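(* Let $n,m\ge 1$ with $m_1\ge1$ and $n_1\ge 1$, and let $\mathcal F=\{f_i\}_{i\ge0}$ be a family as in the context. Consider the following hypotheses: (a) $f_1$ is an odd function, $f_1\ge 0$ on $[0,T]$ and $f_1\not\equiv 0$ on $[0,T]$; (b) for every integer $r\ge 1$, the set $\{f_i^e\}_{i\in\mathcal N_r^{\text{non-odd}}}$, ordered by increasing index, is a CT-system on $(0,T)$; (c) for all integers $k,l\ge 1$, $\tilde F_l^e\tilde f_k^o\in\mathcal B_{k+l-1}\setminus\mathcal B_{k+l-2}$, and moreover $m_1\ge\min\{m-m_1-1,\;n_1-1\}$. Let $\mathcal H_{3,2}(n,m)\in\mathbb N\cup\{+\infty\}$ be the supremum, over all $A\in\operatorname{span}(\mathcal F_n)$ and $B\in\operatorname{span}(\mathcal F_m)$, of the number of limit cycles of the Abel equation $\frac{dx}{dt}=A(t)x^3+B(t)x^2$, $t\in[-T,T]$. Then: (i) if (a) and (b) hold, then $\mathcal H_{3,2}(n,m)\ge 2m_1+1$; (ii) if (a), (b) and (c) hold, then $\mathcal H_{3,2}(n,m)\ge 2\max\{m-m_1+n_1,\;m_1+1\}-1$.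
   Context: Family. Fix $T>0$. $\mathcal F=\{f_i\}_{i=0}^\infty$ is a sequence of real-analytic functions on an open neighborhood of $[-T,T]$ with $f_0(t)>0$ on $[-T,T]$ and $\int_{-T}^Tf_k(t)\,dt=0$ for all $k\ge1$. Put $\mathcal F_k=\{f_0,\dots,f_k\}$ (spans are real linear spans). The even and odd parts of $f_i$ are $f_i^e(t)=\frac{f_i(t)+f_i(-t)}2$ and $f_i^o(t)=\frac{f_i(t)-f_i(-t)}2$, and $F_i^e(t)=\int_{-T}^tf_i^e(s)\,ds$. Index sets and relabeling. $\mathcal N_k=\{0,1,\dots,k\}$, $\mathcal N_k^{\text{non-odd}}=\{i\in\mathcal N_k: f_i^e\not\equiv0\text{ on }[-T,T]\}$. Set $m_1=\#\mathcal N_m^{\text{non-odd}}-1$ and $n_1=\#\mathcal N_n^{\text{non-odd}}-1$. List the indices $i$ with $f_i^e\not\equiv0$ in increasing order as $0=i_0<i_1<i_2<\cdots$ and the indices with $f_i^e\equiv 0$ in increasing order as $j_1<j_2<\cdots$; set $\tilde f_l^e=f_{i_l}^e$, $\tilde F_l^e=F_{i_l}^e$ ($l\ge0$) and $\tilde f_k^o=f_{j_k}^o=f_{j_k}$ ($k\ge1$). (Assumption (c) includes that these are defined for all indices $l,k\ge1$, i.e. $\mathcal F$ contains infinitely many odd and infinitely many non-odd functions. Under (a), $\tilde f_1^o=f_1$.) For $r\ge1$ let $\mathcal B_r=\operatorname{span}\{\tilde F_1^e\tilde f_1^o,\dots,\tilde F_r^e\tilde f_1^o\}$, and $\mathcal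 B_0=\{0\}$. CT-system. An ordered set $(g_0,\dots,g_n)$ of analytic functions on an open interval $I$ is a complete Chebyshev system (CT-system) on $I$ if for every $k\in\{0,\dots,n\}$ every linear combination $\alpha_0g_0+\dots+\alpha_kg_k$ with $(\alpha_0,\dots,\alpha_k)\ne 0$ has at most $k$ zeros on $I$ (in particular it is not identically zero). Limit cycles. A closed solution of an equation $dx/dt=g(t,x)$ on $[-T,T]$ is a solution defined on all of $[-T,T]$ with $x(-T)=x(T)$; a limit cycle is a closed solution that is isolated among closed solutions (i.e. its initial value $x(-T)$ is isolated in the set of initial values of closed solutions). The solution $x\equiv0$ is counted if isolated. *)

theory Defs
  imports "HOL-Analysis.Analysis" "HOL-Library.Extended_Nat" "HOL-Library.Infinite_Set"
begin

definition real_analytic_on :: "(real \<Rightarrow> real) \<Rightarrow> real set \<Rightarrow> bool" where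
  "real_analytic_on g U \<longleftrightarrow>
     (\<forall>x\<in>U. \<exists>r>0. \<exists>a :: nat \<Rightarrow> real.
        \<forall>y. \<bar>y - x\<bar> < r \<longrightarrow> (\<lambda>k. a k * (y - x) ^ k) sums g y)"

definition even_part :: "(real \<Rightarrow> real) \<Rightarrow> real \<Rightarrow> real" where
  "even_part g t = (g t + g (- t)) / 2"

definition odd_part :: "(real \<Rightarrow> real) \<Rightarrow> real \<Rightarrow> real" where
  "odd_part g t = (g t - g (- t)) / 2"

(* Functions of interest live on S = [-T,T] but are represented by total functions;
   all identities between them, and hence membership in a span, are only required on S. *)
definition span_on :: "real set \<Rightarrow> (nat \<Rightarrow> real \<Rightarrow> real) \<Rightarrow> nat set \<Rightarrow> (real \<Rightarrow> real) set" where
  "span_on S g K = {h. \<exists>c :: nat \<Rightarrow> real. \<forall>t\<in>S. h t = (\<Sum>i\<in>K. c i * g i t)}"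

definition CT_system :: "real \<Rightarrow> real \<Rightarrow> (real \<Rightarrow> real) list \<Rightarrow> bool" where
  "CT_system a b gs \<longleftrightarrow>
     (\<forall>g\<in>set gs. real_analytic_on g {a<..<b}) \<and>
     (\<forall>k<length gs. \<forall>\<alpha> :: nat \<Rightarrow> real. (\<exists>i\<le>k. \<alpha> i \<noteq> 0) \<longrightarrow>
        finite {t \<in> {a<..<b}. (\<Sum>i\<le>k. \<alpha> i * (gs ! i) t) = 0} \<and>
        card {t \<in> {a<..<b}. (\<Sum>i\<le>k. \<alpha> i * (gs ! i) t) = 0} \<le> k)"

definition admissible_family :: "real \<Rightarrow> (nat \<Rightarrow> real \<Rightarrow> real) \<Rightarrow> bool" where
  "admissible_family T f \<longleftrightarrow>
     (\<forall>i. \<exists>U. open U \<and> {- T..T} \<subseteq> U \<and> real_analytic_on (f i) U) \<and>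
     (\<forall>t\<in>{- T..T}. f 0 t > 0) \<and>
     (\<forall>k\<ge>1. integral {- T..T} (f k) = 0)"

definition non_odd :: "real \<Rightarrow> (nat \<Rightarrow> real \<Rightarrow> real) \<Rightarrow> nat set" where
  "non_odd T f = {i. \<exists>t\<in>{- T..T}. even_part (f i) t \<noteq> 0}"

definition non_odd_upto :: "real \<Rightarrow> (nat \<Rightarrow> real \<Rightarrow> real) \<Rightarrow> nat \<Rightarrow> nat set" where
  "non_odd_upto T f k = non_odd T f \<inter> {0..k}"

(* For an admissible family the index 0 is non-odd, so the subtraction is not truncated. *)
definition non_odd_count :: "real \<Rightarrow> (nat \<Rightarrow> real \<Rightarrow> real) \<Rightarrow> nat \<Rightarrow> nat" where
  "non_odd_count T f k = card (non_odd_upto T f k) - 1"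

definition Fe :: "real \<Rightarrow> (nat \<Rightarrow> real \<Rightarrow> real) \<Rightarrow> nat \<Rightarrow> real \<Rightarrow> real" where
  "Fe T f i t = integral {- T..t} (even_part (f i))"

(* The relabelings below are meaningful only when non_odd T f, respectively its complement,
   is infinite. The l-th non-odd index is counted from l = 0, the k-th odd one from k = 1. *)
definition Fe_tilde :: "real \<Rightarrow> (nat \<Rightarrow> real \<Rightarrow> real) \<Rightarrow> nat \<Rightarrow> real \<Rightarrow> real" where
  "Fe_tilde T f l = Fe T f (enumerate (non_odd T f) l)"

definition fo_tilde :: "real \<Rightarrow> (nat \<Rightarrow> real \<Rightarrow> real) \<Rightarrow> nat \<Rightarrow> real \<Rightarrow> real" where
  "fo_tilde T f k = odd_part (f (enumerate (- non_odd T f) (k - 1)))"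

(* For r = 0 the sums are empty, so this is {0} on [-T,T]. *)
definition B_space :: "real \<Rightarrow> (nat \<Rightarrow> real \<Rightarrow> real) \<Rightarrow> nat \<Rightarrow> (real \<Rightarrow> real) set" where
  "B_space T f r = span_on {- T..T} (\<lambda>l t. Fe_tilde T f l t * fo_tilde T f 1 t) {1..r}"

definition cond_a :: "real \<Rightarrow> (nat \<Rightarrow> real \<Rightarrow> real) \<Rightarrow> bool" where
  "cond_a T f \<longleftrightarrow>
     (\<forall>t\<in>{- T..T}. f 1 (- t) = - f 1 t) \<and>
     (\<forall>t\<in>{0..T}. f 1 t \<ge> 0) \<and>
     (\<exists>t\<in>{0..T}. f 1 t \<noteq> 0)"

definition cond_b :: "real \<Rightarrow> (nat \<Rightarrow> real \<Rightarrow> real) \<Rightarrow> bool" where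
  "cond_b T f \<longleftrightarrow>
     (\<forall>r\<ge>1. CT_system 0 T
        (map (\<lambda>i. even_part (f i)) (sorted_list_of_set (non_odd_upto T f r))))"

definition cond_c :: "real \<Rightarrow> (nat \<Rightarrow> real \<Rightarrow> real) \<Rightarrow> nat \<Rightarrow> nat \<Rightarrow> bool" where
  "cond_c T f n m \<longleftrightarrow>
     infinite (non_odd T f) \<and> infinite (- non_odd T f) \<and>
     (\<forall>k\<ge>1. \<forall>l\<ge>1.
        (\<lambda>t. Fe_tilde T f l t * fo_tilde T f k t)
          \<in> B_space T f (k + l - 1) - B_space T f (k + l - 2)) \<and>
     int (non_odd_count T f m) \<ge>
       min (int m - int (non_odd_count T f m) - 1) (int (non_odd_count T f n) - 1)"

definition closed_solution ::
    "real \<Rightarrow> (real \<Rightarrow> real \<Rightarrow> real) \<Rightarrow> (real \<Rightarrow> real) \<Rightarrow> bool" where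
  "closed_solution T g x \<longleftrightarrow>
     (\<forall>t\<in>{- T..T}. (x has_real_derivative g t (x t)) (at t within {- T..T})) \<and>
     x (- T) = x T"

(* Restricting to extensional functions identifies solutions that agree on [-T,T], so that
   the cardinality of this set is the number of limit cycles. *)
definition limit_cycles :: "real \<Rightarrow> (real \<Rightarrow> real \<Rightarrow> real) \<Rightarrow> (real \<Rightarrow> real) set" where
  "limit_cycles T g =
     {x \<in> extensional {- T..T}. closed_solution T g x \<and>
        x (- T) isolated_in {y (- T) |y. closed_solution T g y}}"

definition num_limit_cycles :: "real \<Rightarrow> (real \<Rightarrow> real \<Rightarrow> real) \<Rightarrow> enat" where
  "num_limit_cycles T g =
     (if finite (limit_cycles T g) then enat (card (limit_cycles T g)) else \<infinity>)"

definition H32 :: "real \<Rightarrow> (nat \<Rightarrow> real \<Rightarrow> real) \<Rightarrow> nat \<Rightarrow> nat \<Rightarrow> enat" where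
  "H32 T f n m =
     (SUP (A, B) \<in> span_on {- T..T} f {0..n} \<times> span_on {- T..T} f {0..m}.
        num_limit_cycles T (\<lambda>t x. A t * x ^ 3 + B t * x ^ 2))"

end

theory Submission
  imports Defs
begin

text \<open>
Write \<open>A = f\<^sub>1 + \<epsilon> A\<^sub>1\<close> and \<open>B = \<epsilon> b + \<epsilon>\<^sup>2 B\<^sub>1\<close> with \<open>b\<close> odd and \<open>A\<^sub>1\<close> of mean zero.
For a nonvanishing solution \<open>x\<close>, the function \<open>v = 1 / x\<^sup>2\<close> satisfies
\<open>v' = - 2 A \<mp> 2 B sqrt v\<close>, the sign depending on that of \<open>x\<close>. For \<open>\<epsilon> = 0\<close> this is solved by
\<open>V h t = h + 2 G t\<close> with \<open>G\<close> even and nonnegative, a centre, and by symmetry the displacement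
\<open>v T - v (- T)\<close> equals \<open>- 4 \<epsilon>\<^sup>2 M h + o(\<epsilon>\<^sup>2)\<close>, where \<open>M\<close> pairs \<open>B\<^sub>1\<close> with \<open>sqrt V\<close> and \<open>b\<close>
with a primitive of the even part of \<open>A\<^sub>1\<close> over \<open>sqrt V\<close>. The difference of two solutions
solves a linear equation, so two nearby closed solutions would make an integral vanish whose
leading term is \<open>2 \<epsilon>\<^sup>2 M'\<close>; hence every simple zero of \<open>M\<close> yields exactly one limit cycle
nearby with \<open>x > 0\<close>, and, replacing \<open>B\<close> by \<open>- B\<close>, one with \<open>x < 0\<close>. The zero solution is isolated
because \<open>B\<^sub>1\<close> has nonzero mean.

Integrating by parts, \<open>M h\<close> becomes the integral of \<open>g sqrt (h + 2 G)\<close> for a combination \<open>g\<close> of the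
even parts. The Chebyshev property makes the matrix of moments of these even parts against powers
of \<open>G\<close> invertible (multiply \<open>g\<close> by a polynomial in \<open>G\<close> with the same sign changes), so the Taylor
coefficients of \<open>s \<mapsto> \<integral> g sqrt (1 + 2 s G)\<close> can be prescribed up to the order \<open>R\<close> to be those of the
product of the \<open>s - j \<delta>\<close>, \<open>j = 1, ..., R\<close>, which produces \<open>R\<close> simple zeros for small \<open>\<delta>\<close>. In part (i) all of \<open>g\<close> is
carried by \<open>B\<^sub>1\<close>; in part (ii) the terms of low index are carried by \<open>B\<^sub>1\<close> and the others by the
products in (c), one factor of which is kept fixed so that the system to solve is triangular.
\<close>


section \<open>Linear and integral equations\<close>

text \<open>The different orders of \<open>b\<close> and \<open>B1\<close> in B come from parity.
  With \<open>b\<close> odd and \<open>A1\<close> of mean zero nothing survives at order \<epsilon>.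
  At order \<epsilon>^2 the function \<open>b\<close> meets the asymmetry of sqrt v under t -> -t,
  which is itself of order \<epsilon> and is produced by \<open>A1\<close>. So M is linear in
  \<open>B1\<close> and bilinear in (\<open>A1\<close>, \<open>b\<close>), and the bilinear term is
  where the products of (c) enter. A bilinear map cannot simply be inverted; this is the obstacle
  that freezing one factor removes. The variable v is chosen because the unperturbed equation
  becomes v' = - 2 a, solved by one quadrature, so every limit is explicit. No expansion of the flow
  in \<epsilon> and h is set up: the sign of the displacement and the uniqueness near a zero are
  proved by contradiction along sequences with \<epsilon> -> 0, by bounded convergence. The zeros of
  M are sought at large h, that is at small s = 1 / h, where finitely many moments against powers of
  G control the integral. With R zeros the count is R positive, R negative and the zero solution, 2
  R + 1 in all; R is m1 in (i) and m - m1 + n1 - 1 for the new bound in (ii).\<close>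

lemma integral_symmetric_interval:
  fixes g :: "real \<Rightarrow> real"
  assumes "0 \<le> c" "continuous_on {- c..c} g"
  shows "integral {- c..c} g = integral {0..c} (\<lambda>t. g t + g (- t))"
proof -
  have neg: "continuous_on {0..c} (\<lambda>t. g (- t))"
    by (rule continuous_on_compose2[OF assms(2)]) (auto intro!: continuous_intros)
  have pos: "continuous_on {0..c} g"
    by (rule continuous_on_subset[OF assms(2)]) auto
  have "integral {- c..c} g = integral {- c..0} g + integral {0..c} g"
    using assms by (intro Henstock_Kurzweil_Integration.integral_combine[symmetric] integrable_continuous_real) auto
  also have "integral {- c..0} g = integral {0..c} (\<lambda>t. g (- t))"
    using Henstock_Kurzweil_Integration.integral_reflect_real[of c 0 "\<lambda>t. g (- t)"] by simp
  finally show ?thesis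
    using pos neg by (simp add: integral_add integrable_continuous_real)
qed

text \<open>Multiplying \<open>e\<close> by the integrating factor gives a function with derivative
  zero. It is used for the difference of two solutions, for the sign of x, and for v + 3 in
  \<open>no_small_periodic\<close>.\<close>

lemma linear_ode_solution:
  fixes e c :: "real \<Rightarrow> real"
  assumes c: "continuous_on {a..b} c"
    and e: "\<And>t. t \<in> {a..b} \<Longrightarrow> (e has_real_derivative c t * e t) (at t within {a..b})"
    and t: "t \<in> {a..b}"
  shows "e t = e a * exp (integral {a..t} c)"
proof -
  have "((\<lambda>t. e t * exp (- integral {a..t} c)) has_field_derivative 0) (at t within {a..b})"
    if "t \<in> {a..b}" for t
    by (rule derivative_eq_intros e integral_has_real_derivative c that refl)+ (simp add: algebra_simps)
  then obtain k where k: "\<And>t. t \<in> {a..b} \<Longrightarrow> e t * exp (- integral {a..t} c) = k"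
    using has_field_derivative_zero_constant[of "{a..b}" "\<lambda>t. e t * exp (- integral {a..t} c)"]
    by auto
  have "a \<in> {a..b}" using t by auto
  then have "e t * exp (- integral {a..t} c) = e a"
    using k[of a] k[OF t] by simp
  then show ?thesis by (simp add: exp_minus field_simps)
qed

text \<open>Picard's operator is a contraction in the sup norm on the whole interval at once. The
  factor \<open>K * L * (b - a)\<close> will be small because \<open>K\<close> bounds a multiple of
  \<open>coefB\<close>, which is of order \<epsilon>; the contribution of \<open>coefA\<close> does
  not involve the unknown and sits in \<open>P\<close>.\<close>

lemma small_lipschitz_integral_equation:
  fixes P B r :: "real \<Rightarrow> real"
  assumes ab: "a \<le> b" and P: "continuous_on {a..b} P" and B: "continuous_on {a..b} B"
    and K: "\<And>t. t \<in> {a..b} \<Longrightarrow> \<bar>B t\<bar> \<le> K"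
    and r: "\<And>x y. \<bar>r x - r y\<bar> \<le> L * \<bar>x - y\<bar>"
    and small: "K * L * (b - a) < 1"
  obtains v where "continuous_on {a..b} v"
    "\<And>t. t \<in> {a..b} \<Longrightarrow> v t = P t + integral {a..t} (\<lambda>s. B s * r (v s))"
proof -
  \<comment> \<open>The fixed point theorem is applied in the complete space of bounded continuous
    functions on the whole line, so functions on \<open>{a..b}\<close> are extended by constants
    through this clamp.\<close>
  define cl where "cl t = max a (min b t)" for t
  define \<Theta> where "\<Theta> w t = P t + integral {a..t} (\<lambda>s. B s * r (apply_bcontfun w s))"
    for w :: "real \<Rightarrow>\<^sub>C real" and t
  have K0: "K \<ge> 0" using K[of a] ab by force
  have L0: "L \<ge> 0" using order_trans[OF abs_ge_zero r[of 1 0]] by simp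
  have cr: "continuous_on UNIV r"
  proof (rule continuous_onI)
    fix x e :: real assume "e > 0"
    then show "\<exists>d>0. \<forall>x'\<in>UNIV. dist x' x < d \<longrightarrow> dist (r x') (r x) \<le> e"
    proof (intro exI[of _ "e / (L + 1)"] conjI ballI impI)
      fix x' assume "dist x' x < e / (L + 1)"
      then have "L * \<bar>x' - x\<bar> \<le> (L + 1) * (e / (L + 1))"
        using L0 \<open>e > 0\<close> by (intro mult_mono) (auto simp: dist_real_def)
      then show "dist (r x') (r x) \<le> e"
        using r[of x' x] L0 by (simp add: dist_real_def)
    qed (use L0 in auto)
  qed
  have ci: "continuous_on {a..b} (\<lambda>s. B s * r (apply_bcontfun w s))" for w
    by (intro continuous_intros B continuous_on_compose2[OF cr]) auto
  have c\<Theta>: "continuous_on {a..b} (\<Theta> w)" for w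
    unfolding \<Theta>_def
    by (intro continuous_intros P indefinite_integral_continuous_1 integrable_continuous_real ci)
  have cl: "cl t \<in> {a..b}" for t using ab by (auto simp: cl_def)
  have mem: "(\<lambda>t. \<Theta> w (cl t)) \<in> bcontfun" for w
  proof -
    have "continuous_on UNIV (\<lambda>t. \<Theta> w (cl t))"
      by (rule continuous_on_compose2[OF c\<Theta>]) (use cl in \<open>auto simp: cl_def intro!: continuous_intros\<close>)
    moreover have "bounded (\<Theta> w ` {a..b})"
      by (intro compact_imp_bounded compact_continuous_image c\<Theta>) auto
    ultimately show ?thesis
      using cl by (auto simp: bcontfun_def intro: bounded_subset)
  qed
  define \<Psi> where "\<Psi> w = Bcontfun (\<lambda>t. \<Theta> w (cl t))" for w
  have \<Psi>: "apply_bcontfun (\<Psi> w) t = \<Theta> w (cl t)" for w t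
    unfolding \<Psi>_def using mem[of w] by (simp add: Bcontfun_inverse)
  have "dist (\<Psi> w) (\<Psi> u) \<le> (K * L * (b - a)) * dist w u" for w u
  proof (rule dist_bound)
    fix t
    let ?c = "cl t"
    let ?g = "\<lambda>s. B s * r (apply_bcontfun w s) - B s * r (apply_bcontfun u s)"
    have sub: "{a..?c} \<subseteq> {a..b}" using cl[of t] by auto
    have "dist (apply_bcontfun (\<Psi> w) t) (apply_bcontfun (\<Psi> u) t) = \<bar>integral {a..?c} ?g\<bar>"
      using continuous_on_subset[OF ci sub]
      by (simp add: \<Psi> \<Theta>_def dist_real_def integral_diff integrable_continuous_real)
    also have "\<dots> \<le> (K * (L * dist w u)) * (?c - a)"
    proof (rule integral_bound[where 'a=real, unfolded real_norm_def])
      show "continuous_on {a..?c} ?g"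
        by (intro continuous_on_subset[OF _ sub] continuous_on_diff ci)
      fix s assume s: "s \<in> {a..?c}"
      have "?g s = B s * (r (apply_bcontfun w s) - r (apply_bcontfun u s))"
        by (simp add: algebra_simps)
      also have "\<bar>\<dots>\<bar> \<le> K * (L * dist w u)"
        unfolding abs_mult
      proof (intro mult_mono K)
        have "L * \<bar>apply_bcontfun w s - apply_bcontfun u s\<bar> \<le> L * dist w u"
          using dist_bounded[of w s u] L0 by (intro mult_left_mono) (auto simp: dist_real_def)
        then show "\<bar>r (apply_bcontfun w s) - r (apply_bcontfun u s)\<bar> \<le> L * dist w u"
          using r[of "apply_bcontfun w s" "apply_bcontfun u s"] by linarith
      qed (use s sub K0 in auto)
      finally show "\<bar>?g s\<bar> \<le> K * (L * dist w u)" .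
    qed (use cl[of t] in auto)
    also have "\<dots> \<le> (K * (L * dist w u)) * (b - a)"
      using cl[of t] K0 L0 by (intro mult_left_mono) auto
    finally show "dist (apply_bcontfun (\<Psi> w) t) (apply_bcontfun (\<Psi> u) t)
        \<le> K * L * (b - a) * dist w u" by (simp add: mult_ac)
  qed
  moreover have "0 \<le> K * L * (b - a)" using K0 L0 ab by simp
  ultimately obtain w where w: "\<Psi> w = w"
    using banach_fix_type[of "K * L * (b - a)" \<Psi>] small by blast
  show thesis
  proof (rule that[of "apply_bcontfun w"])
    show "continuous_on {a..b} (apply_bcontfun w)" by simp
    fix t assume "t \<in> {a..b}"
    then show "apply_bcontfun w t = P t + integral {a..t} (\<lambda>s. B s * r (apply_bcontfun w s))"
      using \<Psi>[of w t] unfolding w by (simp add: \<Theta>_def cl_def)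
  qed
qed

section \<open>The perturbed Abel equation\<close>

lemma sqrt_diff_le:
  assumes "0 < m" "m \<le> x" "m \<le> y"
  shows "\<bar>sqrt x - sqrt y\<bar> \<le> \<bar>x - y\<bar> / (2 * sqrt m)"
proof -
  have pos: "sqrt m \<le> sqrt x" "sqrt m \<le> sqrt y" "0 < sqrt m" using assms by auto
  have "x - y = (sqrt x - sqrt y) * (sqrt x + sqrt y)"
    using assms by (simp add: algebra_simps)
  then have "\<bar>x - y\<bar> = \<bar>sqrt x - sqrt y\<bar> * (sqrt x + sqrt y)"
    using pos by (simp add: abs_mult)
  also have "\<dots> \<ge> \<bar>sqrt x - sqrt y\<bar> * (2 * sqrt m)"
    using pos by (intro mult_left_mono; linarith)
  finally show ?thesis using pos by (simp add: field_simps)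
qed

locale abel_perturbation =
  fixes T :: real and a A1 b B1 :: "real \<Rightarrow> real"
  assumes T_pos: "0 < T"
    and cont_a: "continuous_on {- T..T} a" and cont_A1: "continuous_on {- T..T} A1"
    and cont_b: "continuous_on {- T..T} b" and cont_B1: "continuous_on {- T..T} B1"
    and a_odd: "\<And>t. t \<in> {- T..T} \<Longrightarrow> a (- t) = - a t"
    and b_odd: "\<And>t. t \<in> {- T..T} \<Longrightarrow> b (- t) = - b t"
    and a_nonneg: "\<And>t. t \<in> {0..T} \<Longrightarrow> 0 \<le> a t"
    and integral_A1: "integral {- T..T} A1 = 0"
begin

definition coefA :: "real \<Rightarrow> real \<Rightarrow> real" where
  "coefA \<epsilon> t = a t + \<epsilon> * A1 t"

definition coefB :: "real \<Rightarrow> real \<Rightarrow> real" where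
  "coefB \<epsilon> t = \<epsilon> * b t + \<epsilon>\<^sup>2 * B1 t"

definition abel :: "real \<Rightarrow> real \<Rightarrow> real \<Rightarrow> real" where
  "abel \<epsilon> t x = coefA \<epsilon> t * x ^ 3 + coefB \<epsilon> t * x ^ 2"

text \<open>A primitive of \<open>- a\<close>; as \<open>a\<close> is odd it equals the integral of
  \<open>a\<close> over [t, T], which makes it even, nonnegative and zero at both ends.\<close>

definition G :: "real \<Rightarrow> real" where
  "G t = - integral {- T..t} a"

definition V :: "real \<Rightarrow> real \<Rightarrow> real" where
  "V h t = h + 2 * G t"

text \<open>Half of the integral of \<open>A1\<close> over [-t, t], the only trace that
  \<open>A1\<close> leaves in the second-order term.\<close>

definition \<Phi> :: "real \<Rightarrow> real" where
  "\<Phi> t = integral {0..t} (even_part A1)"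

definition melnikov :: "real \<Rightarrow> real" where
  "melnikov h =
     integral {0..T} (\<lambda>t. even_part B1 t * sqrt (V h t) - b t * \<Phi> t / sqrt (V h t))"

text \<open>The derivative of \<open>melnikov\<close> (see \<open>melnikov_deriv\<close>), written
  out because \<open>quotient_lim\<close> yields this formula directly.\<close>

definition melnikov' :: "real \<Rightarrow> real" where
  "melnikov' h =
     integral {0..T} (\<lambda>t. even_part B1 t / (2 * sqrt (V h t)) + b t * \<Phi> t / (2 * V h t * sqrt (V h t)))"

(* v = 1 / x^2 along a nowhere vanishing solution x of the Abel equation *)
definition sol :: "real \<Rightarrow> real \<Rightarrow> (real \<Rightarrow> real) \<Rightarrow> bool" where
  "sol \<epsilon> h v \<longleftrightarrow> continuous_on {- T..T} v \<and>
     (\<forall>t\<in>{- T..T}. 0 < v t \<and>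
        v t = h - 2 * integral {- T..t} (coefA \<epsilon>)
                - 2 * integral {- T..t} (\<lambda>s. coefB \<epsilon> s * sqrt (v s)))"

lemma cont_coef: "continuous_on {- T..T} (coefA \<epsilon>)" "continuous_on {- T..T} (coefB \<epsilon>)"
  unfolding coefA_def coefB_def
  by (intro continuous_intros cont_a cont_A1 cont_b cont_B1)+

lemma integral_split:
  assumes "continuous_on {- T..T} g" "t \<in> {0..T}"
  shows "integral {- T..t} g - integral {- T..- t} g = integral {- t..t} (g :: real \<Rightarrow> real)"
proof -
  have "integral {- T..- t} g + integral {- t..t} g = integral {- T..t} g"
    using assms
    by (intro Henstock_Kurzweil_Integration.integral_combine integrable_continuous_real
        continuous_on_subset[OF assms(1)]) auto
  then show ?thesis by simp
qed

lemma integral_odd: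
  assumes "continuous_on {- T..T} g" "\<And>t. t \<in> {- T..T} \<Longrightarrow> g (- t) = - g t" "t \<in> {0..T}"
  shows "integral {- t..t} g = (0 :: real)"
proof -
  have "integral {- t..t} g = integral {0..t} (\<lambda>s. g s + g (- s))"
    using assms by (intro integral_symmetric_interval continuous_on_subset[OF assms(1)]) auto
  also have "\<dots> = integral {0..t} (\<lambda>s. 0)"
    using assms by (intro integral_cong) auto
  finally show ?thesis by simp
qed

lemma integral_A1_eq:
  assumes "t \<in> {0..T}"
  shows "integral {- t..t} A1 = 2 * \<Phi> t"
proof -
  have "integral {- t..t} A1 = integral {0..t} (\<lambda>s. A1 s + A1 (- s))"
    using assms by (intro integral_symmetric_interval continuous_on_subset[OF cont_A1]) auto
  also have "\<dots> = integral {0..t} (\<lambda>s. 2 * even_part A1 s)"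
    by (intro integral_cong) (simp add: even_part_def)
  finally show ?thesis by (simp add: \<Phi>_def)
qed

lemma integral_coefA:
  assumes "t \<in> {0..T}"
  shows "integral {- t..t} (coefA \<epsilon>) = 2 * \<epsilon> * \<Phi> t"
proof -
  have sub: "{- t..t} \<subseteq> {- T..T}" using assms by auto
  have "integral {- t..t} (coefA \<epsilon>) = integral {- t..t} a + \<epsilon> * integral {- t..t} A1"
    unfolding coefA_def using continuous_on_subset[OF cont_a sub] continuous_on_subset[OF cont_A1 sub]
    by (subst integral_add) (auto intro!: integrable_continuous_real continuous_intros)
  then show ?thesis using integral_odd[OF cont_a a_odd assms] integral_A1_eq[OF assms] by simp
qed

lemma \<Phi>_T: "\<Phi> T = 0"
  using integral_A1_eq[of T] integral_A1 T_pos by simp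

lemma G_even:
  assumes "t \<in> {- T..T}"
  shows "G (- t) = G t"
proof -
  have "G (- s) = G s" if "s \<in> {0..T}" for s
    using integral_split[OF cont_a that] integral_odd[OF cont_a a_odd that] by (simp add: G_def)
  from this[of t] this[of "- t"] show ?thesis using assms by (cases "t \<ge> 0") auto
qed

lemma G_decreasing:
  assumes "0 \<le> s" "s \<le> t" "t \<le> T"
  shows "G t \<le> G s"
proof -
  have "integral {- T..s} a + integral {s..t} a = integral {- T..t} a"
    using assms T_pos
    by (intro Henstock_Kurzweil_Integration.integral_combine integrable_continuous_real
        continuous_on_subset[OF cont_a]) auto
  moreover have "0 \<le> integral {s..t} a"
    using assms T_pos
    by (intro integral_nonneg integrable_continuous_real continuous_on_subset[OF cont_a] a_nonneg) auto
  ultimately show ?thesis by (simp add: G_def)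
qed

lemma G_T: "G T = 0"
  using integral_odd[OF cont_a a_odd, of T] T_pos by (simp add: G_def)

lemma G_nonneg: "t \<in> {- T..T} \<Longrightarrow> 0 \<le> G t"
  using G_decreasing[of "\<bar>t\<bar>" T] G_even[of t] G_T by (cases "t \<ge> 0") auto

lemma cont_G: "continuous_on {- T..T} G"
  unfolding G_def
  by (intro continuous_intros indefinite_integral_continuous_1 integrable_continuous_real cont_a)

lemma cont_V: "continuous_on {- T..T} (V h)"
  unfolding V_def by (intro continuous_intros cont_G)

lemma V_ge: "t \<in> {- T..T} \<Longrightarrow> h \<le> V h t"
  using G_nonneg by (simp add: V_def)

lemma V_even: "t \<in> {- T..T} \<Longrightarrow> V h (- t) = V h t"
  using G_even by (simp add: V_def)

lemma cont_\<Phi>: "continuous_on {0..T} \<Phi>"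
proof -
  have "continuous_on {0..T} (\<lambda>t. A1 (- t))"
    by (rule continuous_on_compose2[OF cont_A1]) (auto intro!: continuous_intros)
  then show ?thesis
    unfolding \<Phi>_def even_part_def using T_pos
    by (intro indefinite_integral_continuous_1 integrable_continuous_real continuous_intros
        continuous_on_subset[OF cont_A1]) auto
qed

lemma cont_even_part:
  assumes "continuous_on {- T..T} g"
  shows "continuous_on {0..T} (even_part g)"
proof -
  have "continuous_on {0..T} (\<lambda>t. g (- t))"
    by (rule continuous_on_compose2[OF assms]) (auto intro!: continuous_intros)
  then show ?thesis unfolding even_part_def using T_pos
    by (intro continuous_intros continuous_on_subset[OF assms]) auto
qed

section \<open>Solutions of the equation for v: comparison, uniqueness, existence\<close>

lemma sol_cont: "sol \<epsilon> h v \<Longrightarrow> continuous_on {- T..T} v"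
  by (simp add: sol_def)

lemma sol_pos: "sol \<epsilon> h v \<Longrightarrow> t \<in> {- T..T} \<Longrightarrow> 0 < v t"
  by (metis sol_def)

lemma sol_eq:
  assumes "sol \<epsilon> h v" "t \<in> {- T..T}"
  shows "v t = h - 2 * integral {- T..t} (coefA \<epsilon>)
                - 2 * integral {- T..t} (\<lambda>s. coefB \<epsilon> s * sqrt (v s))"
  by (rule conjunct2[OF bspec[OF conjunct2[OF assms(1)[unfolded sol_def]] assms(2)]])

lemma sol_init: "sol \<epsilon> h v \<Longrightarrow> v (- T) = h"
  using sol_eq[of \<epsilon> h v "- T"] T_pos by simp

lemma sol_deriv:
  assumes "sol \<epsilon> h v" "t \<in> {- T..T}"
  shows "(v has_real_derivative - 2 * coefA \<epsilon> t - 2 * coefB \<epsilon> t * sqrt (v t)) (at t within {- T..T})"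
proof -
  have c: "continuous_on {- T..T} (\<lambda>s. coefB \<epsilon> s * sqrt (v s))"
    by (intro continuous_intros cont_coef sol_cont[OF assms(1)])
  have "((\<lambda>t. h - 2 * integral {- T..t} (coefA \<epsilon>)
          - 2 * integral {- T..t} (\<lambda>s. coefB \<epsilon> s * sqrt (v s))) has_real_derivative
        - 2 * coefA \<epsilon> t - 2 * coefB \<epsilon> t * sqrt (v t)) (at t within {- T..T})"
    by (rule derivative_eq_intros integral_has_real_derivative cont_coef c assms(2) refl)+ simp
  then show ?thesis
    by (rule has_field_derivative_transform_within[OF _ zero_less_one assms(2)])
       (rule sol_eq[OF assms(1), symmetric])
qed

text \<open>\<open>coefA\<close> cancels in the difference, and sqrt w - sqrt v is (w - v) / (sqrt v
  + sqrt w), so w - v solves a linear equation. Uniqueness, Lipschitz dependence on h and the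
  criterion for two closed solutions all come from this formula.\<close>

lemma sol_diff:
  assumes v: "sol \<epsilon> h v" and w: "sol \<epsilon> k w" and t: "t \<in> {- T..T}"
  shows "w t - v t = (k - h) *
    exp (- 2 * integral {- T..t} (\<lambda>s. coefB \<epsilon> s / (sqrt (v s) + sqrt (w s))))"
proof -
  let ?c = "\<lambda>s. - 2 * (coefB \<epsilon> s / (sqrt (v s) + sqrt (w s)))"
  have "w t - v t = (w (- T) - v (- T)) * exp (integral {- T..t} ?c)"
  proof (rule linear_ode_solution[where e = "\<lambda>t. w t - v t"])
    show "continuous_on {- T..T} ?c"
    proof (intro continuous_intros cont_coef sol_cont[OF v] sol_cont[OF w] ballI)
      fix s assume "s \<in> {- T..T}"
      then show "sqrt (v s) + sqrt (w s) \<noteq> 0"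
        using sol_pos[OF v, of s] sol_pos[OF w, of s]
        by (smt (verit) real_sqrt_gt_zero)
    qed
    fix s assume s: "s \<in> {- T..T}"
    have pos: "0 < sqrt (v s)" "0 < sqrt (w s)" "0 < v s" "0 < w s"
      "sqrt (v s) + sqrt (w s) \<noteq> 0"
      using sol_pos[OF v s] sol_pos[OF w s] by (auto simp: add_pos_pos less_imp_neq[symmetric])
    have "w s - v s = (sqrt (w s) - sqrt (v s)) * (sqrt (v s) + sqrt (w s))"
      using pos by (simp add: algebra_simps)
    then have "?c s * (w s - v s) = - 2 * coefB \<epsilon> s * (sqrt (w s) - sqrt (v s))"
      using pos by simp
    then show "((\<lambda>t. w t - v t) has_real_derivative ?c s * (w s - v s)) (at s within {- T..T})"
      by (intro DERIV_cong[OF DERIV_diff[OF sol_deriv[OF w s] sol_deriv[OF v s]]])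
         (simp add: algebra_simps)
  qed (rule t)
  moreover have "integral {- T..t} ?c =
      - 2 * integral {- T..t} (\<lambda>s. coefB \<epsilon> s / (sqrt (v s) + sqrt (w s)))"
    by (rule integral_mult_right)
  ultimately show ?thesis
    by (simp only: sol_init[OF v] sol_init[OF w])
qed

lemma sol_unique:
  assumes "sol \<epsilon> h v" "sol \<epsilon> h w" "t \<in> {- T..T}"
  shows "w t = v t"
  using sol_diff[OF assms] by simp

lemma integral_coefA_eq:
  assumes "t \<in> {- T..T}"
  shows "integral {- T..t} (coefA \<epsilon>) = - G t + \<epsilon> * integral {- T..t} A1"
proof -
  have sub: "{- T..t} \<subseteq> {- T..T}" using assms by auto
  show ?thesis
    unfolding coefA_def G_def using continuous_on_subset[OF cont_a sub] continuous_on_subset[OF cont_A1 sub]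
    by (subst integral_add) (auto intro!: integrable_continuous_real continuous_intros)
qed

lemma exists_bound:
  obtains N where "0 < N" "\<And>t. t \<in> {- T..T} \<Longrightarrow> \<bar>A1 t\<bar> \<le> N"
    "\<And>t. t \<in> {- T..T} \<Longrightarrow> \<bar>b t\<bar> \<le> N" "\<And>t. t \<in> {- T..T} \<Longrightarrow> \<bar>B1 t\<bar> \<le> N"
    "\<And>t. t \<in> {- T..T} \<Longrightarrow> \<bar>a t\<bar> \<le> N" "\<And>t. t \<in> {- T..T} \<Longrightarrow> G t \<le> N"
proof -
  define N where "N t = \<bar>A1 t\<bar> + \<bar>b t\<bar> + \<bar>B1 t\<bar> + \<bar>a t\<bar> + \<bar>G t\<bar>" for t
  have "continuous_on {- T..T} N"
    unfolding N_def by (intro continuous_intros cont_A1 cont_b cont_B1 cont_a cont_G)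
  then have "bdd_above (N ` {- T..T})"
    by (intro bounded_imp_bdd_above compact_imp_bounded compact_continuous_image) auto
  then obtain M where "\<forall>x\<in>N ` {- T..T}. x \<le> M"
    unfolding bdd_above_def by blast
  then have M: "N t \<le> M" if "t \<in> {- T..T}" for t
    using that by blast
  show thesis
    by (rule that[of "max M 1"]) (use M in \<open>force simp: N_def\<close>)+
qed

text \<open>The square root is not Lipschitz near 0, so the equation is solved with a truncated
  root; for small \<epsilon> the solution stays close to \<open>V h\<close>, which is at least
  \<kappa>, and the truncation is never active. One threshold and one constant serve all h in
  [\<kappa>, H].\<close>

lemma sol_exists_bounds:
  assumes "0 < \<kappa>" "\<kappa> \<le> H"
  obtains \<epsilon>1 C Z where "0 < \<epsilon>1" "0 \<le> C"
    "\<And>\<epsilon> h. 0 < \<epsilon> \<Longrightarrow> \<epsilon> < \<epsilon>1 \<Longrightarrow> \<kappa> \<le> h \<Longrightarrow> h \<le> H \<Longrightarrow> \<exists>v. sol \<epsilon> h v"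
    "\<And>\<epsilon> h v t. 0 < \<epsilon> \<Longrightarrow> \<epsilon> < \<epsilon>1 \<Longrightarrow> \<kappa> \<le> h \<Longrightarrow> h \<le> H \<Longrightarrow> sol \<epsilon> h v \<Longrightarrow> t \<in> {- T..T} \<Longrightarrow>
       \<bar>v t - V h t\<bar> \<le> C * \<epsilon> \<and> \<kappa> / 2 \<le> v t \<and> v t \<le> Z"
proof -
  obtain N where N: "0 < N" and NA: "\<And>t. t \<in> {- T..T} \<Longrightarrow> \<bar>A1 t\<bar> \<le> N"
    and Nb: "\<And>t. t \<in> {- T..T} \<Longrightarrow> \<bar>b t\<bar> \<le> N" and NB: "\<And>t. t \<in> {- T..T} \<Longrightarrow> \<bar>B1 t\<bar> \<le> N"
    and "\<And>t. t \<in> {- T..T} \<Longrightarrow> \<bar>a t\<bar> \<le> N"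
    and NG: "\<And>t. t \<in> {- T..T} \<Longrightarrow> G t \<le> N"
    by (rule exists_bound) (rule that)
  \<comment> \<open>\<open>r\<close> is the root truncated to [m, Z], with Lipschitz constant
    \<open>L\<close>. \<open>C * \<epsilon>\<close> adds the contributions of \<open>A1\<close> and
    of the truncated root to the distance from \<open>V h\<close>. The last two entries of
    \<open>\<epsilon>1\<close> give the contraction condition and \<open>C * \<epsilon> < m\<close>,
    which keeps the solution in [m, Z].\<close>
  define m where "m = \<kappa> / 2"
  define Z where "Z = H + 2 * N + m"
  define r where "r y = sqrt (max m (min Z y))" for y
  define L where "L = 1 / (2 * sqrt m)"
  define C where "C = 4 * T * N * (1 + 2 * sqrt Z)"
  define \<epsilon>1 where "\<epsilon>1 = min 1 (min (1 / (8 * N * L * T)) (m / C))"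
  have m: "0 < m" "m \<le> Z" "0 < Z" using assms N by (auto simp: m_def Z_def)
  have L: "0 < L" using m by (simp add: L_def)
  have C: "0 < C" unfolding C_def using T_pos N m by (intro mult_pos_pos add_pos_nonneg) auto
  have \<epsilon>1: "0 < \<epsilon>1" using m L C N T_pos by (simp add: \<epsilon>1_def)
  have rZ: "\<bar>r y\<bar> \<le> sqrt Z" for y using m by (auto simp: r_def)
  have rL: "\<bar>r x - r y\<bar> \<le> L * \<bar>x - y\<bar>" for x y
  proof -
    have "\<bar>r x - r y\<bar> \<le> \<bar>max m (min Z x) - max m (min Z y)\<bar> / (2 * sqrt m)"
      unfolding r_def by (rule sqrt_diff_le) (use m in auto)
    also have "\<dots> \<le> \<bar>x - y\<bar> / (2 * sqrt m)"
      using m by (intro divide_right_mono) (auto simp: max_def min_def)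
    finally show ?thesis by (simp add: L_def)
  qed
  have main: "\<exists>v. sol \<epsilon> h v \<and> (\<forall>t\<in>{- T..T}. \<bar>v t - V h t\<bar> \<le> C * \<epsilon> \<and> m \<le> v t \<and> v t \<le> Z)"
    if \<epsilon>: "0 < \<epsilon>" "\<epsilon> < \<epsilon>1" and h: "\<kappa> \<le> h" "h \<le> H" for \<epsilon> h
  proof -
    have \<epsilon>': "\<epsilon> < 1" "\<epsilon> < 1 / (8 * N * L * T)" "\<epsilon> < m / C" using \<epsilon> by (auto simp: \<epsilon>1_def)
    have NcB: "\<bar>coefB \<epsilon> t\<bar> \<le> 2 * N * \<epsilon>" if "t \<in> {- T..T}" for t
    proof -
      have "\<bar>coefB \<epsilon> t\<bar> \<le> \<epsilon> * \<bar>b t\<bar> + \<epsilon>\<^sup>2 * \<bar>B1 t\<bar>"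
        unfolding coefB_def using \<epsilon> by (intro order_trans[OF abs_triangle_ineq]) (simp add: abs_mult)
      also have "\<dots> \<le> \<epsilon> * N + \<epsilon> * N"
        using \<epsilon> \<epsilon>' Nb[OF that] NB[OF that] N
        by (intro add_mono mult_mono) (auto simp: power2_eq_square)
      finally show ?thesis by simp
    qed
    have NrB: "\<bar>- 2 * coefB \<epsilon> t\<bar> \<le> 4 * N * \<epsilon>" if "t \<in> {- T..T}" for t
      using NcB[OF that] by (simp add: abs_mult)
    have small: "4 * N * \<epsilon> * L * (T - - T) < 1"
      using \<epsilon>'(2) N L T_pos by (simp add: field_simps)
    obtain v where cv: "continuous_on {- T..T} v"
      and v: "\<And>t. t \<in> {- T..T} \<Longrightarrow> v t = (h - 2 * integral {- T..t} (coefA \<epsilon>))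
        + integral {- T..t} (\<lambda>s. (- 2 * coefB \<epsilon> s) * r (v s))"
    proof (rule small_lipschitz_integral_equation[where P = "\<lambda>t. h - 2 * integral {- T..t} (coefA \<epsilon>)" and B = "\<lambda>t. - 2 * coefB \<epsilon> t" and r = r, OF _ _ _ NrB rL small])
      show "continuous_on {- T..T} (\<lambda>t. h - 2 * integral {- T..t} (coefA \<epsilon>))"
        by (intro continuous_intros indefinite_integral_continuous_1 integrable_continuous_real cont_coef)
      show "continuous_on {- T..T} (\<lambda>t. - 2 * coefB \<epsilon> t)"
        by (intro continuous_intros cont_coef)
    qed (use T_pos in auto)
    have v': "v t = h - 2 * integral {- T..t} (coefA \<epsilon>)
        - 2 * integral {- T..t} (\<lambda>s. coefB \<epsilon> s * r (v s))" if "t \<in> {- T..T}" for t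
      using v[OF that] integral_mult_right[of "{- T..t}" "- 2" "\<lambda>s. coefB \<epsilon> s * r (v s)"]
      by (simp add: mult.assoc)
    have cr: "continuous_on {- T..T} (\<lambda>s. coefB \<epsilon> s * r (v s))"
      unfolding r_def by (intro continuous_intros cont_coef cv)
    have close: "\<bar>v t - V h t\<bar> \<le> C * \<epsilon>" if t: "t \<in> {- T..T}" for t
    proof -
      have sub: "{- T..t} \<subseteq> {- T..T}" using t by auto
      have 1: "\<bar>integral {- T..t} A1\<bar> \<le> N * (2 * T)"
      proof -
        have "norm (integral {- T..t} A1) \<le> N * (t - - T)"
          by (rule integral_bound) (use t NA continuous_on_subset[OF cont_A1 sub] in auto)
        also have "\<dots> \<le> N * (2 * T)" using t N by (intro mult_left_mono) auto
        finally show ?thesis by simp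
      qed
      have 2: "\<bar>integral {- T..t} (\<lambda>s. coefB \<epsilon> s * r (v s))\<bar> \<le> (2 * N * \<epsilon> * sqrt Z) * (2 * T)"
      proof -
        have "norm (integral {- T..t} (\<lambda>s. coefB \<epsilon> s * r (v s))) \<le> (2 * N * \<epsilon> * sqrt Z) * (t - - T)"
        proof (rule integral_bound)
          fix s assume "s \<in> {- T..t}"
          then show "norm (coefB \<epsilon> s * r (v s)) \<le> 2 * N * \<epsilon> * sqrt Z"
            unfolding real_norm_def abs_mult
            using NcB[of s] rZ t N \<epsilon> by (intro mult_mono) auto
        qed (use t continuous_on_subset[OF cr sub] in auto)
        also have "\<dots> \<le> (2 * N * \<epsilon> * sqrt Z) * (2 * T)"
          using t N \<epsilon> m by (intro mult_left_mono) auto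
        finally show ?thesis by simp
      qed
      have eq: "v t - V h t = - 2 * (\<epsilon> * integral {- T..t} A1)
          - 2 * integral {- T..t} (\<lambda>s. coefB \<epsilon> s * r (v s))"
        using v'[OF t] integral_coefA_eq[OF t, of \<epsilon>] by (simp add: V_def)
      have "\<bar>\<epsilon> * integral {- T..t} A1\<bar> \<le> \<epsilon> * (N * (2 * T))"
        using 1 \<epsilon> by (simp add: abs_mult)
      then have "\<bar>v t - V h t\<bar> \<le> 2 * (\<epsilon> * (N * (2 * T))) + 2 * ((2 * N * \<epsilon> * sqrt Z) * (2 * T))"
        using 2 unfolding eq by linarith
      also have "\<dots> = C * \<epsilon>" by (simp add: C_def algebra_simps)
      finally show ?thesis .
    qed
    have Cm: "C * \<epsilon> < m" using \<epsilon>'(3) C by (simp add: field_simps)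
    have bnd: "m \<le> v t \<and> v t \<le> Z" if t: "t \<in> {- T..T}" for t
    proof -
      have "V h t \<le> H + 2 * N" using NG[OF t] h by (simp add: V_def)
      then show ?thesis
        using close[OF t] Cm V_ge[OF t, of h] h by (auto simp: m_def Z_def)
    qed
    have rv: "r (v t) = sqrt (v t)" if "t \<in> {- T..T}" for t
      using bnd[OF that] by (simp add: r_def)
    have "sol \<epsilon> h v"
      unfolding sol_def
    proof (intro conjI ballI cv)
      fix t assume t: "t \<in> {- T..T}"
      show "0 < v t" using bnd[OF t] m by linarith
      have "integral {- T..t} (\<lambda>s. coefB \<epsilon> s * r (v s)) = integral {- T..t} (\<lambda>s. coefB \<epsilon> s * sqrt (v s))"
        using t by (intro integral_cong) (auto simp: rv)
      then show "v t = h - 2 * integral {- T..t} (coefA \<epsilon>)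
          - 2 * integral {- T..t} (\<lambda>s. coefB \<epsilon> s * sqrt (v s))"
        using v'[OF t] by simp
    qed
    then show ?thesis using close bnd by blast
  qed
  show thesis
  proof (rule that[OF \<epsilon>1 less_imp_le[OF C]])
    fix \<epsilon> h :: real
    assume 1: "0 < \<epsilon>" "\<epsilon> < \<epsilon>1" "\<kappa> \<le> h" "h \<le> H"
    from main[OF this] obtain v where v: "sol \<epsilon> h v"
      "\<forall>t\<in>{- T..T}. \<bar>v t - V h t\<bar> \<le> C * \<epsilon> \<and> m \<le> v t \<and> v t \<le> Z" by blast
    then show "\<exists>v. sol \<epsilon> h v" by blast
    \<comment> \<open>The bounds are known for the constructed solution; uniqueness carries them
      over to every solution with the same initial value.\<close>
    fix w t assume "sol \<epsilon> h w" "t \<in> {- T..T}"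
    then show "\<bar>w t - V h t\<bar> \<le> C * \<epsilon> \<and> \<kappa> / 2 \<le> w t \<and> w t \<le> Z"
      using v sol_unique[OF v(1), of w t] by (simp add: m_def)
  qed
qed

section \<open>Passage between v and positive solutions x of the Abel equation\<close>

lemma sol_imp_abel:
  assumes v: "sol \<epsilon> h v" and t: "t \<in> {- T..T}"
  shows "((\<lambda>t. 1 / sqrt (v t)) has_real_derivative abel \<epsilon> t (1 / sqrt (v t))) (at t within {- T..T})"
proof -
  have p: "0 < v t" "0 < sqrt (v t)" using sol_pos[OF v t] by auto
  have sq: "sqrt (v t) * (sqrt (v t) * x) = v t * x" for x
    using p by (simp add: mult.assoc[symmetric])
  have "((\<lambda>t. 1 / sqrt (v t)) has_real_derivative
      - ((- 2 * coefA \<epsilon> t - 2 * coefB \<epsilon> t * sqrt (v t)) * (inverse (sqrt (v t)) / 2)) / (sqrt (v t) * sqrt (v t)))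
      (at t within {- T..T})"
    using p by (auto intro!: derivative_eq_intros sol_deriv[OF v t])
  also have "- ((- 2 * coefA \<epsilon> t - 2 * coefB \<epsilon> t * sqrt (v t)) * (inverse (sqrt (v t)) / 2)) / (sqrt (v t) * sqrt (v t))
      = abel \<epsilon> t (1 / sqrt (v t))"
    using p by (simp add: abel_def field_simps power3_eq_cube power2_eq_square sq)
  finally show ?thesis .
qed

text \<open>Along a given x the equation reads x' = (A x^2 + B x) x, linear with a continuous
  coefficient, so x keeps the sign of its initial value and 1 / x^2 is defined on the whole
  interval.\<close>

lemma abel_imp_sol:
  assumes x: "\<And>t. t \<in> {- T..T} \<Longrightarrow> (x has_real_derivative abel \<epsilon> t (x t)) (at t within {- T..T})"
    and x0: "0 < x (- T)"
  shows "sol \<epsilon> (1 / (x (- T))\<^sup>2) (\<lambda>t. 1 / (x t)\<^sup>2)" "t \<in> {- T..T} \<Longrightarrow> 0 < x t"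
proof -
  let ?c = "\<lambda>t. coefA \<epsilon> t * (x t)\<^sup>2 + coefB \<epsilon> t * x t"
  let ?v = "\<lambda>t. 1 / (x t)\<^sup>2"
  have cx: "continuous_on {- T..T} x"
    by (rule DERIV_continuous_on[OF x])
  have pos: "0 < x t" if t: "t \<in> {- T..T}" for t
  proof -
    have "x t = x (- T) * exp (integral {- T..t} ?c)"
    proof (rule linear_ode_solution[where c = ?c, OF _ _ t])
      show "continuous_on {- T..T} ?c" by (intro continuous_intros cont_coef cx)
      fix s assume "s \<in> {- T..T}"
      from x[OF this] show "(x has_real_derivative ?c s * x s) (at s within {- T..T})"
        by (rule DERIV_cong) (simp add: abel_def power3_eq_cube power2_eq_square algebra_simps)
    qed
    then show ?thesis using x0 by simp
  qed
  then show "t \<in> {- T..T} \<Longrightarrow> 0 < x t" .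
  have cv: "continuous_on {- T..T} ?v"
    using pos by (intro continuous_intros cx) force
  have sv: "sqrt (?v t) = 1 / x t" if "t \<in> {- T..T}" for t
    using pos[OF that] by (simp add: real_sqrt_divide)
  have dv: "(?v has_real_derivative - 2 * coefA \<epsilon> t - 2 * (coefB \<epsilon> t * sqrt (?v t))) (at t within {- T..T})"
    if t: "t \<in> {- T..T}" for t
  proof -
    have "(?v has_real_derivative - (2 * x t * abel \<epsilon> t (x t)) / ((x t)\<^sup>2 * (x t)\<^sup>2)) (at t within {- T..T})"
      using pos[OF t] by (auto intro!: derivative_eq_intros x[OF t])
    also have "- (2 * x t * abel \<epsilon> t (x t)) / ((x t)\<^sup>2 * (x t)\<^sup>2)
        = - 2 * coefA \<epsilon> t - 2 * (coefB \<epsilon> t * sqrt (?v t))"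
      unfolding sv[OF t] using pos[OF t]
      by (simp add: abel_def field_simps power3_eq_cube power2_eq_square)
    finally show ?thesis .
  qed
  have cB: "continuous_on {- T..T} (\<lambda>s. coefB \<epsilon> s * sqrt (?v s))"
    by (intro continuous_intros cont_coef cv)
  show "sol \<epsilon> (1 / (x (- T))\<^sup>2) ?v"
    unfolding sol_def
  proof (intro conjI ballI cv)
    fix t assume t: "t \<in> {- T..T}"
    show "0 < ?v t" using pos[OF t] by simp
    have sub: "{- T..t} \<subseteq> {- T..T}" using t by auto
    have "((\<lambda>t. - 2 * coefA \<epsilon> t - 2 * (coefB \<epsilon> t * sqrt (?v t))) has_integral ?v t - ?v (- T)) {- T..t}"
    proof (rule fundamental_theorem_of_calculus)
      fix s assume "s \<in> {- T..t}"
      then show "(?v has_vector_derivative - 2 * coefA \<epsilon> s - 2 * (coefB \<epsilon> s * sqrt (?v s))) (at s within {- T..t})"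
        using sub by (intro has_vector_derivative_within_subset[OF dv[unfolded has_real_derivative_iff_has_vector_derivative]]) auto
    qed (use t in auto)
    then have "?v t - ?v (- T) = integral {- T..t} (\<lambda>t. - 2 * coefA \<epsilon> t - 2 * (coefB \<epsilon> t * sqrt (?v t)))"
      by (simp add: integral_unique)
    also have "\<dots> = - 2 * integral {- T..t} (coefA \<epsilon>) - 2 * integral {- T..t} (\<lambda>s. coefB \<epsilon> s * sqrt (?v s))"
      by (subst integral_diff)
         (auto intro!: integrable_continuous_real continuous_intros continuous_on_subset[OF cB sub]
            continuous_on_subset[OF cont_coef(1) sub])
    finally show "?v t = 1 / (x (- T))\<^sup>2 - 2 * integral {- T..t} (coefA \<epsilon>)
        - 2 * integral {- T..t} (\<lambda>s. coefB \<epsilon> s * sqrt (?v s))" by simp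
  qed
qed

end

section \<open>Second-order asymptotics of the displacement\<close>

lemma bounded_convergence_integral:
  fixes f :: "nat \<Rightarrow> real \<Rightarrow> real"
  assumes "\<And>k. continuous_on {c..d} (f k)"
    and "\<And>k x. x \<in> {c..d} \<Longrightarrow> \<bar>f k x\<bar> \<le> M"
    and "\<And>x. x \<in> {c..d} \<Longrightarrow> (\<lambda>k. f k x) \<longlonglongrightarrow> g x"
  shows "(\<lambda>k. integral {c..d} (f k)) \<longlonglongrightarrow> integral {c..d} g"
  by (rule dominated_convergence(2)[where h = "\<lambda>_. M"])
     (use assms in \<open>auto intro: integrable_continuous_real\<close>)

lemma abs_mult_le_mult:
  fixes x y :: real
  assumes "\<bar>x\<bar> \<le> p" "\<bar>y\<bar> \<le> q"
  shows "\<bar>x * y\<bar> \<le> p * q"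
  unfolding abs_mult using assms by (intro mult_mono) auto

text \<open>The setting for all asymptotics: solutions along a sequence \<epsilon> -> 0 with uniform
  bounds. The initial values may move, which the uniqueness argument needs; for the sign of the
  displacement they are constant.\<close>

locale abel_sequence = abel_perturbation +
  fixes e h :: "nat \<Rightarrow> real" and v :: "nat \<Rightarrow> real \<Rightarrow> real" and h0 \<kappa> C Z :: real
  assumes e_pos: "\<And>n. 0 < e n" and e_lim: "e \<longlonglongrightarrow> 0" and h_lim: "h \<longlonglongrightarrow> h0"
    and \<kappa>_pos: "0 < \<kappa>" and h0_ge: "\<kappa> \<le> h0"
    and sol: "\<And>n. sol (e n) (h n) (v n)"
    and close: "\<And>n t. t \<in> {- T..T} \<Longrightarrow> \<bar>v n t - V (h n) t\<bar> \<le> C * e n"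
    and v_ge: "\<And>n t. t \<in> {- T..T} \<Longrightarrow> \<kappa> / 2 \<le> v n t"
    and v_le: "\<And>n t. t \<in> {- T..T} \<Longrightarrow> v n t \<le> Z"
begin

text \<open>The asymmetry of sqrt v, rescaled by \<epsilon>; it stays bounded and converges to
  \<open>- 2 * \<Phi> t / sqrt (V h0 t)\<close>.\<close>

definition \<xi> :: "nat \<Rightarrow> real \<Rightarrow> real" where
  "\<xi> n t = (sqrt (v n t) - sqrt (v n (- t))) / e n"

lemma v_lim:
  assumes "t \<in> {- T..T}"
  shows "(\<lambda>n. v n t) \<longlonglongrightarrow> V h0 t"
proof -
  have "(\<lambda>n. C * e n) \<longlonglongrightarrow> 0" using tendsto_mult_left[OF e_lim, of C] by simp
  then have "(\<lambda>n. v n t - V (h n) t) \<longlonglongrightarrow> 0"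
    by (rule Lim_null_comparison[where g = "\<lambda>n. C * e n", rotated])
       (use close[OF assms] in auto)
  moreover have "(\<lambda>n. V (h n) t) \<longlonglongrightarrow> V h0 t"
    unfolding V_def by (intro tendsto_intros h_lim)
  ultimately have "(\<lambda>n. (v n t - V (h n) t) + V (h n) t) \<longlonglongrightarrow> 0 + V h0 t"
    by (rule tendsto_add)
  then show ?thesis by simp
qed

lemma V0_pos: "t \<in> {- T..T} \<Longrightarrow> 0 < V h0 t"
  using V_ge[of t h0] h0_ge \<kappa>_pos by linarith

lemma e_le:
  obtains E where "\<And>n. e n \<le> E" "0 < E"
proof -
  obtain E where "\<forall>x\<in>range e. norm x \<le> E"
    using convergent_imp_bounded[OF e_lim] unfolding bounded_iff by blast
  then have E: "e n \<le> E" for n using abs_le_D1[of "e n" E] by simp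
  show thesis by (rule that[OF E less_le_trans[OF e_pos E]])
qed

lemma sqrt_v_le: "t \<in> {- T..T} \<Longrightarrow> \<bar>sqrt (v n t)\<bar> \<le> sqrt Z"
  using v_le[of t n] sol_pos[OF sol, of t n] by simp

lemma cont_sqrt_v: "continuous_on {- T..T} (\<lambda>t. sqrt (v n t))"
  by (intro continuous_intros sol_cont[OF sol])

lemma asym_eq:
  assumes t: "t \<in> {0..T}"
  shows "(v n t - v n (- t)) / e n =
    - 4 * \<Phi> t - 2 * integral {- t..t} (\<lambda>s. (b s + e n * B1 s) * sqrt (v n s))"
proof -
  have t': "t \<in> {- T..T}" "- t \<in> {- T..T}" using t by auto
  have c: "continuous_on {- T..T} (\<lambda>s. coefB (e n) s * sqrt (v n s))"
    by (intro continuous_intros cont_coef sol_cont[OF sol])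
  have "v n t - v n (- t) = - 2 * integral {- t..t} (coefA (e n))
      - 2 * integral {- t..t} (\<lambda>s. coefB (e n) s * sqrt (v n s))"
    using sol_eq[OF sol[of n] t'(1)] sol_eq[OF sol[of n] t'(2)]
      integral_split[OF cont_coef(1)[of "e n"] t] integral_split[OF c t]
    by linarith
  also have "(\<lambda>s. coefB (e n) s * sqrt (v n s)) = (\<lambda>s. e n * ((b s + e n * B1 s) * sqrt (v n s)))"
    by (auto simp: coefB_def power2_eq_square algebra_simps)
  also have "integral {- t..t} \<dots> = e n * integral {- t..t} (\<lambda>s. (b s + e n * B1 s) * sqrt (v n s))"
    by (rule integral_mult_right)
  also have "- 2 * integral {- t..t} (coefA (e n)) = - 4 * \<Phi> t * e n"
    using integral_coefA[OF t, of "e n"] by simp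
  finally have "v n t - v n (- t) =
    e n * (- 4 * \<Phi> t - 2 * integral {- t..t} (\<lambda>s. (b s + e n * B1 s) * sqrt (v n s)))"
    by (simp only: algebra_simps)
  then show ?thesis
    using e_pos[of n] by simp
qed

text \<open>The integral of \<open>b\<close> times sqrt v over [-t, t] tends to that of an odd
  function, because \<open>V h0\<close> is even; hence only the contribution of \<open>A1\<close>
  remains.\<close>

lemma asym_lim:
  assumes t: "t \<in> {0..T}"
  shows "(\<lambda>n. (v n t - v n (- t)) / e n) \<longlonglongrightarrow> - 4 * \<Phi> t"
proof -
  have sub: "{- t..t} \<subseteq> {- T..T}" using t by auto
  obtain N where N: "0 < N" and "\<And>t. t \<in> {- T..T} \<Longrightarrow> \<bar>A1 t\<bar> \<le> N"
    and Nb: "\<And>t. t \<in> {- T..T} \<Longrightarrow> \<bar>b t\<bar> \<le> N" and NB: "\<And>t. t \<in> {- T..T} \<Longrightarrow> \<bar>B1 t\<bar> \<le> N"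
    and "\<And>t. t \<in> {- T..T} \<Longrightarrow> \<bar>a t\<bar> \<le> N" and "\<And>t. t \<in> {- T..T} \<Longrightarrow> G t \<le> N"
    by (rule exists_bound) (rule that)
  obtain E where E: "\<And>n. e n \<le> E" "0 < E" by (rule e_le) (rule that)
  have "(\<lambda>n. integral {- t..t} (\<lambda>s. (b s + e n * B1 s) * sqrt (v n s)))
      \<longlonglongrightarrow> integral {- t..t} (\<lambda>s. (b s + 0 * B1 s) * sqrt (V h0 s))"
  proof (rule bounded_convergence_integral)
    show "continuous_on {- t..t} (\<lambda>s. (b s + e n * B1 s) * sqrt (v n s))" for n
      by (intro continuous_on_subset[OF _ sub] continuous_intros cont_b cont_B1 sol_cont[OF sol])
    fix s assume "s \<in> {- t..t}"
    then have s: "s \<in> {- T..T}" using sub by auto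
    show "\<bar>(b s + e n * B1 s) * sqrt (v n s)\<bar> \<le> (N + E * N) * sqrt Z" for n
    proof (rule abs_mult_le_mult[OF _ sqrt_v_le[OF s]])
      have "\<bar>e n * B1 s\<bar> \<le> E * N"
        using E(1)[of n] e_pos[of n] NB[OF s] by (intro abs_mult_le_mult) auto
      then show "\<bar>b s + e n * B1 s\<bar> \<le> N + E * N" using Nb[OF s] by linarith
    qed
    show "(\<lambda>n. (b s + e n * B1 s) * sqrt (v n s)) \<longlonglongrightarrow> (b s + 0 * B1 s) * sqrt (V h0 s)"
      by (intro tendsto_intros e_lim v_lim s)
  qed
  moreover have "integral {- t..t} (\<lambda>s. b s * sqrt (V h0 s)) = 0"
    by (rule integral_odd[OF _ _ t]) (auto intro!: continuous_intros cont_b cont_V simp: b_odd V_even)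
  ultimately have "(\<lambda>n. - 4 * \<Phi> t - 2 * integral {- t..t} (\<lambda>s. (b s + e n * B1 s) * sqrt (v n s)))
      \<longlonglongrightarrow> - 4 * \<Phi> t - 2 * 0"
    by (intro tendsto_intros) simp
  then show ?thesis by (simp add: asym_eq[OF t])
qed

lemma \<xi>_eq:
  assumes t: "t \<in> {- T..T}"
  shows "\<xi> n t = ((v n t - v n (- t)) / e n) / (sqrt (v n t) + sqrt (v n (- t)))"
proof -
  have p: "0 < v n t" "0 < v n (- t)" using t by (auto intro: sol_pos[OF sol])
  then have s: "0 < sqrt (v n t) + sqrt (v n (- t))" by (intro add_pos_pos) auto
  have "v n t - v n (- t) = (sqrt (v n t) - sqrt (v n (- t))) * (sqrt (v n t) + sqrt (v n (- t)))"
    using p by (simp add: algebra_simps)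
  then show ?thesis using s by (simp add: \<xi>_def)
qed

lemma \<xi>_lim:
  assumes t: "t \<in> {0..T}"
  shows "(\<lambda>n. \<xi> n t) \<longlonglongrightarrow> - 2 * \<Phi> t / sqrt (V h0 t)"
proof -
  have t': "t \<in> {- T..T}" "- t \<in> {- T..T}" using t by auto
  have "(\<lambda>n. \<xi> n t) \<longlonglongrightarrow> (- 4 * \<Phi> t) / (sqrt (V h0 t) + sqrt (V h0 (- t)))"
    unfolding \<xi>_eq[OF t'(1)] using V0_pos[OF t'(1)] V_even[OF t'(1)]
    by (intro tendsto_divide asym_lim[OF t] tendsto_intros v_lim t') auto
  then show ?thesis using V_even[OF t'(1)] by simp
qed

text \<open>v at t and v at -t lie within \<open>C * e n\<close> of the same value, as
  \<open>V\<close> is even, so division by \<open>e n\<close> is harmless. This supplies the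
  dominating constant for bounded convergence.\<close>

lemma \<xi>_bound:
  assumes t: "t \<in> {- T..T}"
  shows "\<bar>\<xi> n t\<bar> \<le> 2 * C / (2 * sqrt (\<kappa> / 2))"
proof -
  have t': "- t \<in> {- T..T}" using t by auto
  have "\<bar>sqrt (v n t) - sqrt (v n (- t))\<bar> \<le> \<bar>v n t - v n (- t)\<bar> / (2 * sqrt (\<kappa> / 2))"
    using \<kappa>_pos v_ge[OF t] v_ge[OF t'] by (intro sqrt_diff_le) auto
  also have "\<dots> \<le> (2 * C * e n) / (2 * sqrt (\<kappa> / 2))"
    using close[OF t, of n] close[OF t', of n] V_even[OF t, of "h n"] \<kappa>_pos
    by (intro divide_right_mono) (linarith | simp)+
  finally show ?thesis
    using e_pos[of n] by (simp add: \<xi>_def abs_divide field_simps)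
qed

lemma cont_reflect:
  assumes "continuous_on {- T..T} g"
  shows "continuous_on {- T..T} (\<lambda>t. g (- t) :: real)"
  by (rule continuous_on_compose2[OF assms]) (auto intro!: continuous_intros)

lemma cont_\<xi>: "continuous_on {- T..T} (\<xi> n)"
  unfolding \<xi>_def using e_pos[of n]
  by (intro continuous_intros sol_cont[OF sol] cont_reflect[OF sol_cont[OF sol]]) auto

text \<open>Since \<open>\<Phi> T = 0\<close>, the displacement over \<epsilon> is an integral over
  [-T, T]. Folding it onto [0, T] turns the term of the odd \<open>b\<close> into \<open>b\<close>
  times the asymmetry of sqrt v, that is \<epsilon> times \<open>b * \<xi>\<close>; so it gains the
  factor \<epsilon> that \<open>B1\<close> carries from the start.\<close>

lemma displacement_lim: "(\<lambda>n. (v n T - v n (- T)) / (e n)\<^sup>2) \<longlonglongrightarrow> - 4 * melnikov h0"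
proof -
  have ST: "T \<in> {0..T}" "{0..T} \<subseteq> {- T..T}" using T_pos by auto
  obtain N where N: "0 < N" and "\<And>t. t \<in> {- T..T} \<Longrightarrow> \<bar>A1 t\<bar> \<le> N"
    and Nb: "\<And>t. t \<in> {- T..T} \<Longrightarrow> \<bar>b t\<bar> \<le> N" and NB: "\<And>t. t \<in> {- T..T} \<Longrightarrow> \<bar>B1 t\<bar> \<le> N"
    and "\<And>t. t \<in> {- T..T} \<Longrightarrow> \<bar>a t\<bar> \<le> N" and "\<And>t. t \<in> {- T..T} \<Longrightarrow> G t \<le> N"
    by (rule exists_bound) (rule that)
  let ?g = "\<lambda>n t. b t * \<xi> n t + (B1 t * sqrt (v n t) + B1 (- t) * sqrt (v n (- t)))"
  have eq: "(v n T - v n (- T)) / (e n)\<^sup>2 = - 2 * integral {0..T} (?g n)" for n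
  proof -
    have "(v n T - v n (- T)) / e n = - 2 * integral {- T..T} (\<lambda>s. (b s + e n * B1 s) * sqrt (v n s))"
      using asym_eq[OF ST(1), of n] \<Phi>_T by simp
    also have "integral {- T..T} (\<lambda>s. (b s + e n * B1 s) * sqrt (v n s))
      = integral {0..T} (\<lambda>s. (b s + e n * B1 s) * sqrt (v n s) + (b (- s) + e n * B1 (- s)) * sqrt (v n (- s)))"
      using T_pos
      by (intro integral_symmetric_interval continuous_intros cont_b cont_B1 sol_cont[OF sol]) auto
    also have "\<dots> = integral {0..T} (\<lambda>s. e n * ?g n s)"
    proof (intro integral_cong)
      fix s assume "s \<in> {0..T}"
      then have "b (- s) = - b s" by (intro b_odd) auto
      then show "(b s + e n * B1 s) * sqrt (v n s) + (b (- s) + e n * B1 (- s)) * sqrt (v n (- s)) = e n * ?g n s"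
        using e_pos[of n] by (simp add: \<xi>_def field_simps)
    qed
    also have "\<dots> = e n * integral {0..T} (?g n)" by (rule integral_mult_right)
    finally have "(v n T - v n (- T)) / e n = e n * (- 2 * integral {0..T} (?g n))"
      by (simp only: mult_ac)
    moreover have "(v n T - v n (- T)) / (e n)\<^sup>2 = (v n T - v n (- T)) / e n / e n"
      by (simp add: power2_eq_square)
    ultimately show ?thesis using e_pos[of n] by simp
  qed
  have "(\<lambda>n. integral {0..T} (?g n)) \<longlonglongrightarrow>
    integral {0..T} (\<lambda>t. b t * (- 2 * \<Phi> t / sqrt (V h0 t)) + (B1 t * sqrt (V h0 t) + B1 (- t) * sqrt (V h0 (- t))))"
  proof (rule bounded_convergence_integral)
    show "continuous_on {0..T} (?g n)" for n
      by (intro continuous_on_subset[OF _ ST(2)] continuous_intros cont_b cont_B1 sol_cont[OF sol]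
          cont_\<xi> cont_reflect[OF cont_B1] cont_reflect[OF sol_cont[OF sol]])
    fix t assume t: "t \<in> {0..T}"
    then have t': "t \<in> {- T..T}" "- t \<in> {- T..T}" by auto
    show "\<bar>?g n t\<bar> \<le> N * (2 * C / (2 * sqrt (\<kappa> / 2))) + (N * sqrt Z + N * sqrt Z)" for n
      by (intro order_trans[OF abs_triangle_ineq] add_mono abs_mult_le_mult Nb NB t' \<xi>_bound sqrt_v_le)
    show "(\<lambda>n. ?g n t) \<longlonglongrightarrow>
        b t * (- 2 * \<Phi> t / sqrt (V h0 t)) + (B1 t * sqrt (V h0 t) + B1 (- t) * sqrt (V h0 (- t)))"
      by (intro tendsto_add tendsto_mult tendsto_const \<xi>_lim t tendsto_real_sqrt v_lim t')
  qed
  also have "integral {0..T} (\<lambda>t. b t * (- 2 * \<Phi> t / sqrt (V h0 t)) + (B1 t * sqrt (V h0 t) + B1 (- t) * sqrt (V h0 (- t))))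
    = integral {0..T} (\<lambda>t. 2 * (even_part B1 t * sqrt (V h0 t) - b t * \<Phi> t / sqrt (V h0 t)))"
    by (intro integral_cong) (auto simp: even_part_def V_even algebra_simps)
  also have "\<dots> = 2 * melnikov h0"
    unfolding melnikov_def by (rule integral_mult_right)
  finally have "(\<lambda>n. - 2 * integral {0..T} (?g n)) \<longlonglongrightarrow> - 2 * (2 * melnikov h0)"
    by (intro tendsto_intros)
  then show ?thesis by (simp add: eq)
qed

end

section \<open>Second-order limit for pairs of solutions\<close>

context abel_perturbation
begin

lemma cont_quot:
  assumes "sol \<epsilon> h v" "sol \<epsilon> k w"
  shows "continuous_on {- T..T} (\<lambda>t. coefB \<epsilon> t / (sqrt (v t) + sqrt (w t)))"
proof (intro continuous_intros cont_coef sol_cont[OF assms(1)] sol_cont[OF assms(2)] ballI)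
  fix s assume "s \<in> {- T..T}"
  then have "0 < sqrt (v s)" "0 < sqrt (w s)"
    using sol_pos[OF assms(1), of s] sol_pos[OF assms(2), of s] by auto
  then show "sqrt (v s) + sqrt (w s) \<noteq> 0" by linarith
qed

text \<open>The same folding, now with the kernel 1 / S where S = sqrt v + sqrt w: its asymmetry is
  minus \<epsilon> times the sum of the two \<open>\<xi>\<close>, divided by S at t and at -t. Both
  sequences tend to the same h0, so both roots have the limit sqrt (V h0) and the derivative of
  \<open>melnikov\<close> appears.\<close>

lemma quotient_lim:
  assumes v: "abel_sequence T a A1 b B1 e h v h0 \<kappa> C Z"
    and w: "abel_sequence T a A1 b B1 e k w h0 \<kappa> C Z"
  shows "(\<lambda>n. integral {- T..T} (\<lambda>t. coefB (e n) t / (sqrt (v n t) + sqrt (w n t))) / (e n)\<^sup>2)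
    \<longlonglongrightarrow> 2 * melnikov' h0"
proof -
  interpret v: abel_sequence T a A1 b B1 e h v h0 \<kappa> C Z by (rule v)
  interpret w: abel_sequence T a A1 b B1 e k w h0 \<kappa> C Z by (rule w)
  have ST: "{0..T} \<subseteq> {- T..T}" using T_pos by auto
  obtain N where N: "0 < N" and "\<And>t. t \<in> {- T..T} \<Longrightarrow> \<bar>A1 t\<bar> \<le> N"
    and Nb: "\<And>t. t \<in> {- T..T} \<Longrightarrow> \<bar>b t\<bar> \<le> N" and NB: "\<And>t. t \<in> {- T..T} \<Longrightarrow> \<bar>B1 t\<bar> \<le> N"
    and "\<And>t. t \<in> {- T..T} \<Longrightarrow> \<bar>a t\<bar> \<le> N" and "\<And>t. t \<in> {- T..T} \<Longrightarrow> G t \<le> N"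
    by (rule exists_bound) (rule that)
  define S where "S n t = sqrt (v n t) + sqrt (w n t)" for n t
  define X where "X = 2 * C / (2 * sqrt (\<kappa> / 2))"
  define m where "m = 2 * sqrt (\<kappa> / 2)"
  have m: "0 < m" using v.\<kappa>_pos by (simp add: m_def)
  have Sm: "m \<le> S n t" if "t \<in> {- T..T}" for n t
  proof -
    have "sqrt (\<kappa> / 2) \<le> sqrt (v n t)" "sqrt (\<kappa> / 2) \<le> sqrt (w n t)"
      using v.v_ge[OF that, of n] w.v_ge[OF that, of n] by auto
    then show ?thesis unfolding S_def m_def by linarith
  qed
  then have Sp: "0 < S n t" if "t \<in> {- T..T}" for n t using m that by (meson less_le_trans)
  have inv: "\<bar>1 / S n t\<bar> \<le> 1 / m" if "t \<in> {- T..T}" for n t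
    using Sm[OF that, of n] Sp[OF that, of n] m by (simp add: frac_le)
  have contS: "continuous_on {- T..T} (S n)" for n
    unfolding S_def by (intro continuous_intros v.cont_sqrt_v w.cont_sqrt_v)
  have contI: "continuous_on {- T..T} (\<lambda>t. 1 / S n t)" for n
    using Sp[of _ n] by (intro continuous_intros contS) (metis less_irrefl)
  let ?g = "\<lambda>n t. - (b t * ((v.\<xi> n t + w.\<xi> n t) * (1 / S n t * (1 / S n (- t)))))
      + (B1 t * (1 / S n t) + B1 (- t) * (1 / S n (- t)))"
  have eq: "integral {- T..T} (\<lambda>t. coefB (e n) t / S n t) / (e n)\<^sup>2 = integral {0..T} (?g n)" for n
  proof -
    have "integral {- T..T} (\<lambda>t. coefB (e n) t / S n t)
        = integral {0..T} (\<lambda>t. coefB (e n) t / S n t + coefB (e n) (- t) / S n (- t))"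
      using T_pos cont_quot[OF v.sol w.sol, of n] unfolding S_def
      by (intro integral_symmetric_interval) auto
    also have "\<dots> = integral {0..T} (\<lambda>t. (e n)\<^sup>2 * ?g n t)"
    proof (intro integral_cong)
      fix t assume "t \<in> {0..T}"
      then have t: "t \<in> {- T..T}" "- t \<in> {- T..T}" by auto
      have p: "0 < S n t" "0 < S n (- t)" "0 < e n" using Sp t v.e_pos by auto
      have "b (- t) = - b t" by (intro b_odd t)
      then have 1: "coefB (e n) t / S n t + coefB (e n) (- t) / S n (- t)
        = e n * b t * (1 / S n t - 1 / S n (- t)) + (e n)\<^sup>2 * (B1 t * (1 / S n t) + B1 (- t) * (1 / S n (- t)))"
        using p by (simp add: coefB_def field_simps)
      have "v.\<xi> n t + w.\<xi> n t = (S n t - S n (- t)) / e n"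
        by (simp add: v.\<xi>_def w.\<xi>_def S_def add_divide_distrib diff_divide_distrib)
      then have "S n t - S n (- t) = e n * (v.\<xi> n t + w.\<xi> n t)"
        using p by simp
      moreover have "1 / S n t - 1 / S n (- t) = - ((S n t - S n (- t)) * (1 / S n t * (1 / S n (- t))))"
        using p by (simp add: field_simps)
      ultimately have "1 / S n t - 1 / S n (- t) = - (e n * ((v.\<xi> n t + w.\<xi> n t) * (1 / S n t * (1 / S n (- t)))))"
        by (simp only: mult.assoc)
      then show "coefB (e n) t / S n t + coefB (e n) (- t) / S n (- t) = (e n)\<^sup>2 * ?g n t"
        unfolding 1 by (simp only:) (simp add: power2_eq_square algebra_simps)
    qed
    also have "\<dots> = (e n)\<^sup>2 * integral {0..T} (?g n)" by (rule integral_mult_right)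
    finally show ?thesis using v.e_pos[of n] by simp
  qed
  let ?s = "\<lambda>t. sqrt (V h0 t)"
  let ?l = "\<lambda>t. - (b t * ((- 2 * \<Phi> t / ?s t + - 2 * \<Phi> t / ?s t) * (1 / (?s t + ?s t) * (1 / (?s (- t) + ?s (- t))))))
      + (B1 t * (1 / (?s t + ?s t)) + B1 (- t) * (1 / (?s (- t) + ?s (- t))))"
  have "(\<lambda>n. integral {0..T} (?g n)) \<longlonglongrightarrow> integral {0..T} ?l"
  proof (rule bounded_convergence_integral)
    show "continuous_on {0..T} (?g n)" for n
      by (intro continuous_on_subset[OF _ ST] continuous_on_add continuous_on_mult continuous_on_minus
          cont_b cont_B1 v.cont_\<xi> w.cont_\<xi> contI v.cont_reflect[OF contI] v.cont_reflect[OF cont_B1])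
    fix t assume t: "t \<in> {0..T}"
    then have t': "t \<in> {- T..T}" "- t \<in> {- T..T}" by auto
    show "\<bar>?g n t\<bar> \<le> N * ((X + X) * (1 / m * (1 / m))) + (N * (1 / m) + N * (1 / m))" for n
      unfolding X_def
      by (intro order_trans[OF abs_triangle_ineq] add_mono order_trans[OF eq_refl[OF abs_minus_cancel]]
           abs_mult_le_mult Nb NB t' v.\<xi>_bound w.\<xi>_bound inv)
    have "?s t \<noteq> 0" "?s (- t) \<noteq> 0" using v.V0_pos[OF t'(1)] v.V0_pos[OF t'(2)] by auto
    then show "(\<lambda>n. ?g n t) \<longlonglongrightarrow> ?l t"
      unfolding S_def
      by (intro tendsto_add tendsto_minus tendsto_mult tendsto_divide tendsto_const v.\<xi>_lim w.\<xi>_lim t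
          tendsto_real_sqrt v.v_lim w.v_lim t') auto
  qed
  also have "integral {0..T} ?l = integral {0..T} (\<lambda>t. 2 * (even_part B1 t / (2 * sqrt (V h0 t))
      + b t * \<Phi> t / (2 * V h0 t * sqrt (V h0 t))))"
  proof (intro integral_cong)
    fix t assume "t \<in> {0..T}"
    then have t: "t \<in> {- T..T}" by auto
    have "0 < ?s t" "V h0 t = ?s t * ?s t" using v.V0_pos[OF t] by auto
    then show "?l t = 2 * (even_part B1 t / (2 * sqrt (V h0 t)) + b t * \<Phi> t / (2 * V h0 t * sqrt (V h0 t)))"
      unfolding V_even[OF t] even_part_def by (simp add: field_simps)
  qed
  also have "\<dots> = 2 * melnikov' h0"
    unfolding melnikov'_def by (rule integral_mult_right)
  finally show ?thesis unfolding eq[symmetric] by (simp add: S_def)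
qed

end

section \<open>Persistence of simple zeros of the Melnikov function\<close>

text \<open>Turns the failure of a claim for arbitrarily small \<delta> into a null sequence of
  counterexamples, ready for \<open>abel_sequence\<close>.\<close>

lemma sequence_choice:
  fixes d :: real
  assumes "0 < d" and "\<And>\<delta>. 0 < \<delta> \<Longrightarrow> \<delta> \<le> d \<Longrightarrow> \<exists>x. P \<delta> x"
  obtains \<delta> x where "\<And>n :: nat. 0 < \<delta> n" "\<And>n. \<delta> n \<le> d" "\<delta> \<longlonglongrightarrow> 0" "\<And>n. P (\<delta> n) (x n)"
proof -
  define \<delta> where "\<delta> n = d * inverse (real (Suc n))" for n
  have 1: "0 < \<delta> n" "\<delta> n \<le> d" for n using assms(1) by (auto simp: \<delta>_def field_simps)
  have "\<delta> \<longlonglongrightarrow> d * 0" unfolding \<delta>_def by (intro tendsto_intros LIMSEQ_inverse_real_of_nat)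
  then have 2: "\<delta> \<longlonglongrightarrow> 0" by simp
  have "\<forall>n. \<exists>x. P (\<delta> n) x" using assms(2) 1 by blast
  then obtain x where "\<And>n. P (\<delta> n) (x n)" by metis
  then show thesis using that 1 2 by blast
qed

context abel_perturbation
begin

definition periodic :: "real \<Rightarrow> real \<Rightarrow> bool" where
  "periodic \<epsilon> h \<longleftrightarrow> (\<exists>v. sol \<epsilon> h v \<and> v T = v (- T))"

lemma melnikov_deriv:
  assumes h0: "0 < h0"
  shows "(melnikov has_real_derivative melnikov' h0) (at h0)"
proof -
  let ?U = "{0<..} :: real set"
  have V: "0 < V h t" if "h \<in> ?U" "t \<in> {0..T}" for h t
    using V_ge[of t h] that T_pos by auto
  have ST: "{0..T} \<subseteq> {- T..T}" using T_pos by auto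
  have cb: "continuous_on {0..T} b" by (rule continuous_on_subset[OF cont_b ST])
  have cB: "continuous_on {0..T} (even_part B1)" by (rule cont_even_part[OF cont_B1])
  have cV: "continuous_on (?U \<times> {0..T}) (\<lambda>x. V (fst x) (snd x))"
    unfolding V_def
    by (intro continuous_intros continuous_on_compose2[OF continuous_on_subset[OF cont_G ST]]) auto
  have "((\<lambda>h. integral (cbox 0 T) (\<lambda>t. even_part B1 t * sqrt (V h t) - b t * \<Phi> t / sqrt (V h t)))
      has_field_derivative integral (cbox 0 T)
        (\<lambda>t. even_part B1 t / (2 * sqrt (V h0 t)) + b t * \<Phi> t / (2 * V h0 t * sqrt (V h0 t))))
      (at h0 within ?U)"
  proof (rule leibniz_rule_field_derivative)
    fix h t assume h: "h \<in> ?U" and "t \<in> cbox 0 T"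
    then have p: "0 < V h t" "0 < sqrt (V h t)" using V[of h t] by auto
    have dV: "((\<lambda>h. V h t) has_real_derivative 1) (at h within ?U)"
      unfolding V_def by (auto intro!: derivative_eq_intros)
    have sq: "sqrt (V h t) * sqrt (V h t) = V h t" using p by simp
    show "((\<lambda>h. even_part B1 t * sqrt (V h t) - b t * \<Phi> t / sqrt (V h t)) has_field_derivative
        even_part B1 t / (2 * sqrt (V h t)) + b t * \<Phi> t / (2 * V h t * sqrt (V h t))) (at h within ?U)"
      using p sq by (auto intro!: derivative_eq_intros dV simp: field_simps)
  next
    fix h assume h: "h \<in> ?U"
    have "continuous_on {0..T} (\<lambda>t. even_part B1 t * sqrt (V h t) - b t * \<Phi> t / sqrt (V h t))"
      using V[OF h]
      by (intro continuous_intros cb cB cont_\<Phi> continuous_on_subset[OF cont_V ST]) force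
    then show "(\<lambda>t. even_part B1 t * sqrt (V h t) - b t * \<Phi> t / sqrt (V h t)) integrable_on cbox 0 T"
      by (simp add: integrable_continuous_real)
  next
    show "continuous_on (?U \<times> cbox 0 T)
       (\<lambda>(h, t). even_part B1 t / (2 * sqrt (V h t)) + b t * \<Phi> t / (2 * V h t * sqrt (V h t)))"
      unfolding split_beta cbox_interval
      using V
      by (intro continuous_intros cV continuous_on_compose2[OF cB] continuous_on_compose2[OF cb]
          continuous_on_compose2[OF cont_\<Phi>]) force+
  qed (use h0 in auto)
  then show ?thesis
    using h0 at_within_open[of h0 ?U] by (simp add: melnikov_def[abs_def] melnikov'_def)
qed

text \<open>If v and w are both closed, w - v has the same nonzero value at -T and T, so the
  exponential in \<open>sol_diff\<close> equals 1.\<close>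

lemma closed_imp_quotient_zero:
  assumes v: "sol \<epsilon> h v" "v T = v (- T)" and w: "sol \<epsilon> k w" "w T = w (- T)" and ne: "h \<noteq> k"
  shows "integral {- T..T} (\<lambda>t. coefB \<epsilon> t / (sqrt (v t) + sqrt (w t))) = 0"
  using sol_diff[OF v(1) w(1), of T] v w ne T_pos by (simp add: sol_init[OF v(1)] sol_init[OF w(1)])

text \<open>The exponential in \<open>sol_diff\<close> is bounded once the solutions stay above
  \<open>\<kappa>\<close>, so the value at T depends on h in a Lipschitz way; this is for the
  intermediate value theorem.\<close>

lemma displacement_continuous:
  assumes \<epsilon>: "0 < \<epsilon>" and \<kappa>: "0 < \<kappa>"
    and sol: "\<And>h. h \<in> {p..q} \<Longrightarrow> sol \<epsilon> h (v h)"
    and ge: "\<And>h t. h \<in> {p..q} \<Longrightarrow> t \<in> {- T..T} \<Longrightarrow> \<kappa> \<le> v h t"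
  shows "continuous_on {p..q} (\<lambda>h. v h T - v h (- T))"
proof -
  have "bounded (coefB \<epsilon> ` {- T..T})"
    by (intro compact_imp_bounded compact_continuous_image cont_coef) auto
  then obtain K where "\<forall>x\<in>coefB \<epsilon> ` {- T..T}. norm x \<le> K" unfolding bounded_iff by blast
  then have K: "\<bar>coefB \<epsilon> t\<bar> \<le> K" if "t \<in> {- T..T}" for t using that by auto
  define L where "L = exp (2 * (K / (2 * sqrt \<kappa>) * (T - - T)))"
  have lip: "\<bar>v k T - v h T\<bar> \<le> L * \<bar>k - h\<bar>" if h: "h \<in> {p..q}" and k: "k \<in> {p..q}" for h k
  proof -
    let ?Q = "integral {- T..T} (\<lambda>s. coefB \<epsilon> s / (sqrt (v h s) + sqrt (v k s)))"
    have "norm ?Q \<le> K / (2 * sqrt \<kappa>) * (T - - T)"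
    proof (rule integral_bound)
      show "continuous_on {- T..T} (\<lambda>s. coefB \<epsilon> s / (sqrt (v h s) + sqrt (v k s)))"
        by (rule cont_quot[OF sol[OF h] sol[OF k]])
      fix s assume s: "s \<in> {- T..T}"
      have "sqrt \<kappa> \<le> sqrt (v h s)" "sqrt \<kappa> \<le> sqrt (v k s)" "0 < sqrt \<kappa>"
        using ge[OF h s] ge[OF k s] \<kappa> by auto
      then have "2 * sqrt \<kappa> \<le> sqrt (v h s) + sqrt (v k s)" "0 < 2 * sqrt \<kappa>" by linarith+
      then show "norm (coefB \<epsilon> s / (sqrt (v h s) + sqrt (v k s))) \<le> K / (2 * sqrt \<kappa>)"
        unfolding real_norm_def abs_divide using K[OF s] by (intro frac_le) auto
    qed (use T_pos in auto)
    then have "exp (- 2 * ?Q) \<le> L" unfolding L_def exp_le_cancel_iff real_norm_def by linarith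
    moreover have "v k T - v h T = (k - h) * exp (- 2 * ?Q)"
      using sol_diff[OF sol[OF h] sol[OF k], of T] T_pos by simp
    ultimately show ?thesis
      using mult_left_mono[of "exp (- 2 * ?Q)" L "\<bar>k - h\<bar>"] by (simp only: abs_mult abs_exp_cancel mult.commute)
  qed
  have "continuous_on {p..q} (\<lambda>h. v h T)"
  proof (rule continuous_onI)
    fix h e :: real assume h: "h \<in> {p..q}" and e: "0 < e"
    have L: "0 < L" by (simp add: L_def)
    show "\<exists>d>0. \<forall>k\<in>{p..q}. dist k h < d \<longrightarrow> dist (v k T) (v h T) \<le> e"
    proof (intro exI[of _ "e / L"] conjI ballI impI)
      fix k assume k: "k \<in> {p..q}" "dist k h < e / L"
      then have "L * \<bar>k - h\<bar> \<le> e" using L by (simp add: dist_real_def field_simps)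
      then show "dist (v k T) (v h T) \<le> e" using lip[OF h k(1)] by (simp add: dist_real_def)
    qed (use e L in simp)
  qed
  then have "continuous_on {p..q} (\<lambda>h. v h T - h)" by (intro continuous_intros)
  then show ?thesis
    by (rule continuous_on_cong[OF refl, THEN iffD1, rotated]) (simp add: sol_init[OF sol])
qed

text \<open>Existence comes from opposite signs of the displacement at h0 - r and h0 + r, uniqueness
  from \<open>quotient_lim\<close>. The radius r is fixed before \<epsilon> and can be made smaller
  than any \<open>r1\<close>, which later keeps the cycles of different zeros apart.\<close>

theorem simple_zero_persists:
  assumes h0: "0 < h0" and zero: "melnikov h0 = 0" and simple: "melnikov' h0 \<noteq> 0" and r1: "0 < r1"
  obtains r \<epsilon>0 where "0 < r" "r < r1" "r < h0" "0 < \<epsilon>0"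
    "\<And>\<epsilon>. 0 < \<epsilon> \<Longrightarrow> \<epsilon> < \<epsilon>0 \<Longrightarrow> \<exists>!h. \<bar>h - h0\<bar> < r \<and> periodic \<epsilon> h"
proof -
  \<comment> \<open>[\<kappa>, H] is a compact window of positive values that contains
    \<open>{h0 - r..h0 + r}\<close> for every r < \<kappa>.\<close>
  define \<kappa> where "\<kappa> = h0 / 2"
  define H where "H = 2 * h0"
  have \<kappa>: "0 < \<kappa>" "\<kappa> \<le> H" "\<kappa> \<le> h0" "h0 \<le> H" using h0 by (auto simp: \<kappa>_def H_def)
  obtain \<epsilon>1 C Z where \<epsilon>1: "0 < \<epsilon>1" and "0 \<le> C"
    and ex: "\<And>\<epsilon> h. 0 < \<epsilon> \<Longrightarrow> \<epsilon> < \<epsilon>1 \<Longrightarrow> \<kappa> \<le> h \<Longrightarrow> h \<le> H \<Longrightarrow> \<exists>v. sol \<epsilon> h v"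
    and bd: "\<And>\<epsilon> h v t. 0 < \<epsilon> \<Longrightarrow> \<epsilon> < \<epsilon>1 \<Longrightarrow> \<kappa> \<le> h \<Longrightarrow> h \<le> H \<Longrightarrow> sol \<epsilon> h v \<Longrightarrow> t \<in> {- T..T} \<Longrightarrow>
       \<bar>v t - V h t\<bar> \<le> C * \<epsilon> \<and> \<kappa> / 2 \<le> v t \<and> v t \<le> Z"
    using sol_exists_bounds[OF \<kappa>(1,2)] by metis
  have seq: "abel_sequence T a A1 b B1 e h v k \<kappa> C Z"
    if "\<And>n. 0 < e n" "\<And>n. e n < \<epsilon>1" "e \<longlonglongrightarrow> 0" "h \<longlonglongrightarrow> k" "\<And>n. \<kappa> \<le> h n" "\<And>n. h n \<le> H"
      "\<And>n. sol (e n) (h n) (v n)" "\<kappa> \<le> k" for e h v k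
    by unfold_locales (use that \<kappa> bd[OF that(1,2,5,6,7)] in auto)

  \<comment> \<open>Two distinct closed solutions with both initial values tending to h0 would make
    the quotient integral vanish along a sequence, so its limit \<open>2 * melnikov' h0\<close>
    would be 0.\<close>
  have unique: "\<exists>d>0. \<forall>\<epsilon> h k. 0 < \<epsilon> \<and> \<epsilon> < d \<and> \<bar>h - h0\<bar> < d \<and> \<bar>k - h0\<bar> < d \<and> periodic \<epsilon> h \<and> periodic \<epsilon> k \<longrightarrow> h = k"
  proof (rule ccontr)
    assume neg: "\<not> ?thesis"
    define d where "d = min \<epsilon>1 \<kappa>"
    have d: "0 < d" "d \<le> \<epsilon>1" "d \<le> \<kappa>" using \<epsilon>1 \<kappa> by (auto simp: d_def)
    let ?P = "\<lambda>\<delta> (\<epsilon>, h, k, v, w). 0 < \<epsilon> \<and> \<epsilon> < \<delta> \<and> \<bar>h - h0\<bar> < \<delta> \<and> \<bar>k - h0\<bar> < \<delta> \<and> h \<noteq> k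
        \<and> sol \<epsilon> h v \<and> v T = v (- T) \<and> sol \<epsilon> k w \<and> w T = w (- T)"
    have exP: "\<exists>x. ?P \<delta> x" if "0 < \<delta>" "\<delta> \<le> d" for \<delta>
    proof -
      obtain \<epsilon> h k where *: "0 < \<epsilon>" "\<epsilon> < \<delta>" "\<bar>h - h0\<bar> < \<delta>" "\<bar>k - h0\<bar> < \<delta>" "periodic \<epsilon> h" "periodic \<epsilon> k" "h \<noteq> k"
        using neg \<open>0 < \<delta>\<close> by blast
      then obtain v w where "sol \<epsilon> h v \<and> v T = v (- T)" "sol \<epsilon> k w \<and> w T = w (- T)"
        unfolding periodic_def by blast
      with * have "?P \<delta> (\<epsilon>, h, k, v, w)" by simp
      then show ?thesis by blast
    qed
    obtain \<delta> x where \<delta>: "\<And>n :: nat. 0 < \<delta> n" "\<And>n. \<delta> n \<le> d" "\<delta> \<longlonglongrightarrow> 0" and x: "\<And>n. ?P (\<delta> n) (x n)"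
      by (rule sequence_choice[OF d(1) exP]) (assumption | rule that)+
    define e h k v w where "e n = fst (x n)" and "h n = fst (snd (x n))" and "k n = fst (snd (snd (x n)))"
      and "v n = fst (snd (snd (snd (x n))))" and "w n = snd (snd (snd (snd (x n))))" for n
    have X: "0 < e n" "e n < \<delta> n" "\<bar>h n - h0\<bar> < \<delta> n" "\<bar>k n - h0\<bar> < \<delta> n" "h n \<noteq> k n"
      "sol (e n) (h n) (v n)" "v n T = v n (- T)" "sol (e n) (k n) (w n)" "w n T = w n (- T)" for n
      using x[of n] by (auto simp: e_def h_def k_def v_def w_def split: prod.splits)
    have e: "e \<longlonglongrightarrow> 0"
      by (rule tendsto_sandwich[OF always_eventually always_eventually tendsto_const \<delta>(3)];
          intro allI less_imp_le X)
    have lim: "y \<longlonglongrightarrow> h0" if "\<And>n. \<bar>y n - h0\<bar> < \<delta> n" for y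
    proof -
      have "(\<lambda>n. y n - h0) \<longlonglongrightarrow> 0"
        using that by (intro Lim_null_comparison[OF always_eventually \<delta>(3)] allI) (simp add: less_imp_le)
      then show ?thesis by (simp add: LIM_zero_iff)
    qed
    have e1: "e n < \<epsilon>1" for n using X(2)[of n] \<delta>(2)[of n] d by linarith
    have range: "\<kappa> \<le> y \<and> y \<le> H" if "\<bar>y - h0\<bar> < \<delta> n" for n y
      using that \<delta>(2)[of n] d by (auto simp: \<kappa>_def H_def)
    have "abel_sequence T a A1 b B1 e h v h0 \<kappa> C Z" "abel_sequence T a A1 b B1 e k w h0 \<kappa> C Z"
      using range[OF X(3)] range[OF X(4)]
      by (auto intro!: seq X e1 e lim \<kappa>)
    from quotient_lim[OF this]
    have "(\<lambda>n. 0 :: real) \<longlonglongrightarrow> 2 * melnikov' h0"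
      using closed_imp_quotient_zero[OF X(6,7,8,9,5)] by simp
    then have "2 * melnikov' h0 = 0" using LIMSEQ_unique tendsto_const by blast
    then show False using simple by simp
  qed
  then obtain d2 where d2: "0 < d2" and uniq: "\<And>\<epsilon> h k. 0 < \<epsilon> \<Longrightarrow> \<epsilon> < d2 \<Longrightarrow> \<bar>h - h0\<bar> < d2 \<Longrightarrow>
      \<bar>k - h0\<bar> < d2 \<Longrightarrow> periodic \<epsilon> h \<Longrightarrow> periodic \<epsilon> k \<Longrightarrow> h = k" by blast

  \<comment> \<open>The displacement over \<epsilon>^2 tends to \<open>- 4 * melnikov h\<close>, so
    it eventually has the opposite sign. This is applied only at the two ends of the interval, so a
    threshold depending on h suffices.\<close>
  have sgn: "\<exists>d>0. \<forall>\<epsilon> v. 0 < \<epsilon> \<and> \<epsilon> < d \<and> sol \<epsilon> h v \<longrightarrow> (v T - v (- T)) * melnikov h < 0"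
    if h: "\<kappa> \<le> h" "h \<le> H" and M: "melnikov h \<noteq> 0" for h
  proof (rule ccontr)
    assume neg: "\<not> ?thesis"
    let ?P = "\<lambda>\<delta> (\<epsilon>, v). 0 < \<epsilon> \<and> \<epsilon> < \<delta> \<and> sol \<epsilon> h v \<and> \<not> (v T - v (- T)) * melnikov h < 0"
    have exP: "\<exists>x. ?P \<delta> x" if "0 < \<delta>" "\<delta> \<le> \<epsilon>1" for \<delta>
      using neg \<open>0 < \<delta>\<close> by auto
    obtain \<delta> x where \<delta>: "\<And>n :: nat. 0 < \<delta> n" "\<And>n. \<delta> n \<le> \<epsilon>1" "\<delta> \<longlonglongrightarrow> 0" and x: "\<And>n. ?P (\<delta> n) (x n)"
      by (rule sequence_choice[OF \<epsilon>1 exP]) (assumption | rule that)+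
    define e v where "e n = fst (x n)" and "v n = snd (x n)" for n
    have X: "0 < e n" "e n < \<delta> n" "sol (e n) h (v n)" "0 \<le> (v n T - v n (- T)) * melnikov h" for n
      using x[of n] by (auto simp: e_def v_def split: prod.splits)
    have e: "e \<longlonglongrightarrow> 0"
      by (rule tendsto_sandwich[OF always_eventually always_eventually tendsto_const \<delta>(3)];
          intro allI less_imp_le X)
    have e1: "e n < \<epsilon>1" for n using X(2)[of n] \<delta>(2)[of n] by linarith
    interpret abel_sequence T a A1 b B1 e "\<lambda>_. h" v h \<kappa> C Z
      by (rule seq) (use X e e1 h in auto)
    have "(\<lambda>n. (v n T - v n (- T)) / (e n)\<^sup>2 * melnikov h) \<longlonglongrightarrow> - 4 * melnikov h * melnikov h"
      by (intro tendsto_mult displacement_lim tendsto_const)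
    moreover have "0 \<le> (v n T - v n (- T)) / (e n)\<^sup>2 * melnikov h" for n
      using divide_nonneg_nonneg[OF X(4)[of n] zero_le_power2[of "e n"]] by simp
    ultimately have "0 \<le> - 4 * melnikov h * melnikov h"
      by (intro LIMSEQ_le_const) auto
    then have "melnikov h * melnikov h \<le> 0" by simp
    then show False using M not_real_square_gt_zero[of "melnikov h"] by linarith
  qed

  \<comment> \<open>A simple zero is a sign change; stating it as a negative product treats increase
    and decrease alike.\<close>
  have "\<exists>d>0. \<forall>x. 0 < x \<and> x < d \<longrightarrow> melnikov (h0 - x) * melnikov (h0 + x) < 0"
  proof (cases "0 < melnikov' h0")
    case True
    show ?thesis
      using DERIV_pos_inc_left[OF melnikov_deriv[OF h0] True] DERIV_pos_inc_right[OF melnikov_deriv[OF h0] True]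
      unfolding zero by (metis min_less_iff_conj mult_neg_pos)
  next
    case False
    then have "melnikov' h0 < 0" using simple by simp
    then show ?thesis
      using DERIV_neg_dec_left[OF melnikov_deriv[OF h0]] DERIV_neg_dec_right[OF melnikov_deriv[OF h0]]
      unfolding zero by (metis min_less_iff_conj mult_pos_neg)
  qed
  then obtain d where d: "0 < d" and alt: "\<And>x. 0 < x \<Longrightarrow> x < d \<Longrightarrow> melnikov (h0 - x) * melnikov (h0 + x) < 0"
    by blast
  define \<rho> where "\<rho> = Min {d, d2, r1, \<kappa>}"
  have "0 < \<rho>" "\<rho> \<le> d" "\<rho> \<le> d2" "\<rho> \<le> r1" "\<rho> \<le> \<kappa>"
    using d d2 r1 \<kappa> by (auto simp: \<rho>_def)
  then obtain r where r: "0 < r" "r < d" "r < d2" "r < r1" "r < \<kappa>"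
    using that[of "\<rho> / 2"] by auto
  have range: "\<kappa> \<le> h \<and> h \<le> H" if "h \<in> {h0 - r..h0 + r}" for h
    using that r by (auto simp: \<kappa>_def H_def)
  have M: "melnikov (h0 - r) * melnikov (h0 + r) < 0" by (rule alt) (use r in auto)
  then have Mn: "melnikov (h0 - r) \<noteq> 0" "melnikov (h0 + r) \<noteq> 0" by auto
  have ends: "h0 - r \<in> {h0 - r..h0 + r}" "h0 + r \<in> {h0 - r..h0 + r}" using r by auto
  obtain d3 where d3: "0 < d3"
    and s3: "\<forall>\<epsilon> v. 0 < \<epsilon> \<and> \<epsilon> < d3 \<and> sol \<epsilon> (h0 - r) v \<longrightarrow> (v T - v (- T)) * melnikov (h0 - r) < 0"
    using sgn[OF conjunct1[OF range[OF ends(1)]] conjunct2[OF range[OF ends(1)]] Mn(1)] by (elim exE conjE) (rule that)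
  obtain d4 where d4: "0 < d4"
    and s4: "\<forall>\<epsilon> v. 0 < \<epsilon> \<and> \<epsilon> < d4 \<and> sol \<epsilon> (h0 + r) v \<longrightarrow> (v T - v (- T)) * melnikov (h0 + r) < 0"
    using sgn[OF conjunct1[OF range[OF ends(2)]] conjunct2[OF range[OF ends(2)]] Mn(2)] by (elim exE conjE) (rule that)
  define \<epsilon>0 where "\<epsilon>0 = Min {\<epsilon>1, d2, d3, d4}"
  have \<epsilon>0: "0 < \<epsilon>0" "\<epsilon>0 \<le> \<epsilon>1" "\<epsilon>0 \<le> d2" "\<epsilon>0 \<le> d3" "\<epsilon>0 \<le> d4"
    using \<epsilon>1 d2 d3 d4 by (auto simp: \<epsilon>0_def)
  show thesis
  proof (rule that[of r \<epsilon>0])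
    fix \<epsilon> :: real assume \<epsilon>: "0 < \<epsilon>" "\<epsilon> < \<epsilon>0"
    define v where "v h = (SOME v. sol \<epsilon> h v)" for h
    have \<epsilon>': "\<epsilon> < \<epsilon>1" "\<epsilon> < d2" "\<epsilon> < d3" "\<epsilon> < d4" using \<epsilon> \<epsilon>0 by linarith+
    have sol: "sol \<epsilon> h (v h)" if "h \<in> {h0 - r..h0 + r}" for h
      unfolding v_def
      by (rule someI_ex[OF ex[OF \<epsilon>(1) \<epsilon>'(1) conjunct1[OF range[OF that]] conjunct2[OF range[OF that]]]])
    have ge: "\<kappa> / 2 \<le> v h t" if "h \<in> {h0 - r..h0 + r}" "t \<in> {- T..T}" for h t
      using bd[OF \<epsilon>(1) \<epsilon>'(1) conjunct1[OF range[OF that(1)]] conjunct2[OF range[OF that(1)]] sol[OF that(1)] that(2)]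
      by (elim conjE)
    let ?D = "\<lambda>h. v h T - v h (- T)"
    have cD: "continuous_on {h0 - r..h0 + r} ?D"
      by (rule displacement_continuous[OF \<epsilon>(1) _ sol ge]) (use \<kappa> in auto)
    have neg: "?D (h0 - r) * melnikov (h0 - r) < 0" "?D (h0 + r) * melnikov (h0 + r) < 0"
      using s3[rule_format, of \<epsilon> "v (h0 - r)"] s4[rule_format, of \<epsilon> "v (h0 + r)"] sol[OF ends(1)] sol[OF ends(2)] \<epsilon>(1) \<epsilon>' by simp_all
    have "\<exists>h. h0 - r \<le> h \<and> h \<le> h0 + r \<and> ?D h = 0"
    proof (cases "0 < melnikov (h0 - r)")
      case True
      then have "?D (h0 - r) \<le> 0" "0 \<le> ?D (h0 + r)"
        using neg M by (auto simp: mult_less_0_iff)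
      then show ?thesis using IVT'[of ?D "h0 - r" 0 "h0 + r"] cD r by auto
    next
      case False
      then have "0 \<le> ?D (h0 - r)" "?D (h0 + r) \<le> 0"
        using neg M by (auto simp: mult_less_0_iff)
      then show ?thesis using IVT2'[of ?D "h0 + r" 0 "h0 - r"] cD r by auto
    qed
    then obtain h where h: "h0 - r \<le> h" "h \<le> h0 + r" "?D h = 0" by blast
    then have "h \<noteq> h0 - r" "h \<noteq> h0 + r" using neg by auto
    then have "\<bar>h - h0\<bar> < r" using h by auto
    moreover have "periodic \<epsilon> h" unfolding periodic_def using sol[of h] h by auto
    ultimately show "\<exists>!h. \<bar>h - h0\<bar> < r \<and> periodic \<epsilon> h"
      using uniq[of \<epsilon>] \<epsilon> \<epsilon>0 r by (intro ex1I[of _ h]) auto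
  qed (use r \<epsilon>0 in \<open>auto simp: \<kappa>_def\<close>)
qed

end

section \<open>Counting limit cycles\<close>

text \<open>Each isolated initial value is attained by a closed solution, whose restriction to
  [-T,T] is extensional and hence counted. Different initial values give different solutions, so it
  is enough to count initial values.\<close>

lemma num_limit_cycles_ge:
  assumes T: "0 < T" and P: "finite P"
    and iso: "\<And>p. p \<in> P \<Longrightarrow> p isolated_in {y (- T) |y. closed_solution T g y}"
  shows "enat (card P) \<le> num_limit_cycles T g"
proof (cases "finite (limit_cycles T g)")
  case True
  have "P \<subseteq> (\<lambda>x. x (- T)) ` limit_cycles T g"
  proof
    fix p assume p: "p \<in> P"
    then obtain y where y: "closed_solution T g y" "p = y (- T)"
      using iso[OF p] unfolding isolated_in_def by blast
    let ?x = "restrict y {- T..T}"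
    have eq: "?x (- T) = p" "?x T = y T" using T y by auto
    have "closed_solution T g ?x"
      unfolding closed_solution_def
    proof (intro conjI ballI)
      fix t assume t: "t \<in> {- T..T}"
      then have "(y has_real_derivative g t (?x t)) (at t within {- T..T})"
        using y by (auto simp: closed_solution_def)
      then show "(?x has_real_derivative g t (?x t)) (at t within {- T..T})"
        by (rule has_field_derivative_transform_within[OF _ zero_less_one t]) simp
    next
      show "?x (- T) = ?x T" using y eq by (simp add: closed_solution_def)
    qed
    then have "?x \<in> limit_cycles T g"
      unfolding limit_cycles_def using iso[OF p] eq by simp
    then show "p \<in> (\<lambda>x. x (- T)) ` limit_cycles T g" using eq by blast
  qed
  then have "card P \<le> card ((\<lambda>x. x (- T)) ` limit_cycles T g)"
    using True by (intro card_mono) auto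
  also have "\<dots> \<le> card (limit_cycles T g)" using True by (rule card_image_le)
  finally show ?thesis using True by (simp add: num_limit_cycles_def)
qed (simp add: num_limit_cycles_def)

lemma finite_separation:
  fixes S :: "real set"
  assumes "finite S"
  obtains d where "0 < d" "\<And>x y. x \<in> S \<Longrightarrow> y \<in> S \<Longrightarrow> x \<noteq> y \<Longrightarrow> d \<le> \<bar>x - y\<bar>"
proof -
  let ?D = "insert 1 ((\<lambda>(x, y). \<bar>x - y\<bar>) ` {(x, y). x \<in> S \<and> y \<in> S \<and> x \<noteq> y})"
  have "finite {(x, y). x \<in> S \<and> y \<in> S \<and> x \<noteq> y}"
    by (rule finite_subset[of _ "S \<times> S"]) (use assms in auto)
  then have fin: "finite ?D" by simp
  show thesis
  proof (rule that[of "Min ?D"])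
    show "0 < Min ?D" using fin by (subst Min_gr_iff) auto
    show "Min ?D \<le> \<bar>x - y\<bar>" if "x \<in> S" "y \<in> S" "x \<noteq> y" for x y
      using fin that by (intro Min_le) auto
  qed
qed

section \<open>Isolated initial values of closed solutions\<close>

context abel_perturbation
begin

abbreviation initial_values :: "real \<Rightarrow> real set" where
  "initial_values \<epsilon> \<equiv> {y (- T) |y. closed_solution T (abel \<epsilon>) y}"

lemma periodic_imp_initial_value:
  assumes "periodic \<epsilon> h"
  shows "1 / sqrt h \<in> initial_values \<epsilon>"
proof -
  obtain v where v: "sol \<epsilon> h v" "v T = v (- T)" using assms by (auto simp: periodic_def)
  have "closed_solution T (abel \<epsilon>) (\<lambda>t. 1 / sqrt (v t))"
    unfolding closed_solution_def using sol_imp_abel[OF v(1)] v(2) by simp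
  moreover have "1 / sqrt (v (- T)) = 1 / sqrt h" using sol_init[OF v(1)] by simp
  ultimately show ?thesis by (metis (mono_tags, lifting) mem_Collect_eq)
qed

lemma initial_value_imp_periodic:
  assumes "p \<in> initial_values \<epsilon>" "0 < p"
  shows "periodic \<epsilon> (1 / p\<^sup>2)"
proof -
  obtain x where x: "closed_solution T (abel \<epsilon>) x" "p = x (- T)" using assms by blast
  have "sol \<epsilon> (1 / (x (- T))\<^sup>2) (\<lambda>t. 1 / (x t)\<^sup>2)"
    by (rule abel_imp_sol(1)) (use x assms(2) in \<open>simp_all add: closed_solution_def\<close>)
  moreover have "x T = x (- T)" using x(1) by (simp add: closed_solution_def)
  ultimately have "sol \<epsilon> (1 / (x (- T))\<^sup>2) (\<lambda>t. 1 / (x t)\<^sup>2) \<and> 1 / (x T)\<^sup>2 = 1 / (x (- T))\<^sup>2"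
    by simp
  then show ?thesis
    unfolding periodic_def x(2) by (intro exI[where x = "\<lambda>t. 1 / (x t)\<^sup>2"])
qed

text \<open>A small initial value p means a large h = 1 / p^2, and then v stays large. From (sqrt
  v)' = - A / sqrt v - B, a closed solution makes the integral of A / sqrt v cancel that of B; the
  former is small, while the latter is \<epsilon>^2 times the nonzero integral of
  \<open>B1\<close>.\<close>

lemma no_small_periodic:
  assumes \<epsilon>: "0 < \<epsilon>" and B1: "integral {- T..T} B1 \<noteq> 0"
  obtains \<eta> where "0 < \<eta>" "\<And>p. p \<in> initial_values \<epsilon> \<Longrightarrow> 0 < p \<Longrightarrow> \<eta> \<le> p"
proof -
  have "bounded ((\<lambda>t. \<bar>coefA \<epsilon> t\<bar> + \<bar>coefB \<epsilon> t\<bar>) ` {- T..T})"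
    by (intro compact_imp_bounded compact_continuous_image continuous_intros cont_coef) auto
  then obtain K' where "\<forall>x\<in>(\<lambda>t. \<bar>coefA \<epsilon> t\<bar> + \<bar>coefB \<epsilon> t\<bar>) ` {- T..T}. norm x \<le> K'"
    unfolding bounded_iff by blast
  then have K': "\<bar>coefA \<epsilon> t\<bar> + \<bar>coefB \<epsilon> t\<bar> \<le> K'" if "t \<in> {- T..T}" for t using that by auto
  define K where "K = max K' 1"
  have K: "\<bar>coefA \<epsilon> t\<bar> \<le> K" "\<bar>coefB \<epsilon> t\<bar> \<le> K" if "t \<in> {- T..T}" for t
    using K'[OF that] by (auto simp: K_def)
  have K1: "1 \<le> K" by (simp add: K_def)
  have intB: "integral {- T..T} (coefB \<epsilon>) = \<epsilon>\<^sup>2 * integral {- T..T} B1"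
  proof -
    have "integral {- T..T} (coefB \<epsilon>) = \<epsilon> * integral {- T..T} b + \<epsilon>\<^sup>2 * integral {- T..T} B1"
      unfolding coefB_def using cont_b cont_B1
      by (subst integral_add) (auto intro!: integrable_continuous_real continuous_intros)
    then show ?thesis using integral_odd[OF cont_b b_odd, of T] T_pos by simp
  qed
  define \<beta> where "\<beta> = \<bar>\<epsilon>\<^sup>2 * integral {- T..T} B1\<bar>"
  have \<beta>: "0 < \<beta>" using \<epsilon> B1 by (simp add: \<beta>_def)
  \<comment> \<open>If v is at least \<open>m\<close>, the integral of A / sqrt v is at most
    \<open>2 * K * T / sqrt m\<close>, hence at most half of \<open>\<beta>\<close>, the modulus of
    the integral of B. As \<open>E\<close> bounds the factor by which v + 3 can shrink, an initial
    value above \<open>H\<close> keeps v above \<open>m\<close>.\<close>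
  define m where "m = (4 * K * T / \<beta>)\<^sup>2 + 1"
  have m: "0 < m" by (simp add: m_def add_nonneg_pos)
  define E where "E = exp (K * (T - - T))"
  define H where "H = (m + 3) * E"
  have H: "0 < H" using m by (simp add: H_def E_def)
  have no: "\<not> periodic \<epsilon> h" if h: "H \<le> h" for h
  proof
    assume "periodic \<epsilon> h"
    then obtain v where v: "sol \<epsilon> h v" and vT: "v T = v (- T)" by (auto simp: periodic_def)
    \<comment> \<open>The shift by 3 makes the equation linear with coefficient bounded by
      \<open>K\<close>: since 2 sqrt v \<le> 1 + v, the numerator is at most K * (2 + 1 +
      v).\<close>
    let ?c = "\<lambda>t. (- 2 * coefA \<epsilon> t - 2 * coefB \<epsilon> t * sqrt (v t)) / (v t + 3)"
    have vp: "0 < v t" if "t \<in> {- T..T}" for t by (rule sol_pos[OF v that])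
    have cc: "continuous_on {- T..T} ?c"
    proof (intro continuous_intros cont_coef sol_cont[OF v] ballI)
      fix t assume "t \<in> {- T..T}"
      from vp[OF this] show "v t + 3 \<noteq> 0" by linarith
    qed
    have c_bound: "\<bar>?c t\<bar> \<le> K" if t: "t \<in> {- T..T}" for t
    proof -
      have p: "0 < v t" "0 < sqrt (v t)" using vp[OF t] by auto
      have "2 * 1 * sqrt (v t) \<le> 1\<^sup>2 + (sqrt (v t))\<^sup>2" by (rule sum_squares_bound)
      then have s: "2 * sqrt (v t) \<le> 1 + v t" using p by simp
      have "\<bar>- 2 * coefA \<epsilon> t - 2 * coefB \<epsilon> t * sqrt (v t)\<bar>
          \<le> \<bar>- 2 * coefA \<epsilon> t\<bar> + \<bar>2 * coefB \<epsilon> t * sqrt (v t)\<bar>"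
        by (rule abs_triangle_ineq4)
      also have "\<dots> = 2 * \<bar>coefA \<epsilon> t\<bar> + \<bar>coefB \<epsilon> t\<bar> * (2 * sqrt (v t))"
        using p by (simp add: abs_mult)
      also have "\<dots> \<le> 2 * K + K * (1 + v t)"
        using K[OF t] K1 p s by (intro add_mono mult_mono) auto
      also have "\<dots> = K * (v t + 3)" by (simp add: algebra_simps)
      finally have le: "\<bar>- 2 * coefA \<epsilon> t - 2 * coefB \<epsilon> t * sqrt (v t)\<bar> \<le> K * (v t + 3)" .
      have p3: "0 < v t + 3" using p by simp
      show ?thesis
        unfolding abs_divide abs_of_pos[OF p3] pos_divide_le_eq[OF p3] by (rule le)
    qed
    have v_ge: "m \<le> v t" if t: "t \<in> {- T..T}" for t
    proof -
      have sub: "{- T..t} \<subseteq> {- T..T}" using t by auto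
      have "v t + 3 = (v (- T) + 3) * exp (integral {- T..t} ?c)"
      proof (rule linear_ode_solution[where e = "\<lambda>t. v t + 3", OF cc _ t])
        fix s assume s: "s \<in> {- T..T}"
        have "?c s * (v s + 3) = - 2 * coefA \<epsilon> s - 2 * coefB \<epsilon> s * sqrt (v s)"
          using vp[OF s] by simp
        then show "((\<lambda>t. v t + 3) has_real_derivative ?c s * (v s + 3)) (at s within {- T..T})"
          by (auto intro!: derivative_eq_intros sol_deriv[OF v s])
      qed
      then have eq: "v t + 3 = (h + 3) * exp (integral {- T..t} ?c)"
        by (simp only: sol_init[OF v])
      have "norm (integral {- T..t} ?c) \<le> K * (t - - T)"
        by (rule integral_bound[OF _ continuous_on_subset[OF cc sub]])
           (use t in simp, rule c_bound[folded real_norm_def], use t in simp)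
      moreover have "K * (t - - T) \<le> K * (T - - T)" using t K1 by (intro mult_left_mono) auto
      ultimately have "- (K * (T - - T)) \<le> integral {- T..t} ?c"
        unfolding real_norm_def by linarith
      then have "(h + 3) * exp (- (K * (T - - T))) \<le> v t + 3"
        unfolding eq using h H by (intro mult_left_mono) auto
      moreover have "m + 3 = H * exp (- (K * (T - - T)))"
        by (simp add: H_def E_def exp_minus)
      moreover have "H * exp (- (K * (T - - T))) \<le> (h + 3) * exp (- (K * (T - - T)))"
        using h by (intro mult_right_mono) auto
      ultimately show ?thesis by linarith
    qed
    let ?q = "\<lambda>t. coefA \<epsilon> t / sqrt (v t)"
    have cq: "continuous_on {- T..T} ?q"
    proof (intro continuous_intros cont_coef sol_cont[OF v] ballI)
      fix t assume "t \<in> {- T..T}"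
      from vp[OF this] show "sqrt (v t) \<noteq> 0" by simp
    qed
    have "((\<lambda>t. - (?q t) - coefB \<epsilon> t) has_integral sqrt (v T) - sqrt (v (- T))) {- T..T}"
    proof (rule fundamental_theorem_of_calculus)
      fix t assume t: "t \<in> {- T..T}"
      have p: "0 < v t" "0 < sqrt (v t)" using vp[OF t] by auto
      have "((\<lambda>t. sqrt (v t)) has_real_derivative - (?q t) - coefB \<epsilon> t) (at t within {- T..T})"
        using p by (auto intro!: derivative_eq_intros sol_deriv[OF v t] simp: field_simps)
      then show "((\<lambda>t. sqrt (v t)) has_vector_derivative - (?q t) - coefB \<epsilon> t) (at t within {- T..T})"
        by (simp add: has_real_derivative_iff_has_vector_derivative)
    qed (use T_pos in auto)
    then have "integral {- T..T} (\<lambda>t. - (?q t) - coefB \<epsilon> t) = 0"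
      using vT by (simp add: integral_unique)
    moreover have "integral {- T..T} (\<lambda>t. - (?q t) - coefB \<epsilon> t)
        = - integral {- T..T} ?q - integral {- T..T} (coefB \<epsilon>)"
      by (subst integral_diff) (auto intro!: integrable_continuous_real continuous_intros cq cont_coef)
    ultimately have "\<bar>integral {- T..T} ?q\<bar> = \<beta>" by (simp add: \<beta>_def intB)
    moreover have "norm (integral {- T..T} ?q) \<le> K / sqrt m * (T - - T)"
    proof (rule integral_bound[OF _ cq])
      fix t assume t: "t \<in> {- T..T}"
      show "norm (?q t) \<le> K / sqrt m"
        unfolding real_norm_def abs_divide
        using K[OF t] v_ge[OF t] m by (intro frac_le) auto
    qed (use T_pos in auto)
    moreover have "K / sqrt m * (T - - T) < \<beta>"
    proof -
      have "4 * K * T / \<beta> = sqrt ((4 * K * T / \<beta>)\<^sup>2)" using K1 T_pos \<beta> by simp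
      also have "\<dots> \<le> sqrt m" unfolding m_def by (rule real_sqrt_le_mono) simp
      finally have "4 * (K * T) \<le> \<beta> * sqrt m" using \<beta> by (simp add: field_simps)
      moreover have "0 < K * T" using K1 T_pos by simp
      ultimately have "2 * (K * T) < \<beta> * sqrt m" by linarith
      then show ?thesis using m by (simp add: field_simps)
    qed
    ultimately show False by simp
  qed
  show thesis
  proof (rule that[of "1 / sqrt H"])
    fix p assume p: "p \<in> initial_values \<epsilon>" "0 < p"
    have "\<not> H \<le> 1 / p\<^sup>2" using no initial_value_imp_periodic[OF p] by blast
    then have "1 / H < p\<^sup>2" using H p by (simp add: field_simps)
    then have "sqrt (1 / H) < p" using p by (metis real_less_lsqrt H divide_nonneg_nonneg less_imp_le zero_le_one)
    then show "1 / sqrt H \<le> p" by (simp add: real_sqrt_divide)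
  qed (use H in simp)
qed

text \<open>Radii below half the separation of \<open>hs\<close> make the intervals around its
  points disjoint, so the closed solutions found there are distinct. As each interval holds exactly
  one periodic h, its image under h -> 1 / sqrt h isolates the initial value.\<close>

lemma positive_limit_cycles:
  assumes fin: "finite hs" and hs: "\<And>h. h \<in> hs \<Longrightarrow> 0 < h \<and> melnikov h = 0 \<and> melnikov' h \<noteq> 0"
  obtains \<epsilon>0 where "0 < \<epsilon>0"
    "\<And>\<epsilon>. 0 < \<epsilon> \<Longrightarrow> \<epsilon> < \<epsilon>0 \<Longrightarrow> \<exists>P. finite P \<and> card P = card hs \<and>
       (\<forall>p\<in>P. 0 < p \<and> p isolated_in initial_values \<epsilon>)"
proof -
  obtain d where d: "0 < d" and sep: "\<And>x y. x \<in> hs \<Longrightarrow> y \<in> hs \<Longrightarrow> x \<noteq> y \<Longrightarrow> d \<le> \<bar>x - y\<bar>"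
    by (rule finite_separation[OF fin]) (rule that)
  have "\<forall>h\<in>hs. \<exists>r \<epsilon>0. 0 < r \<and> r < d / 2 \<and> r < h \<and> 0 < \<epsilon>0 \<and>
      (\<forall>\<epsilon>. 0 < \<epsilon> \<and> \<epsilon> < \<epsilon>0 \<longrightarrow> (\<exists>!k. \<bar>k - h\<bar> < r \<and> periodic \<epsilon> k))"
  proof
    fix h assume "h \<in> hs"
    then have h: "0 < h" "melnikov h = 0" "melnikov' h \<noteq> 0" using hs by auto
    have "0 < d / 2" using d by simp
    from simple_zero_persists[OF h this] show "\<exists>r \<epsilon>0. 0 < r \<and> r < d / 2 \<and> r < h \<and> 0 < \<epsilon>0 \<and>
      (\<forall>\<epsilon>. 0 < \<epsilon> \<and> \<epsilon> < \<epsilon>0 \<longrightarrow> (\<exists>!k. \<bar>k - h\<bar> < r \<and> periodic \<epsilon> k))" by metis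
  qed
  then obtain r where "\<forall>h\<in>hs. \<exists>\<epsilon>0. 0 < r h \<and> r h < d / 2 \<and> r h < h \<and> 0 < \<epsilon>0 \<and>
      (\<forall>\<epsilon>. 0 < \<epsilon> \<and> \<epsilon> < \<epsilon>0 \<longrightarrow> (\<exists>!k. \<bar>k - h\<bar> < r h \<and> periodic \<epsilon> k))"
    by (rule bchoice[THEN exE])
  then obtain e where "\<forall>h\<in>hs. 0 < r h \<and> r h < d / 2 \<and> r h < h \<and> 0 < e h \<and>
      (\<forall>\<epsilon>. 0 < \<epsilon> \<and> \<epsilon> < e h \<longrightarrow> (\<exists>!k. \<bar>k - h\<bar> < r h \<and> periodic \<epsilon> k))"
    by (rule bchoice[THEN exE])
  then have re: "0 < r h" "r h < d / 2" "r h < h" "0 < e h"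
    and uq: "\<And>\<epsilon>. 0 < \<epsilon> \<Longrightarrow> \<epsilon> < e h \<Longrightarrow> \<exists>!k. \<bar>k - h\<bar> < r h \<and> periodic \<epsilon> k" if "h \<in> hs" for h
    using that by blast+
  define \<epsilon>0 where "\<epsilon>0 = Min (insert 1 (e ` hs))"
  show thesis
  proof (rule that[of \<epsilon>0])
    show "0 < \<epsilon>0" unfolding \<epsilon>0_def using fin re by (subst Min_gr_iff) auto
    fix \<epsilon> assume \<epsilon>: "0 < \<epsilon>" "\<epsilon> < \<epsilon>0"
    have \<epsilon>e: "\<epsilon> < e h" if "h \<in> hs" for h
      using \<epsilon> fin that by (auto simp: \<epsilon>0_def)
    define k where "k h = (THE k. \<bar>k - h\<bar> < r h \<and> periodic \<epsilon> k)" for h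
    have k: "\<bar>k h - h\<bar> < r h" "periodic \<epsilon> (k h)" if "h \<in> hs" for h
      using theI'[OF uq[OF that \<epsilon>(1) \<epsilon>e[OF that]]] unfolding k_def by blast+
    have kpos: "0 < k h" if "h \<in> hs" for h using k[OF that] re(3)[OF that] by linarith
    define P where "P = (\<lambda>h. 1 / sqrt (k h)) ` hs"
    have inj: "inj_on (\<lambda>h. 1 / sqrt (k h)) hs"
    proof (rule inj_onI)
      fix x y assume xy: "x \<in> hs" "y \<in> hs" "1 / sqrt (k x) = 1 / sqrt (k y)"
      then have "k x = k y" using kpos[of x] kpos[of y] by simp
      then have "\<bar>x - y\<bar> < d"
        using k(1)[OF xy(1)] k(1)[OF xy(2)] re(2)[OF xy(1)] re(2)[OF xy(2)] by linarith
      then show "x = y" using sep[OF xy(1,2)] by linarith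
    qed
    show "\<exists>P. finite P \<and> card P = card hs \<and> (\<forall>p\<in>P. 0 < p \<and> p isolated_in initial_values \<epsilon>)"
    proof (intro exI[of _ P] conjI ballI)
      show "finite P" "card P = card hs" using fin card_image[OF inj] by (auto simp: P_def)
      fix p assume "p \<in> P"
      then obtain h where h: "h \<in> hs" "p = 1 / sqrt (k h)" by (auto simp: P_def)
      show p: "0 < p" using h kpos by simp
      \<comment> \<open>The image of \<open>{h - r h<..<h + r h}\<close> under the decreasing map h
        -> 1 / sqrt h; \<open>r h < h\<close> keeps it bounded and among positive values.\<close>
      let ?U = "{1 / sqrt (h + r h)<..<1 / sqrt (h - r h)}"
      have r: "0 < h - r h" "0 < h + r h" using re(1,3)[OF h(1)] by auto
      have mem: "q \<in> ?U \<longleftrightarrow> \<bar>1 / q\<^sup>2 - h\<bar> < r h" if q: "0 < q" for q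
      proof -
        have 1: "1 / sqrt y < q \<longleftrightarrow> 1 / q\<^sup>2 < y" if "0 < y" for y
        proof -
          have "1 / sqrt y < q \<longleftrightarrow> 1 / q < sqrt y" using q that by (simp add: field_simps)
          also have "\<dots> \<longleftrightarrow> (1 / q)\<^sup>2 < (sqrt y)\<^sup>2"
            unfolding not_le[symmetric] using q that by (subst power_mono_iff) auto
          finally show ?thesis using that by (simp add: power_one_over)
        qed
        have 2: "q < 1 / sqrt y \<longleftrightarrow> y < 1 / q\<^sup>2" if "0 < y" for y
        proof -
          have "q < 1 / sqrt y \<longleftrightarrow> sqrt y < 1 / q" using q that by (simp add: field_simps)
          also have "\<dots> \<longleftrightarrow> (sqrt y)\<^sup>2 < (1 / q)\<^sup>2"
            unfolding not_le[symmetric] using q that by (subst power_mono_iff) auto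
          finally show ?thesis using that by (simp add: power_one_over)
        qed
        show ?thesis using 1[OF r(2)] 2[OF r(1)] by auto
      qed
      have p2: "1 / p\<^sup>2 = k h" using h kpos[OF h(1)] by (simp add: power_one_over)
      show "p isolated_in initial_values \<epsilon>"
        unfolding isolated_in_def
      proof (intro conjI exI[of _ ?U])
        show pI: "p \<in> initial_values \<epsilon>"
          using periodic_imp_initial_value[OF k(2)[OF h(1)]] h(2) by simp
        show "?U \<inter> initial_values \<epsilon> = {p}"
        proof (intro equalityI subsetI)
          fix q assume q: "q \<in> ?U \<inter> initial_values \<epsilon>"
          have q0: "0 < q" using q r by (auto intro: less_trans[of 0 "1 / sqrt (h + r h)"])
          have "\<bar>1 / q\<^sup>2 - h\<bar> < r h" "periodic \<epsilon> (1 / q\<^sup>2)"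
            using mem[OF q0] q initial_value_imp_periodic[OF _ q0] by blast+
          then have "k h = 1 / q\<^sup>2"
            unfolding k_def by (intro the1_equality[OF uq[OF h(1) \<epsilon>(1) \<epsilon>e[OF h(1)]]] conjI)
          then have "k h * q\<^sup>2 = k h * p\<^sup>2" using p2 p q0 by (simp add: field_simps)
          then have "q\<^sup>2 = p\<^sup>2" using kpos[OF h(1)] by simp
          then show "q \<in> {p}" using p q0 by (simp add: power2_eq_iff_nonneg)
        next
          fix q assume "q \<in> {p}"
          then show "q \<in> ?U \<inter> initial_values \<epsilon>" using pI mem[OF p] p2 k(1)[OF h(1)] by simp
        qed
      qed simp
    qed
  qed
qed

text \<open>The reflection x -> -x changes the signs of \<open>b\<close> and \<open>B1\<close>,
  hence of both \<open>melnikov\<close> and \<open>melnikov'\<close>, so the same set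
  \<open>hs\<close> serves for negative solutions.\<close>

theorem limit_cycles_from_simple_zeros:
  assumes fin: "finite hs" and hs: "\<And>h. h \<in> hs \<Longrightarrow> 0 < h \<and> melnikov h = 0 \<and> melnikov' h \<noteq> 0"
    and B1: "integral {- T..T} B1 \<noteq> 0"
  obtains \<epsilon> where "0 < \<epsilon>" "enat (2 * card hs + 1) \<le> num_limit_cycles T (abel \<epsilon>)"
proof -
  interpret neg: abel_perturbation T a A1 "\<lambda>t. - b t" "\<lambda>t. - B1 t"
    by (rule abel_perturbation.intro[OF T_pos cont_a cont_A1 continuous_on_minus[OF cont_b]
          continuous_on_minus[OF cont_B1] a_odd _ a_nonneg integral_A1]) (simp_all add: b_odd)
  have coefB: "neg.coefB \<epsilon> t = - coefB \<epsilon> t" for \<epsilon> t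
    by (simp add: coefB_def neg.coefB_def)
  have abel: "neg.abel \<epsilon> t x = - abel \<epsilon> t (- x)" for \<epsilon> t x
    by (simp add: abel_def neg.abel_def coefB power2_eq_square power3_eq_cube)
  have even: "even_part (\<lambda>t. - B1 t) t = - even_part B1 t" for t
    by (simp add: even_part_def field_simps)
  have melnikov: "neg.melnikov h = - melnikov h" "neg.melnikov' h = - melnikov' h" for h
    unfolding neg.melnikov_def melnikov_def neg.melnikov'_def melnikov'_def even
    by (simp_all flip: integral_neg)
  have closed: "closed_solution T (neg.abel \<epsilon>) (\<lambda>t. - x t)" if "closed_solution T (abel \<epsilon>) x" for \<epsilon> x
    using that DERIV_minus unfolding closed_solution_def abel by fastforce
  have iv: "- p \<in> neg.initial_values \<epsilon>" if p: "p \<in> initial_values \<epsilon>" for p \<epsilon>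
  proof -
    obtain y where "closed_solution T (abel \<epsilon>) y" "p = y (- T)" using p by blast
    then show ?thesis using closed[of \<epsilon> y] by (intro CollectI exI[of _ "\<lambda>t. - y t"]) simp
  qed
  have closed': "closed_solution T (abel \<epsilon>) (\<lambda>t. - x t)" if "closed_solution T (neg.abel \<epsilon>) x" for \<epsilon> x
    using that DERIV_minus unfolding closed_solution_def abel by fastforce
  have iv': "- p \<in> initial_values \<epsilon>" if p: "p \<in> neg.initial_values \<epsilon>" for p \<epsilon>
  proof -
    obtain y where "closed_solution T (neg.abel \<epsilon>) y" "p = y (- T)" using p by blast
    then show ?thesis using closed'[of \<epsilon> y] by (intro CollectI exI[of _ "\<lambda>t. - y t"]) simp
  qed

  obtain \<epsilon>1 where \<epsilon>1: "0 < \<epsilon>1" and P1: "\<And>\<epsilon>. 0 < \<epsilon> \<Longrightarrow> \<epsilon> < \<epsilon>1 \<Longrightarrow> \<exists>P. finite P \<and> card P = card hs \<and>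
       (\<forall>p\<in>P. 0 < p \<and> p isolated_in initial_values \<epsilon>)"
    by (rule positive_limit_cycles[OF fin hs]) (assumption | rule that)+
  have hs': "0 < h \<and> neg.melnikov h = 0 \<and> neg.melnikov' h \<noteq> 0" if "h \<in> hs" for h
    using hs[OF that] by (simp add: melnikov)
  obtain \<epsilon>2 where \<epsilon>2: "0 < \<epsilon>2" and P2: "\<And>\<epsilon>. 0 < \<epsilon> \<Longrightarrow> \<epsilon> < \<epsilon>2 \<Longrightarrow> \<exists>P. finite P \<and> card P = card hs \<and>
       (\<forall>p\<in>P. 0 < p \<and> p isolated_in neg.initial_values \<epsilon>)"
    by (rule neg.positive_limit_cycles[OF fin hs']) (assumption | rule that)+
  \<comment> \<open>All cycles must belong to one equation, so a single \<epsilon> has to lie below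
    the thresholds of both signs.\<close>
  define \<epsilon> where "\<epsilon> = min \<epsilon>1 \<epsilon>2 / 2"
  have \<epsilon>: "0 < \<epsilon>" "\<epsilon> < \<epsilon>1" "\<epsilon> < \<epsilon>2" using \<epsilon>1 \<epsilon>2 by (auto simp: \<epsilon>_def min_def)
  obtain P where P: "finite P" "card P = card hs" "\<And>p. p \<in> P \<Longrightarrow> 0 < p \<and> p isolated_in initial_values \<epsilon>"
    using P1[OF \<epsilon>(1,2)] by blast
  obtain Q where Q: "finite Q" "card Q = card hs" "\<And>p. p \<in> Q \<Longrightarrow> 0 < p \<and> p isolated_in neg.initial_values \<epsilon>"
    using P2[OF \<epsilon>(1,3)] by blast
  \<comment> \<open>\<open>no_small_periodic\<close> gives a gap to the right of 0; for the
    reflected equation it gives a gap to the left.\<close>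
  have zero: "0 isolated_in initial_values \<epsilon>"
  proof -
    obtain \<eta> where \<eta>: "0 < \<eta>" "\<And>p. p \<in> initial_values \<epsilon> \<Longrightarrow> 0 < p \<Longrightarrow> \<eta> \<le> p"
      by (rule no_small_periodic[OF \<epsilon>(1) B1]) (rule that)
    have B1': "integral {- T..T} (\<lambda>t. - B1 t) \<noteq> 0" using B1 by simp
    obtain \<eta>' where \<eta>': "0 < \<eta>'" "\<And>p. p \<in> neg.initial_values \<epsilon> \<Longrightarrow> 0 < p \<Longrightarrow> \<eta>' \<le> p"
      by (rule neg.no_small_periodic[OF \<epsilon>(1) B1']) (rule that)
    have "closed_solution T (abel \<epsilon>) (\<lambda>_. 0)"
      by (simp add: closed_solution_def abel_def)
    then have mem: "0 \<in> initial_values \<epsilon>" by force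
    moreover have "{- \<eta>'<..<\<eta>} \<inter> initial_values \<epsilon> = {0}"
    proof (intro equalityI subsetI)
      fix p assume p: "p \<in> {- \<eta>'<..<\<eta>} \<inter> initial_values \<epsilon>"
      have "\<not> 0 < p" using \<eta>(2)[of p] p by auto
      moreover have "\<not> p < 0" using \<eta>'(2)[OF iv[of p \<epsilon>]] p by auto
      ultimately show "p \<in> {0}" by auto
    qed (use mem \<eta>(1) \<eta>'(1) in auto)
    ultimately show ?thesis
      unfolding isolated_in_def by (intro conjI exI[of _ "{- \<eta>'<..<\<eta>}"]) simp_all
  qed
  have minus: "- q isolated_in initial_values \<epsilon>" if q: "q \<in> Q" for q
  proof -
    obtain U where U: "open U" "U \<inter> neg.initial_values \<epsilon> = {q}" and q': "q \<in> neg.initial_values \<epsilon>"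
      using Q(3)[OF q] unfolding isolated_in_def by blast
    have "uminus ` U \<inter> initial_values \<epsilon> = {- q}"
    proof (intro equalityI subsetI)
      fix p assume "p \<in> uminus ` U \<inter> initial_values \<epsilon>"
      then obtain u where u: "u \<in> U" "p = - u" "p \<in> initial_values \<epsilon>" by blast
      have "u \<in> neg.initial_values \<epsilon>" using iv[OF u(3)] unfolding u(2) minus_minus .
      then have "u = q" using u(1) U(2) by blast
      then show "p \<in> {- q}" using u(2) by simp
    next
      fix p assume "p \<in> {- q}"
      then show "p \<in> uminus ` U \<inter> initial_values \<epsilon>" using U(2) q' iv'[OF q'] by blast
    qed
    moreover have "open (uminus ` U)" using U(1) by (rule open_negations)
    ultimately show ?thesis unfolding isolated_in_def using iv'[OF q'] by blast
  qed
  let ?R = "insert 0 (P \<union> uminus ` Q)"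
  have disj: "P \<inter> uminus ` Q = {}" "0 \<notin> P \<union> uminus ` Q"
    using P(3) Q(3) by force+
  have "card (uminus ` Q) = card hs" using card_image[of uminus Q] Q(2) by (simp add: inj_on_def)
  then have "card ?R = 2 * card hs + 1"
    using disj P(1,2) Q(1) by (simp add: card_Un_disjoint)
  moreover have "enat (card ?R) \<le> num_limit_cycles T (abel \<epsilon>)"
    by (rule num_limit_cycles_ge[OF T_pos]) (use P Q zero minus in auto)
  ultimately show thesis using that \<epsilon>(1) by simp
qed

end

section \<open>Moments and linear systems\<close>

lemma nonzero_constant_sign:
  fixes g :: "real \<Rightarrow> real"
  assumes "continuous_on {a<..<b} g" "\<And>t. t \<in> {a<..<b} \<Longrightarrow> g t \<noteq> 0"
  obtains \<tau> :: real where "\<tau> = 1 \<or> \<tau> = - 1" "\<And>t. t \<in> {a<..<b} \<Longrightarrow> 0 < \<tau> * g t"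
proof -
  have conn: "connected (g ` {a<..<b})" by (intro connected_continuous_image assms(1)) simp
  have "(\<forall>t\<in>{a<..<b}. 0 < g t) \<or> (\<forall>t\<in>{a<..<b}. g t < 0)"
  proof (rule ccontr)
    assume "\<not> ?thesis"
    then obtain s t where "s \<in> {a<..<b}" "t \<in> {a<..<b}" "g s \<le> 0" "0 \<le> g t" by (meson not_le)
    then have "0 \<in> g ` {a<..<b}" using connectedD_interval[OF conn, of "g s" "g t" 0] by blast
    then show False using assms(2) by force
  qed
  then show thesis using that[of 1] that[of "- 1"] by auto
qed

text \<open>Induction on the number of zeros, by cutting at the largest zero z: the claim holds on
  the left of z by induction, and to the right of z the sign of g is constant while all factors
  found so far are nonnegative.\<close>

lemma sign_change_product:
  fixes g \<phi> :: "real \<Rightarrow> real"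
  assumes "continuous_on {a<..<b} g" "finite {t \<in> {a<..<b}. g t = 0}" "mono_on {a<..<b} \<phi>"
  shows "\<exists>Z \<sigma>. Z \<subseteq> {t \<in> {a<..<b}. g t = 0} \<and> (\<forall>t\<in>{a<..<b}. 0 \<le> \<sigma> * g t * (\<Prod>z\<in>Z. \<phi> t - \<phi> z))
    \<and> (\<sigma> = 1 \<or> \<sigma> = (- 1 :: real))"
  using assms
proof (induction "card {t \<in> {a<..<b}. g t = 0}" arbitrary: b rule: less_induct)
  case less
  let ?N = "\<lambda>b. {t \<in> {a<..<b}. g t = 0}"
  show ?case
  proof (cases "?N b = {}")
    case True
    then obtain \<tau> :: real where "\<tau> = 1 \<or> \<tau> = - 1" "\<And>t. t \<in> {a<..<b} \<Longrightarrow> 0 < \<tau> * g t"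
      using nonzero_constant_sign[OF less.prems(1)] by blast
    then show ?thesis by (intro exI[of _ "{}"] exI[of _ \<tau>]) (auto intro: less_imp_le)
  next
    case False
    define z where "z = Max (?N b)"
    have z: "z \<in> ?N b" unfolding z_def by (rule Max_in[OF less.prems(2) False])
    have zmax: "t \<le> z" if "t \<in> ?N b" for t unfolding z_def by (rule Max_ge[OF less.prems(2) that])
    have sub: "?N z \<subset> ?N b" using z by auto
    have "card (?N z) < card (?N b)" by (rule psubset_card_mono[OF less.prems(2) sub])
    moreover have "continuous_on {a<..<z} g" "mono_on {a<..<z} \<phi>" "finite (?N z)"
      using z less.prems(2) sub
      by (auto intro: continuous_on_subset[OF less.prems(1)] mono_on_subset[OF less.prems(3)]
          finite_subset[OF psubset_imp_subset])
    ultimately obtain Z \<sigma> where Z: "Z \<subseteq> ?N z" and \<sigma>: "\<sigma> = 1 \<or> \<sigma> = (- 1 :: real)"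
      and pos: "\<And>t. t \<in> {a<..<z} \<Longrightarrow> 0 \<le> \<sigma> * g t * (\<Prod>z\<in>Z. \<phi> t - \<phi> z)"
      using less.hyps[of z] by blast
    have "continuous_on {z<..<b} g" using z by (intro continuous_on_subset[OF less.prems(1)]) auto
    moreover have "g t \<noteq> 0" if "t \<in> {z<..<b}" for t using zmax[of t] z that by force
    ultimately obtain \<tau> :: real where \<tau>: "\<tau> = 1 \<or> \<tau> = - 1" "\<And>t. t \<in> {z<..<b} \<Longrightarrow> 0 < \<tau> * g t"
      using nonzero_constant_sign[of z b g] by blast
    have fin: "finite Z" "z \<notin> Z"
      using finite_subset[OF Z finite_subset[OF psubset_imp_subset[OF sub] less.prems(2)]] Z by auto
    have mono: "\<phi> s \<le> \<phi> t" if "s \<in> {a<..<b}" "t \<in> {a<..<b}" "s \<le> t" for s t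
      using less.prems(3) that by (auto simp: monotone_on_def)
    have right: "0 \<le> (\<Prod>z\<in>Z. \<phi> t - \<phi> z)" if "t \<in> {z<..<b}" for t
      using Z z that by (intro prod_nonneg ballI) (auto intro!: mono)
    show ?thesis
    \<comment> \<open>Equal signs mean that the product for the left part also works on the right;
      otherwise the factor of z itself is added, which is nonpositive to the left of z and
      nonnegative to the right.\<close>
    proof (cases "\<sigma> = \<tau>")
      case True
      have "0 \<le> \<sigma> * g t * (\<Prod>z\<in>Z. \<phi> t - \<phi> z)" if t: "t \<in> {a<..<b}" for t
      proof -
        consider "t \<in> {a<..<z}" | "t = z" | "t \<in> {z<..<b}" using t by force
        then show ?thesis
        proof cases
          case 3
          show ?thesis
            using mult_nonneg_nonneg[OF less_imp_le[OF \<tau>(2)[OF 3]] right[OF 3]] True by simp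
        qed (use pos z in auto)
      qed
      then show ?thesis using Z sub \<sigma> by (intro exI[of _ Z] exI[of _ \<sigma>]) auto
    next
      case False
      then have \<tau>\<sigma>: "\<tau> = - \<sigma>" using \<tau> \<sigma> by auto
      have "0 \<le> \<tau> * g t * (\<Prod>z\<in>insert z Z. \<phi> t - \<phi> z)" if t: "t \<in> {a<..<b}" for t
      proof -
        have eq: "\<tau> * g t * (\<Prod>z\<in>insert z Z. \<phi> t - \<phi> z)
            = (\<sigma> * g t * (\<Prod>z\<in>Z. \<phi> t - \<phi> z)) * (\<phi> z - \<phi> t)"
          "\<tau> * g t * (\<Prod>z\<in>insert z Z. \<phi> t - \<phi> z)
            = (\<tau> * g t) * ((\<phi> t - \<phi> z) * (\<Prod>z\<in>Z. \<phi> t - \<phi> z))"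
          using fin by (simp_all add: \<tau>\<sigma> algebra_simps)
        consider "t \<in> {a<..<z}" | "t = z" | "t \<in> {z<..<b}" using t by force
        then show ?thesis
        proof cases
          case 1
          show ?thesis unfolding eq(1)
            using mono[of t z] t z 1 by (intro mult_nonneg_nonneg[OF pos[OF 1]]) auto
        next
          case 3
          show ?thesis unfolding eq(2)
            using right[OF 3] mono[of z t] t z 3
            by (intro mult_nonneg_nonneg[OF less_imp_le[OF \<tau>(2)[OF 3]]] mult_nonneg_nonneg) auto
        qed (use z in auto)
      qed
      then show ?thesis using Z sub z \<tau>(1) by (intro exI[of _ "insert z Z"] exI[of _ \<tau>]) auto
    qed
  qed
qed

text \<open>A polynomial p of degree at most R makes g times p(G) of constant sign. If all moments
  up to R vanished, the integral of this product would be 0, so the product would vanish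
  identically, which forces G to be constant on (0,T).\<close>

lemma moments_nonzero:
  fixes g G :: "real \<Rightarrow> real"
  assumes T: "0 < T" and g: "continuous_on {0..T} g" and G: "continuous_on {0..T} G"
    and anti: "\<And>s t. 0 \<le> s \<Longrightarrow> s \<le> t \<Longrightarrow> t \<le> T \<Longrightarrow> G t \<le> G s"
    and nonconst: "s \<in> {0<..<T}" "t \<in> {0<..<T}" "G s \<noteq> G t"
    and fin: "finite {t \<in> {0<..<T}. g t = 0}" and card: "card {t \<in> {0<..<T}. g t = 0} \<le> R"
  shows "\<exists>k\<le>R. integral {0..T} (\<lambda>t. g t * G t ^ k) \<noteq> 0"
proof (rule ccontr)
  assume "\<not> ?thesis"
  then have mom: "integral {0..T} (\<lambda>t. g t * G t ^ k) = 0" if "k \<le> R" for k using that by blast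
  let ?N = "{t \<in> {0<..<T}. g t = 0}"
  have "continuous_on {0<..<T} g" by (rule continuous_on_subset[OF g]) auto
  moreover have "mono_on {0<..<T} (\<lambda>t. - G t)" using anti by (auto simp: monotone_on_def)
  ultimately have "\<exists>Z \<sigma>. Z \<subseteq> ?N \<and> (\<forall>t\<in>{0<..<T}. 0 \<le> \<sigma> * g t * (\<Prod>z\<in>Z. - G t - (- G z)))
      \<and> (\<sigma> = 1 \<or> \<sigma> = (- 1 :: real))"
    using fin by (intro sign_change_product)
  then obtain Z \<sigma> where Z: "Z \<subseteq> ?N" and pos: "\<forall>t\<in>{0<..<T}. 0 \<le> \<sigma> * g t * (\<Prod>z\<in>Z. - G t - (- G z))"
    and \<sigma>: "\<sigma> = 1 \<or> \<sigma> = (- 1 :: real)"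
    by (elim exE conjE)
  define p where "p = (\<Prod>z\<in>Z. [:G z, - 1:])"
  have pG: "poly p (G t) = (\<Prod>z\<in>Z. - G t - (- G z))" for t
    by (simp add: p_def poly_prod)
  have finZ: "finite Z" by (rule finite_subset[OF Z fin])
  have "degree p \<le> (\<Sum>z\<in>Z. degree [:G z, - 1:])" unfolding p_def
    by (rule degree_prod_sum_le[OF finZ, unfolded o_def])
  also have "\<dots> \<le> card Z" by simp
  also have "\<dots> \<le> R" using card_mono[OF fin Z] card by linarith
  finally have deg: "degree p \<le> R" .
  define f where "f t = \<sigma> * g t * poly p (G t)" for t
  have cf: "continuous_on {0..T} f"
    unfolding f_def by (intro continuous_intros g G)
  have "integral {0..T} f = integral {0..T} (\<lambda>t. \<Sum>k\<le>degree p. (\<sigma> * coeff p k) * (g t * G t ^ k))"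
    unfolding f_def poly_altdef by (simp add: sum_distrib_left mult_ac)
  also have "\<dots> = (\<Sum>k\<le>degree p. integral {0..T} (\<lambda>t. (\<sigma> * coeff p k) * (g t * G t ^ k)))"
    by (rule integral_sum) (auto intro!: integrable_continuous_real continuous_intros g G)
  also have "\<dots> = (\<Sum>k\<le>degree p. (\<sigma> * coeff p k) * integral {0..T} (\<lambda>t. g t * G t ^ k))"
    by (intro sum.cong refl integral_mult_right)
  also have "\<dots> = 0" using mom deg by (intro sum.neutral) auto
  finally have int0: "integral {0..T} f = 0" .
  have "0 \<le> f t" if "t \<in> {0..T}" for t
  proof (rule continuous_ge_on_closure[where S = "{0<..<T}" and f = f and x = t])
    show "continuous_on (closure {0<..<T}) f" "t \<in> closure {0<..<T}"
      using T cf that by auto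
    show "0 \<le> f x" if "x \<in> {0<..<T}" for x
      using bspec[OF pos that] by (simp add: f_def pG)
  qed
  then have f0: "f t = 0" if "t \<in> {0..T}" for t
    using integral_eq_0_iff[OF cf T] int0 that by blast
  \<comment> \<open>G is only weakly monotone, so p(G) may vanish on intervals. But where g is
    nonzero, G takes its value at some zero of g; hence G has finitely many values, and
    connectedness leaves just one.\<close>
  have "G ` {0<..<T} \<subseteq> G ` ?N"
  proof
    fix y assume "y \<in> G ` {0<..<T}"
    then obtain t where t: "t \<in> {0<..<T}" "y = G t" by blast
    show "y \<in> G ` ?N"
    proof (cases "g t = 0")
      case False
      then have "poly p (G t) = 0" using f0[of t] t \<sigma> by (auto simp: f_def)
      then obtain z where "z \<in> Z" "G t = G z" unfolding pG using finZ by auto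
      then show ?thesis using Z t by auto
    qed (use t in auto)
  qed
  then have "finite (G ` {0<..<T})" using fin finite_subset by blast
  moreover have "connected (G ` {0<..<T})"
    by (intro connected_continuous_image continuous_on_subset[OF G]) auto
  ultimately obtain c where "G ` {0<..<T} = {} \<or> G ` {0<..<T} = {c}"
    using connected_finite_iff_sing by blast
  then show False using nonconst by (metis imageI empty_iff singletonD)
qed

text \<open>Gaussian elimination of the last unknown: if its column is zero, the last unit vector is
  a solution; otherwise a pivot row removes it from the remaining equations.\<close>

lemma underdetermined_homogeneous:
  fixes a :: "nat \<Rightarrow> nat \<Rightarrow> real"
  shows "\<exists>x. (\<exists>j\<le>n. x j \<noteq> 0) \<and> (\<forall>i<n. (\<Sum>j\<le>n. a i j * x j) = 0)"
proof (induction n arbitrary: a)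
  case 0
  show ?case by (intro exI[of _ "\<lambda>_. 1"]) simp
next
  case (Suc n)
  show ?case
  proof (cases "\<forall>i<Suc n. a i (Suc n) = 0")
    case True
    have "(\<Sum>j\<le>Suc n. a i j * (if j = Suc n then 1 else 0)) = 0" if "i < Suc n" for i
      using True that by (intro sum.neutral) auto
    moreover have "\<exists>j\<le>Suc n. (if j = Suc n then 1 else 0 :: real) \<noteq> 0" by (intro exI[of _ "Suc n"]) simp
    ultimately show ?thesis by (intro exI[of _ "\<lambda>j. if j = Suc n then 1 else 0"] conjI) blast+
  next
    case False
    then obtain i0 where i0: "i0 < Suc n" "a i0 (Suc n) \<noteq> 0" by blast
    define p where "p = a i0 (Suc n)"
    \<comment> \<open>Numbers the n equations other than the pivot by 0, ..., n - 1: the last row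
      takes the place of row \<open>i0\<close>.\<close>
    define row where "row i = (if i = i0 then n else i)" for i
    define a' where "a' i j = a (row i) j - a (row i) (Suc n) / p * a i0 j" for i j
    obtain x where "(\<exists>j\<le>n. x j \<noteq> 0) \<and> (\<forall>i<n. (\<Sum>j\<le>n. a' i j * x j) = 0)"
      using Suc.IH[of a'] by (rule exE)
    note x = conjunct1[OF this] conjunct2[OF this]
    define y where "y = x(Suc n := - (\<Sum>j\<le>n. a i0 j * x j) / p)"
    have y: "(\<Sum>j\<le>Suc n. a i j * y j) = (\<Sum>j\<le>n. a i j * x j) - a i (Suc n) / p * (\<Sum>j\<le>n. a i0 j * x j)" for i
      by (simp add: y_def)
    have piv: "(\<Sum>j\<le>Suc n. a i0 j * y j) = 0"
      unfolding y using i0 by (simp add: p_def)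
    have "(\<Sum>j\<le>Suc n. a i j * y j) = 0" if i: "i < Suc n" for i
    proof (cases "i = i0")
      case False
      define k where "k = (if i = n then i0 else i)"
      have k: "k < n" "row k = i" using i i0 False by (auto simp: k_def row_def)
      have "(\<Sum>j\<le>n. a' k j * x j) = (\<Sum>j\<le>Suc n. a i j * y j)"
        unfolding y a'_def k(2) by (simp add: left_diff_distrib sum_subtractf sum_distrib_left mult.assoc)
      then show ?thesis using x(2) k(1) by simp
    qed (use piv in simp)
    moreover have "\<exists>j\<le>Suc n. y j \<noteq> 0"
    proof -
      obtain j where "j \<le> n" "x j \<noteq> 0" using x(1) by blast
      then show ?thesis by (intro exI[of _ j]) (simp add: y_def)
    qed
    ultimately show ?thesis by (intro exI[of _ y] conjI allI impI)
  qed
qed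

text \<open>Append \<open>- w\<close> as a further column and take a nonzero kernel vector.
  Injectivity forbids its last coordinate to be 0, and dividing by that coordinate gives the
  solution.\<close>

lemma injective_square_system_solvable:
  fixes a :: "nat \<Rightarrow> nat \<Rightarrow> real"
  assumes inj: "\<And>c. (\<And>i. i \<le> n \<Longrightarrow> (\<Sum>j\<le>n. a i j * c j) = 0) \<Longrightarrow> \<forall>j\<le>n. c j = 0"
  shows "\<exists>c. \<forall>i\<le>n. (\<Sum>j\<le>n. a i j * c j) = w i"
proof -
  define a' where "a' i j = (if j = Suc n then - w i else a i j)" for i j
  obtain x where "(\<exists>j\<le>Suc n. x j \<noteq> 0) \<and> (\<forall>i<Suc n. (\<Sum>j\<le>Suc n. a' i j * x j) = 0)"
    using underdetermined_homogeneous[of "Suc n" a'] by (rule exE)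
  note x = conjunct1[OF this] conjunct2[OF this]
  have eq: "(\<Sum>j\<le>n. a i j * x j) = w i * x (Suc n)" if "i \<le> n" for i
  proof -
    have "(\<Sum>j\<le>Suc n. a' i j * x j) = (\<Sum>j\<le>n. a i j * x j) - w i * x (Suc n)"
      by (simp add: a'_def)
    then show ?thesis using x(2) that by simp
  qed
  have "x (Suc n) \<noteq> 0"
  proof
    assume 0: "x (Suc n) = 0"
    have "\<forall>j\<le>n. x j = 0"
    proof (rule inj)
      fix i assume "i \<le> n"
      from eq[OF this] show "(\<Sum>j\<le>n. a i j * x j) = 0" by (simp only: 0 mult_zero_right)
    qed
    moreover obtain j where "j \<le> Suc n" "x j \<noteq> 0" using x(1) by (elim exE conjE)
    ultimately show False using 0 by (cases "j = Suc n") simp_all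
  qed
  then have "(\<Sum>j\<le>n. a i j * (x j / x (Suc n))) = w i" if "i \<le> n" for i
    using eq[OF that] by (simp add: sum_divide_distrib[symmetric])
  then show ?thesis by (intro exI[of _ "\<lambda>j. x j / x (Suc n)"] allI impI)
qed

section \<open>Simple zeros from prescribed leading terms\<close>

text \<open>Makes the simplicity of a root quantitative, so that it survives perturbations smaller
  than c. Half-width below 1 / 2 keeps the intervals around distinct integers disjoint.\<close>

lemma simple_root_bounds:
  fixes p :: "real poly"
  assumes root: "poly p z = 0" and simple: "poly (pderiv p) z \<noteq> 0"
  shows "\<exists>\<eta> c. 0 < \<eta> \<and> \<eta> < 1 / 2 \<and> 0 < c \<and> poly p (z - \<eta>) * poly p (z + \<eta>) < 0 \<and>
    c \<le> \<bar>poly p (z - \<eta>)\<bar> \<and> c \<le> \<bar>poly p (z + \<eta>)\<bar> \<and>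
    (\<forall>x\<in>{z - \<eta>..z + \<eta>}. c \<le> \<bar>poly (pderiv p) x\<bar>)"
proof -
  \<comment> \<open>Multiplying the derivative by its value at z makes it positive near z, which
    treats both signs at once.\<close>
  define q where "q = smult (poly (pderiv p) z) (pderiv p)"
  define e where "e = (poly (pderiv p) z)\<^sup>2 / 2"
  have e: "0 < e" using simple by (simp add: e_def)
  have qz: "poly q z = 2 * e" by (simp add: q_def e_def power2_eq_square)
  have "isCont (poly q) z" by simp
  then obtain d where d: "0 < d" "\<And>x. dist x z < d \<Longrightarrow> dist (poly q x) (poly q z) < e"
    using e unfolding continuous_at_eps_delta by metis
  define \<eta> where "\<eta> = min (d / 2) (1 / 4)"
  have \<eta>: "0 < \<eta>" "\<eta> < d" "\<eta> < 1 / 2" using d(1) by (auto simp: \<eta>_def min_def)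
  have q: "e \<le> poly q x" if "x \<in> {z - \<eta>..z + \<eta>}" for x
  proof -
    have "dist x z < d" using that \<eta> by (auto simp: dist_real_def)
    from d(2)[OF this] show ?thesis unfolding qz dist_real_def by linarith
  qed
  let ?m = "\<bar>poly (pderiv p) z\<bar>"
  have m: "0 < ?m" using simple by simp
  have pd: "e / ?m \<le> \<bar>poly (pderiv p) x\<bar>" if "x \<in> {z - \<eta>..z + \<eta>}" for x
  proof -
    have "e \<le> ?m * \<bar>poly (pderiv p) x\<bar>"
      using q[OF that] abs_ge_self[of "poly q x"] by (simp add: q_def abs_mult)
    then show ?thesis using m by (simp add: field_simps)
  qed
  obtain x where x: "z < x" "x < z + \<eta>" "poly p (z + \<eta>) - poly p z = (z + \<eta> - z) * poly (pderiv p) x"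
    using poly_MVT[of z "z + \<eta>" p] \<eta> by auto
  obtain y where y: "z - \<eta> < y" "y < z" "poly p z - poly p (z - \<eta>) = (z - (z - \<eta>)) * poly (pderiv p) y"
    using poly_MVT[of "z - \<eta>" z p] \<eta> by auto
  have px: "poly p (z + \<eta>) = \<eta> * poly (pderiv p) x" and py: "poly p (z - \<eta>) = - \<eta> * poly (pderiv p) y"
    using x(3) y(3) root by auto
  have mem: "x \<in> {z - \<eta>..z + \<eta>}" "y \<in> {z - \<eta>..z + \<eta>}" using x y \<eta> by auto
  have "0 < poly q x * poly q y" using q[OF mem(1)] q[OF mem(2)] e by (intro mult_pos_pos) auto
  also have "poly q x * poly q y = (poly (pderiv p) z)\<^sup>2 * (poly (pderiv p) x * poly (pderiv p) y)"
    by (simp add: q_def power2_eq_square mult_ac)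
  finally have "0 < poly (pderiv p) x * poly (pderiv p) y"
    by (simp add: zero_less_mult_iff)
  then have "0 < \<eta>\<^sup>2 * (poly (pderiv p) x * poly (pderiv p) y)" using \<eta> by simp
  moreover have "poly p (z - \<eta>) * poly p (z + \<eta>) = - (\<eta>\<^sup>2 * (poly (pderiv p) x * poly (pderiv p) y))"
    unfolding px py by (simp add: power2_eq_square mult_ac)
  ultimately have "poly p (z - \<eta>) * poly p (z + \<eta>) < 0" by linarith
  moreover have "\<eta> * (e / ?m) \<le> \<bar>poly p (z - \<eta>)\<bar>" "\<eta> * (e / ?m) \<le> \<bar>poly p (z + \<eta>)\<bar>"
    using mult_left_mono[OF pd[OF mem(1)], of \<eta>] mult_left_mono[OF pd[OF mem(2)], of \<eta>] \<eta>
    by (simp_all add: px py abs_mult)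
  moreover have "\<eta> * (e / ?m) \<le> \<bar>poly (pderiv p) x\<bar>" if "x \<in> {z - \<eta>..z + \<eta>}" for x
  proof -
    have "\<eta> * (e / ?m) \<le> 1 * (e / ?m)" using \<eta> e m by (intro mult_right_mono) auto
    then show ?thesis using pd[OF that] by simp
  qed
  moreover have "0 < \<eta> * (e / ?m)" using \<eta> e m by simp
  ultimately show ?thesis using \<eta> by (intro exI[of _ \<eta>] exI[of _ "\<eta> * (e / ?m)"] conjI ballI)
qed

lemma sign_change_root:
  fixes F :: "real \<Rightarrow> real"
  assumes "continuous_on {a..b} F" "a \<le> b" "F a * F b < 0"
  obtains z where "a < z" "z < b" "F z = 0"
proof -
  have ne: "F a \<noteq> 0" "F b \<noteq> 0" using assms(3) by auto
  have "\<exists>z. a \<le> z \<and> z \<le> b \<and> F z = 0"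
  proof (cases "F a < 0")
    case True
    then have "0 < F b" using assms(3) by (simp add: mult_less_0_iff)
    then show ?thesis using IVT'[of F a 0 b] True assms by auto
  next
    case False
    then have "0 < F a" using ne by simp
    then have "F b < 0" using assms(3) by (simp add: mult_less_0_iff)
    then show ?thesis using IVT2'[of F b 0 a] \<open>0 < F a\<close> assms by auto
  qed
  then obtain z where z: "a \<le> z" "z \<le> b" "F z = 0" by blast
  have "z \<noteq> a" "z \<noteq> b" using z(3) ne by auto
  then show thesis using z by (intro that[of z]) auto
qed

lemma same_sign_of_close:
  fixes x y c :: real
  assumes "c \<le> \<bar>y\<bar>" "\<bar>x - y\<bar> < c"
  shows "0 < x * y"
proof (cases "0 \<le> y")
  case True
  then show ?thesis using assms by (intro mult_pos_pos) linarith+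
next
  case False
  then show ?thesis using assms by (intro mult_neg_neg) linarith+
qed

text \<open>A rescaling: with s = \<delta> \<sigma> and suitable weights the combination becomes
  \<delta>^R times p(\<sigma>) plus an error of order \<delta>^(R+1), where p has the simple roots
  1, ..., R. Small \<delta> then gives a simple zero near each \<delta> j.\<close>

lemma simple_zeros_from_leading_terms:
  fixes E E' :: "nat \<Rightarrow> real \<Rightarrow> real"
  assumes R: "1 \<le> R" and C: "0 \<le> C"
    and est: "\<And>k s. k \<le> R \<Longrightarrow> 0 < s \<Longrightarrow> \<bar>E k s - s ^ k\<bar> \<le> C * s ^ Suc R"
    and est': "\<And>k s. k \<le> R \<Longrightarrow> 0 < s \<Longrightarrow> \<bar>E' k s - real k * s ^ (k - 1)\<bar> \<le> C * s ^ R"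
    and deriv: "\<And>k s. k \<le> R \<Longrightarrow> 0 < s \<Longrightarrow> (E k has_real_derivative E' k s) (at s)"
  obtains d S where "finite S" "card S = R" "d 0 \<noteq> 0"
    "\<And>s. s \<in> S \<Longrightarrow> 0 < s \<and> (\<Sum>k\<le>R. d k * E k s) = 0 \<and> (\<Sum>k\<le>R. d k * E' k s) \<noteq> 0"
proof -
  define p :: "real poly" where "p = (\<Prod>j=1..R. [:- real j, 1:])"
  define w where "w k = coeff p k" for k
  have "degree p \<le> (\<Sum>j=1..R. degree [:- real j, 1:])"
    unfolding p_def by (rule degree_prod_sum_le[unfolded o_def]) simp
  then have deg: "degree p \<le> R" by simp
  have p: "poly p x = (\<Sum>k\<le>R. w k * x ^ k)" for x
    unfolding poly_altdef w_def using deg by (intro sum.mono_neutral_left) (auto simp: coeff_eq_0)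
  have p': "poly (pderiv p) x = (\<Sum>k\<le>R. w k * (real k * x ^ (k - 1)))" for x
  proof (rule DERIV_unique[OF poly_DERIV])
    show "((\<lambda>x. poly p x) has_real_derivative (\<Sum>k\<le>R. w k * (real k * x ^ (k - 1)))) (at x)"
      unfolding p by (auto intro!: derivative_eq_intros sum.cong)
  qed
  have root: "poly p (real j) = 0" and simple: "poly (pderiv p) (real j) \<noteq> 0" if j: "j \<in> {1..R}" for j
  proof -
    define q where "q = (\<Prod>i\<in>{1..R} - {j}. [:- real i, 1:])"
    have pq: "p = [:- real j, 1:] * q"
      unfolding p_def q_def by (rule prod.remove) (use j in auto)
    show "poly p (real j) = 0" unfolding pq poly_mult by simp
    have "poly (pderiv p) (real j) = poly q (real j)"
      unfolding pq pderiv_mult by (simp add: pderiv_pCons)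
    also have "\<dots> \<noteq> 0" unfolding q_def poly_prod by (subst prod_zero_iff) auto
    finally show "poly (pderiv p) (real j) \<noteq> 0" .
  qed
  have "\<forall>j\<in>{1..R}. \<exists>\<eta> c. 0 < \<eta> \<and> \<eta> < 1 / 2 \<and> 0 < c \<and> poly p (real j - \<eta>) * poly p (real j + \<eta>) < 0 \<and>
    c \<le> \<bar>poly p (real j - \<eta>)\<bar> \<and> c \<le> \<bar>poly p (real j + \<eta>)\<bar> \<and>
    (\<forall>x\<in>{real j - \<eta>..real j + \<eta>}. c \<le> \<bar>poly (pderiv p) x\<bar>)"
    by (intro ballI simple_root_bounds root simple)
  then obtain \<eta> where "\<forall>j\<in>{1..R}. \<exists>c. 0 < \<eta> j \<and> \<eta> j < 1 / 2 \<and> 0 < c \<and> poly p (real j - \<eta> j) * poly p (real j + \<eta> j) < 0 \<and>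
    c \<le> \<bar>poly p (real j - \<eta> j)\<bar> \<and> c \<le> \<bar>poly p (real j + \<eta> j)\<bar> \<and>
    (\<forall>x\<in>{real j - \<eta> j..real j + \<eta> j}. c \<le> \<bar>poly (pderiv p) x\<bar>)"
    by (rule bchoice[THEN exE])
  then obtain c where "\<forall>j\<in>{1..R}. 0 < \<eta> j \<and> \<eta> j < 1 / 2 \<and> 0 < c j \<and> poly p (real j - \<eta> j) * poly p (real j + \<eta> j) < 0 \<and>
    c j \<le> \<bar>poly p (real j - \<eta> j)\<bar> \<and> c j \<le> \<bar>poly p (real j + \<eta> j)\<bar> \<and>
    (\<forall>x\<in>{real j - \<eta> j..real j + \<eta> j}. c j \<le> \<bar>poly (pderiv p) x\<bar>)"
    by (rule bchoice[THEN exE])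
  then have \<eta>: "0 < \<eta> j" "\<eta> j < 1 / 2" "0 < c j" "poly p (real j - \<eta> j) * poly p (real j + \<eta> j) < 0"
    "c j \<le> \<bar>poly p (real j - \<eta> j)\<bar>" "c j \<le> \<bar>poly p (real j + \<eta> j)\<bar>"
    "\<forall>x\<in>{real j - \<eta> j..real j + \<eta> j}. c j \<le> \<bar>poly (pderiv p) x\<bar>" if "j \<in> {1..R}" for j
    using that by blast+
  define c0 where "c0 = Min (c ` {1..R})"
  have c0: "0 < c0"
    unfolding c0_def using R by (subst Min_gr_iff) (auto intro!: \<eta>(3))
  have c0_le: "c0 \<le> c j" if "j \<in> {1..R}" for j
    unfolding c0_def by (intro Min_le imageI that) simp
  define N where "N = (\<Sum>k\<le>R. \<bar>w k\<bar>)"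
  have N: "0 \<le> N" by (simp add: N_def sum_nonneg)
  \<comment> \<open>After division by \<delta>^R the error is at most \<open>\<delta> * D\<close>
    for 0 < \<sigma> \<le> R + 1, a range that covers all the intervals around the roots;
    \<open>\<delta>\<close> is chosen to push it below \<open>c0\<close>.\<close>
  define D where "D = C * real (Suc R) ^ Suc R * N"
  have D: "0 \<le> D" using C N by (simp add: D_def)
  define \<delta> where "\<delta> = min 1 (c0 / (2 * (D + 1)))"
  have \<delta>: "0 < \<delta>" "\<delta> \<le> 1" "\<delta> * D < c0"
  proof -
    show "0 < \<delta>" "\<delta> \<le> 1" using c0 D by (auto simp: \<delta>_def)
    have "\<delta> * D \<le> c0 / (2 * (D + 1)) * D" using D by (intro mult_right_mono) (auto simp: \<delta>_def)
    also have "\<dots> < c0" using c0 D by (simp add: field_simps add_nonneg_pos)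
    finally show "\<delta> * D < c0" .
  qed
  \<comment> \<open>The coefficients of \<delta>^R p(s / \<delta>), whose roots are the \<delta>
    j.\<close>
  define d where "d k = w k * \<delta> ^ (R - k)" for k
  define F F' where "F s = (\<Sum>k\<le>R. d k * E k s)" and "F' s = (\<Sum>k\<le>R. d k * E' k s)" for s
  have \<delta>pow: "\<delta> ^ (R - k) * \<delta> ^ k = \<delta> ^ R" if "k \<le> R" for k
    using that by (simp add: power_add[symmetric])
  have sumbound: "\<bar>\<Sum>k\<le>R. w k * (\<delta> ^ (R - k) * y k)\<bar> \<le> N * (C * (real (Suc R) ^ Suc R * \<delta> ^ Suc R))"
    if y: "\<And>k. k \<le> R \<Longrightarrow> \<bar>y k\<bar> \<le> C * (real (Suc R) ^ Suc R * \<delta> ^ Suc R)" for y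
  proof -
    have "\<bar>w k * (\<delta> ^ (R - k) * y k)\<bar> \<le> \<bar>w k\<bar> * (1 * (C * (real (Suc R) ^ Suc R * \<delta> ^ Suc R)))" if "k \<le> R" for k
      unfolding abs_mult using y[OF that] \<delta>
      by (intro mult_left_mono mult_mono) (auto simp: power_le_one)
    then have "(\<Sum>k\<le>R. \<bar>w k * (\<delta> ^ (R - k) * y k)\<bar>)
        \<le> (\<Sum>k\<le>R. \<bar>w k\<bar> * (1 * (C * (real (Suc R) ^ Suc R * \<delta> ^ Suc R))))"
      by (intro sum_mono) auto
    also have "\<dots> = N * (C * (real (Suc R) ^ Suc R * \<delta> ^ Suc R))"
      by (simp add: N_def sum_distrib_right)
    finally show ?thesis by (rule order_trans[OF sum_abs])
  qed
  have rhs: "N * (C * (real (Suc R) ^ Suc R * \<delta> ^ Suc R)) < \<delta> ^ R * c0"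
  proof -
    have "N * (C * (real (Suc R) ^ Suc R * \<delta> ^ Suc R)) = \<delta> ^ R * (\<delta> * D)"
      by (simp add: D_def)
    also have "\<dots> < \<delta> ^ R * c0" using \<delta> by (intro mult_strict_left_mono) auto
    finally show ?thesis .
  qed
  have near: "\<bar>F (\<delta> * \<sigma>) - \<delta> ^ R * poly p \<sigma>\<bar> < \<delta> ^ R * c0" if \<sigma>: "0 < \<sigma>" "\<sigma> \<le> real (Suc R)" for \<sigma>
  proof -
    have "F (\<delta> * \<sigma>) - \<delta> ^ R * poly p \<sigma> = (\<Sum>k\<le>R. w k * (\<delta> ^ (R - k) * (E k (\<delta> * \<sigma>) - (\<delta> * \<sigma>) ^ k)))"
      unfolding F_def p sum_distrib_left sum_subtractf[symmetric] d_def
      by (intro sum.cong refl) (simp add: right_diff_distrib power_mult_distrib \<delta>pow[symmetric])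
    also have "\<bar>\<dots>\<bar> \<le> N * (C * (real (Suc R) ^ Suc R * \<delta> ^ Suc R))"
    proof (rule sumbound)
      fix k assume k: "k \<le> R"
      have "\<bar>E k (\<delta> * \<sigma>) - (\<delta> * \<sigma>) ^ k\<bar> \<le> C * (\<delta> * \<sigma>) ^ Suc R"
        using \<delta> \<sigma> by (intro est k) auto
      also have "\<dots> = C * (\<sigma> ^ Suc R * \<delta> ^ Suc R)" by (simp only: power_mult_distrib mult.commute)
      also have "\<dots> \<le> C * (real (Suc R) ^ Suc R * \<delta> ^ Suc R)"
        using \<sigma> \<delta> C by (intro mult_left_mono mult_right_mono power_mono) auto
      finally show "\<bar>E k (\<delta> * \<sigma>) - (\<delta> * \<sigma>) ^ k\<bar> \<le> C * (real (Suc R) ^ Suc R * \<delta> ^ Suc R)" .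
    qed
    finally show ?thesis using rhs by linarith
  qed
  have near': "\<bar>\<delta> * F' (\<delta> * \<sigma>) - \<delta> ^ R * poly (pderiv p) \<sigma>\<bar> < \<delta> ^ R * c0"
    if \<sigma>: "0 < \<sigma>" "\<sigma> \<le> real (Suc R)" for \<sigma>
  proof -
    have pw: "\<delta> ^ R * (real k * \<sigma> ^ (k - 1)) = \<delta> ^ (R - k) * (\<delta> * (real k * (\<delta> * \<sigma>) ^ (k - 1)))" if "k \<le> R" for k
    proof (cases k)
      case (Suc i)
      have "\<delta> ^ R = \<delta> ^ (R - k) * (\<delta> * \<delta> ^ i)" using \<delta>pow[OF that] by (simp add: Suc)
      then show ?thesis by (simp only: Suc diff_Suc_1 power_mult_distrib mult_ac)
    qed simp
    have "\<delta> * F' (\<delta> * \<sigma>) - \<delta> ^ R * poly (pderiv p) \<sigma>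
        = (\<Sum>k\<le>R. w k * (\<delta> ^ (R - k) * (\<delta> * (E' k (\<delta> * \<sigma>) - real k * (\<delta> * \<sigma>) ^ (k - 1)))))"
      unfolding F'_def p' sum_distrib_left sum_subtractf[symmetric] d_def
    proof (intro sum.cong refl)
      fix k assume "k \<in> {..R}"
      then have k: "k \<le> R" by simp
      have "\<delta> ^ R * (w k * (real k * \<sigma> ^ (k - 1))) = w k * (\<delta> ^ R * (real k * \<sigma> ^ (k - 1)))"
        by (simp only: mult_ac)
      then show "\<delta> * (w k * \<delta> ^ (R - k) * E' k (\<delta> * \<sigma>)) - \<delta> ^ R * (w k * (real k * \<sigma> ^ (k - 1))) =
          w k * (\<delta> ^ (R - k) * (\<delta> * (E' k (\<delta> * \<sigma>) - real k * (\<delta> * \<sigma>) ^ (k - 1))))"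
        unfolding pw[OF k] by (simp only: right_diff_distrib mult_ac)
    qed
    also have "\<bar>\<dots>\<bar> \<le> N * (C * (real (Suc R) ^ Suc R * \<delta> ^ Suc R))"
    proof (rule sumbound)
      fix k assume k: "k \<le> R"
      have "\<bar>\<delta> * (E' k (\<delta> * \<sigma>) - real k * (\<delta> * \<sigma>) ^ (k - 1))\<bar> \<le> \<delta> * (C * (\<delta> * \<sigma>) ^ R)"
        unfolding abs_mult using \<delta> \<sigma> est'[OF k, of "\<delta> * \<sigma>"] by (intro mult_mono) auto
      also have "\<dots> = C * (\<sigma> ^ R * \<delta> ^ Suc R)" by (simp add: power_mult_distrib)
      also have "\<dots> \<le> C * (real (Suc R) ^ Suc R * \<delta> ^ Suc R)"
      proof (intro mult_left_mono mult_right_mono C)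
        have "\<sigma> ^ R \<le> real (Suc R) ^ R" using \<sigma> by (intro power_mono) auto
        also have "\<dots> \<le> real (Suc R) ^ Suc R" by (intro power_increasing) auto
        finally show "\<sigma> ^ R \<le> real (Suc R) ^ Suc R" .
      qed (use \<delta> in auto)
      finally show "\<bar>\<delta> * (E' k (\<delta> * \<sigma>) - real k * (\<delta> * \<sigma>) ^ (k - 1))\<bar>
          \<le> C * (real (Suc R) ^ Suc R * \<delta> ^ Suc R)" .
    qed
    finally show ?thesis using rhs by linarith
  qed
  have same_sign: "0 < F (\<delta> * \<sigma>) * poly p \<sigma>" if "0 < \<sigma>" "\<sigma> \<le> real (Suc R)" "c0 \<le> \<bar>poly p \<sigma>\<bar>" for \<sigma>
  proof -
    have "\<delta> ^ R * c0 \<le> \<bar>\<delta> ^ R * poly p \<sigma>\<bar>"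
      using that(3) \<delta> by (simp add: abs_mult)
    then have "0 < F (\<delta> * \<sigma>) * (\<delta> ^ R * poly p \<sigma>)"
      by (rule same_sign_of_close[OF _ near[OF that(1,2)]])
    also have "\<dots> = \<delta> ^ R * (F (\<delta> * \<sigma>) * poly p \<sigma>)" by (simp only: mult_ac)
    finally show ?thesis by (rule zero_less_mult_pos) (use \<delta>(1) in simp)
  qed
  have derF: "(F has_real_derivative F' s) (at s)" if "0 < s" for s
    unfolding F_def F'_def using that
    by (intro DERIV_sum DERIV_cmult deriv) auto
  have ex: "\<exists>z. real j - \<eta> j < z \<and> z < real j + \<eta> j \<and> F (\<delta> * z) = 0 \<and> F' (\<delta> * z) \<noteq> 0" if j: "j \<in> {1..R}" for j
  proof -
    have rng: "0 < x" "x \<le> real (Suc R)" if "x \<in> {real j - \<eta> j..real j + \<eta> j}" for x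
      using that j \<eta>(2)[OF j] by auto
    have c0j: "c0 \<le> c j" by (rule c0_le[OF j])
    have ends: "real j - \<eta> j \<in> {real j - \<eta> j..real j + \<eta> j}" "real j + \<eta> j \<in> {real j - \<eta> j..real j + \<eta> j}"
      using \<eta>(1)[OF j] by auto
    have "0 < F (\<delta> * (real j - \<eta> j)) * poly p (real j - \<eta> j)" "0 < F (\<delta> * (real j + \<eta> j)) * poly p (real j + \<eta> j)"
      using \<eta>(5,6)[OF j] c0j by (intro same_sign rng ends; linarith)+
    then have sc: "F (\<delta> * (real j - \<eta> j)) * F (\<delta> * (real j + \<eta> j)) < 0"
      using \<eta>(4)[OF j] by (auto simp: zero_less_mult_iff mult_less_0_iff)
    have cF: "continuous_on {0<..} F"
      by (intro continuous_at_imp_continuous_on ballI DERIV_isCont[OF derF]) simp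
    have "continuous_on {real j - \<eta> j..real j + \<eta> j} (\<lambda>z. F (\<delta> * z))"
    proof (rule continuous_on_compose2[OF cF])
      show "(*) \<delta> ` {real j - \<eta> j..real j + \<eta> j} \<subseteq> {0<..}"
        using mult_pos_pos[OF \<delta>(1) rng(1)] by blast
    qed (intro continuous_intros)
    then obtain z where z: "real j - \<eta> j < z" "z < real j + \<eta> j" "F (\<delta> * z) = 0"
      by (rule sign_change_root) (use sc \<eta>(1)[OF j] in auto)
    then have zm: "z \<in> {real j - \<eta> j..real j + \<eta> j}" by simp
    have "F' (\<delta> * z) \<noteq> 0"
    proof
      assume "F' (\<delta> * z) = 0"
      then have "\<delta> ^ R * \<bar>poly (pderiv p) z\<bar> < \<delta> ^ R * c0"
        using near'[OF rng[OF zm]] \<delta> by (simp add: abs_mult)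
      then have "\<bar>poly (pderiv p) z\<bar> < c0" using \<delta> by simp
      then show False using bspec[OF \<eta>(7)[OF j] zm] c0j by linarith
    qed
    then show ?thesis using z by blast
  qed
  then have "\<forall>j\<in>{1..R}. \<exists>z. real j - \<eta> j < z \<and> z < real j + \<eta> j \<and> F (\<delta> * z) = 0 \<and> F' (\<delta> * z) \<noteq> 0" by blast
  then obtain z where z: "\<forall>j\<in>{1..R}. real j - \<eta> j < z j \<and> z j < real j + \<eta> j \<and> F (\<delta> * z j) = 0 \<and> F' (\<delta> * z j) \<noteq> 0"
    by (rule bchoice[THEN exE])
  have inj: "inj_on (\<lambda>j. \<delta> * z j) {1..R}"
  proof (rule inj_onI)
    fix i j assume ij: "i \<in> {1..R}" "j \<in> {1..R}" "\<delta> * z i = \<delta> * z j"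
    then have "z i = z j" using \<delta> by simp
    then have "\<bar>real i - real j\<bar> < 1"
      using bspec[OF z ij(1)] bspec[OF z ij(2)] \<eta>(2)[OF ij(1)] \<eta>(2)[OF ij(2)] by linarith
    then show "i = j" by linarith
  qed
  show thesis
  proof (rule that[of "(\<lambda>j. \<delta> * z j) ` {1..R}" d])
    show "card ((\<lambda>j. \<delta> * z j) ` {1..R}) = R" using card_image[OF inj] by simp
    \<comment> \<open>The roots start at 1. The value \<open>d 0\<close> will be the integral of the
      combination, and its being nonzero isolates the zero solution.\<close>
    have "poly p 0 \<noteq> 0" unfolding p_def poly_prod by (subst prod_zero_iff) auto
    then show "d 0 \<noteq> 0" using \<delta> by (simp add: d_def w_def poly_0_coeff_0)
    fix s assume "s \<in> (\<lambda>j. \<delta> * z j) ` {1..R}"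
    then obtain j where j: "j \<in> {1..R}" "s = \<delta> * z j" by blast
    have "0 < z j" using bspec[OF z j(1)] \<eta>(2)[OF j(1)] j(1) by auto
    then show "0 < s \<and> (\<Sum>k\<le>R. d k * E k s) = 0 \<and> (\<Sum>k\<le>R. d k * E' k s) \<noteq> 0"
      using bspec[OF z j(1)] \<delta> j(2) by (simp add: F_def F'_def)
  qed simp
qed

section \<open>Taylor jets of integrals against sqrt (1 + 2 s G)\<close>

locale sqrt_kernel =
  fixes T :: real and G :: "real \<Rightarrow> real"
  assumes T_pos: "0 < T" and cont_G: "continuous_on {0..T} G"
    and G_nonneg: "\<And>t. t \<in> {0..T} \<Longrightarrow> 0 \<le> G t"
    and G_anti: "\<And>s t. 0 \<le> s \<Longrightarrow> s \<le> t \<Longrightarrow> t \<le> T \<Longrightarrow> G t \<le> G s"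
begin

text \<open>The falling factorial of 1 / 2, the factor produced by differentiating a square root n
  times.\<close>

definition \<alpha> :: "nat \<Rightarrow> real" where
  "\<alpha> n = (\<Prod>i<n. 1 / 2 - real i)"

(* J f n is the n-th derivative of s \<mapsto> integral of f * sqrt (1 + 2 s G) over [0,T]. *)
definition J :: "(real \<Rightarrow> real) \<Rightarrow> nat \<Rightarrow> real \<Rightarrow> real" where
  "J f n s = integral {0..T} (\<lambda>t. f t * (\<alpha> n * (2 * G t) ^ n * (1 + 2 * s * G t) powr (1 / 2 - real n)))"

lemma \<alpha>_nonzero: "\<alpha> n \<noteq> 0"
proof -
  have "1 / 2 - real i \<noteq> 0" for i
  proof
    assume "1 / 2 - real i = 0"
    then have "real (2 * i) = real 1" by simp
    then have "2 * i = 1" by (simp only: of_nat_eq_iff)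
    then show False by presburger
  qed
  then show ?thesis unfolding \<alpha>_def by simp
qed

text \<open>A margin to the left of s = 0 on which 1 + 2 s G stays at least 1 / 2, so that
  \<open>J\<close> has two-sided derivatives at 0.\<close>

definition \<eta> :: real where
  "\<eta> = 1 / (4 * (G 0 + 1))"

lemma \<eta>_pos: "0 < \<eta>"
  using G_nonneg[of 0] T_pos by (simp add: \<eta>_def)

lemma kernel_pos:
  assumes "t \<in> {0..T}" "- \<eta> < s"
  shows "0 < 1 + 2 * s * G t"
proof -
  have G: "0 \<le> G t" "G t \<le> G 0" using assms G_nonneg G_anti[of 0 t] by auto
  have "\<eta> * G t \<le> \<eta> * (G 0 + 1)" using G \<eta>_pos by (intro mult_left_mono) auto
  also have "\<dots> = 1 / 4" using G by (simp add: \<eta>_def)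
  finally have "\<eta> * G t \<le> 1 / 4" .
  moreover have "- \<eta> * G t \<le> s * G t" using G assms(2) by (intro mult_right_mono) auto
  ultimately show ?thesis by simp
qed

lemma cont_kernel:
  "continuous_on ({- \<eta><..} \<times> {0..T}) (\<lambda>x. (1 + 2 * fst x * G (snd x)) powr r)"
proof (intro continuous_on_powr continuous_intros)
  show "continuous_on ({- \<eta><..} \<times> {0..T}) (\<lambda>x. G (snd x))"
    by (rule continuous_on_compose2[OF cont_G]) (auto intro!: continuous_intros)
  show "\<forall>x\<in>{- \<eta><..} \<times> {0..T}. 1 + 2 * fst x * G (snd x) \<noteq> 0"
    using kernel_pos by (metis greaterThan_iff less_irrefl mem_Times_iff)
qed

lemma cont_kernel_slice:
  assumes "- \<eta> < s"
  shows "continuous_on {0..T} (\<lambda>t. (1 + 2 * s * G t) powr r)"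
  using kernel_pos[OF _ assms] by (intro continuous_intros cont_G) force

lemma cont_integrand:
  assumes "continuous_on {0..T} f" "- \<eta> < s"
  shows "continuous_on {0..T} (\<lambda>t. f t * (c * (2 * G t) ^ n * (1 + 2 * s * G t) powr r))"
  by (intro continuous_on_mult continuous_on_power continuous_on_const assms cont_G cont_kernel_slice)

lemma J_deriv:
  assumes f: "continuous_on {0..T} f" and s: "- \<eta> < s"
  shows "(J f n has_real_derivative J f (Suc n) s) (at s)"
proof -
  let ?U = "{- \<eta><..}"
  let ?k = "\<lambda>n s t. f t * (\<alpha> n * (2 * G t) ^ n * (1 + 2 * s * G t) powr (1 / 2 - real n))"
  have cont: "continuous_on (?U \<times> {0..T}) (\<lambda>(s, t). ?k n s t)" for n
    unfolding split_beta
    by (intro continuous_intros cont_kernel continuous_on_compose2[OF f] continuous_on_compose2[OF cont_G]) auto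
  have "((\<lambda>s. integral (cbox 0 T) (?k n s)) has_field_derivative integral (cbox 0 T) (?k (Suc n) s)) (at s within ?U)"
  proof (rule leibniz_rule_field_derivative)
    fix s t assume s: "s \<in> ?U" and t: "t \<in> cbox 0 T"
    then have p: "0 < 1 + 2 * s * G t" by (intro kernel_pos) auto
    have "((\<lambda>s. (1 + 2 * s * G t) powr (1 / 2 - real n)) has_field_derivative
        (1 / 2 - real n) * (1 + 2 * s * G t) powr (1 / 2 - real n - 1) * (2 * G t)) (at s within ?U)"
      using p by (auto intro!: derivative_eq_intros)
    then have "((\<lambda>s. ?k n s t) has_field_derivative f t * (\<alpha> n * (2 * G t) ^ n *
        ((1 / 2 - real n) * (1 + 2 * s * G t) powr (1 / 2 - real n - 1) * (2 * G t)))) (at s within ?U)"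
      by (intro DERIV_cmult)
    also have "f t * (\<alpha> n * (2 * G t) ^ n * ((1 / 2 - real n) * (1 + 2 * s * G t) powr (1 / 2 - real n - 1) * (2 * G t)))
        = ?k (Suc n) s t"
      by (simp add: \<alpha>_def algebra_simps)
    finally show "((\<lambda>s. ?k n s t) has_field_derivative ?k (Suc n) s t) (at s within ?U)" .
  next
    fix s assume s: "s \<in> ?U"
    have "continuous_on {0..T} (?k n s)" by (rule cont_integrand[OF f]) (use s in simp)
    then show "?k n s integrable_on cbox 0 T" by (simp add: integrable_continuous_real)
  next
    show "continuous_on (?U \<times> cbox 0 T) (\<lambda>(s, t). ?k (Suc n) s t)"
      using cont[of "Suc n"] by simp
  qed (use s in auto)
  moreover have "at s within ?U = at s" by (rule at_within_open) (use s in auto)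
  ultimately show ?thesis
    unfolding J_def[abs_def] by (simp only: cbox_interval)
qed

lemma J_at_0: "J f n 0 = \<alpha> n * 2 ^ n * integral {0..T} (\<lambda>t. f t * G t ^ n)"
proof -
  have "J f n 0 = integral {0..T} (\<lambda>t. (\<alpha> n * 2 ^ n) * (f t * G t ^ n))"
    unfolding J_def by (simp add: power_mult_distrib mult_ac)
  also have "\<dots> = \<alpha> n * 2 ^ n * integral {0..T} (\<lambda>t. f t * G t ^ n)" by (rule integral_mult_right)
  finally show ?thesis .
qed

text \<open>From the first derivative on the exponent is negative, while the base is at least 1 for
  s \<ge> 0; so the kernel power is at most 1 and the bound holds on the whole half-line.\<close>

lemma J_bounded:
  assumes f: "continuous_on {0..T} f"
  obtains C where "0 \<le> C" "\<And>s. 0 \<le> s \<Longrightarrow> \<bar>J f (Suc n) s\<bar> \<le> C"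
proof -
  have "bounded (f ` {0..T})"
    by (intro compact_imp_bounded compact_continuous_image f) simp
  then obtain F where "\<forall>x\<in>f ` {0..T}. norm x \<le> F" unfolding bounded_iff by blast
  then have F: "\<bar>f t\<bar> \<le> F" if "t \<in> {0..T}" for t using that by auto
  have F0: "0 \<le> F" using F[of 0] T_pos by force
  define C where "C = F * (\<bar>\<alpha> (Suc n)\<bar> * (2 * G 0) ^ Suc n * 1) * (T - 0)"
  have G0: "0 \<le> G 0" using G_nonneg[of 0] T_pos by simp
  show thesis
  proof (rule that[of C])
    show "0 \<le> C" using F0 G0 T_pos by (simp add: C_def)
    fix s :: real assume s: "0 \<le> s"
    have s': "- \<eta> < s" using s \<eta>_pos by linarith
    have "norm (J f (Suc n) s) \<le> C" unfolding J_def C_def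
    proof (rule integral_bound)
      show "continuous_on {0..T} (\<lambda>t. f t * (\<alpha> (Suc n) * (2 * G t) ^ Suc n * (1 + 2 * s * G t) powr (1 / 2 - real (Suc n))))"
        by (rule cont_integrand[OF f s'])
      fix t assume t: "t \<in> {0..T}"
      have G: "0 \<le> G t" "G t \<le> G 0" using t G_nonneg G_anti[of 0 t] by auto
      have "1 \<le> 1 + 2 * s * G t" using s G by simp
      then have "(1 + 2 * s * G t) powr (1 / 2 - real (Suc n)) \<le> (1 + 2 * s * G t) powr 0"
        by (intro powr_mono) auto
      then have "(1 + 2 * s * G t) powr (1 / 2 - real (Suc n)) \<le> 1"
        using \<open>1 \<le> 1 + 2 * s * G t\<close> by simp
      then show "norm (f t * (\<alpha> (Suc n) * (2 * G t) ^ Suc n * (1 + 2 * s * G t) powr (1 / 2 - real (Suc n))))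
          \<le> F * (\<bar>\<alpha> (Suc n)\<bar> * (2 * G 0) ^ Suc n * 1)"
        unfolding real_norm_def using G F[OF t]
        by (intro abs_mult_le_mult) (auto intro: power_mono simp del: power_Suc)
    qed (use T_pos in auto)
    then show "\<bar>J f (Suc n) s\<bar> \<le> C" by simp
  qed
qed

text \<open>Taylor with Lagrange remainder for \<open>J f 0\<close> up to order R and for
  \<open>J f 1\<close> up to order R - 1; both remainders contain the derivative of order R + 1, so
  one bound serves both.\<close>

lemma J_expansion:
  assumes f: "continuous_on {0..T} f" and R: "1 \<le> R" and k: "k \<le> R"
    and jet: "\<And>i. i \<le> R \<Longrightarrow> J f i 0 = (if i = k then fact k else 0)"
  obtains C where "0 \<le> C" "\<And>s. 0 < s \<Longrightarrow> \<bar>J f 0 s - s ^ k\<bar> \<le> C * s ^ Suc R"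
    "\<And>s. 0 < s \<Longrightarrow> \<bar>J f 1 s - real k * s ^ (k - 1)\<bar> \<le> C * s ^ R"
proof -
  obtain C where C: "0 \<le> C" "\<And>s. 0 \<le> s \<Longrightarrow> \<bar>J f (Suc R) s\<bar> \<le> C"
    by (rule J_bounded[OF f]) (rule that)
  have der: "DERIV (J f m) t :> J f (Suc m) t" if "0 \<le> t" for m t
    by (rule J_deriv[OF f]) (use that \<eta>_pos in linarith)
  have rem: "\<bar>J f (Suc R) t / fact i * s ^ j\<bar> \<le> C * s ^ j" if "0 < t" "0 < s" for t s :: real and i j :: nat
  proof (rule abs_mult_le_mult)
    have "\<bar>J f (Suc R) t / fact i\<bar> \<le> \<bar>J f (Suc R) t\<bar> / 1"
      unfolding abs_divide by (intro frac_le) (auto simp: fact_ge_1)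
    then show "\<bar>J f (Suc R) t / fact i\<bar> \<le> C" using C(2)[of t] that by simp
    show "\<bar>s ^ j\<bar> \<le> s ^ j" using that by simp
  qed
  show thesis
  proof (rule that[OF C(1)])
    fix s :: real assume s: "0 < s"
    have "\<exists>t>0. t < s \<and> J f 0 s = (\<Sum>m<Suc R. J f m 0 / fact m * s ^ m) + J f (Suc R) t / fact (Suc R) * s ^ Suc R"
      using Maclaurin[OF s, of "Suc R" "J f"] der by auto
    then obtain t where t: "0 < t" "J f 0 s = (\<Sum>m<Suc R. J f m 0 / fact m * s ^ m) + J f (Suc R) t / fact (Suc R) * s ^ Suc R"
      by blast
    have "(\<Sum>m<Suc R. J f m 0 / fact m * s ^ m) = (\<Sum>m<Suc R. if m = k then s ^ k else 0)"
      by (intro sum.cong refl) (auto simp: jet)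
    also have "\<dots> = s ^ k" using k by simp
    finally have eq: "J f 0 s - s ^ k = J f (Suc R) t / fact (Suc R) * s ^ Suc R" using t(2) by simp
    show "\<bar>J f 0 s - s ^ k\<bar> \<le> C * s ^ Suc R" unfolding eq by (rule rem[OF t(1) s])
    have "\<exists>t>0. t < s \<and> J f 1 s = (\<Sum>m<R. J f (Suc m) 0 / fact m * s ^ m) + J f (Suc R) t / fact R * s ^ R"
      using Maclaurin[OF s, of R "\<lambda>m. J f (Suc m)" "J f 1"] der R by auto
    then obtain t where t: "0 < t" "J f 1 s = (\<Sum>m<R. J f (Suc m) 0 / fact m * s ^ m) + J f (Suc R) t / fact R * s ^ R"
      by blast
    have "(\<Sum>m<R. J f (Suc m) 0 / fact m * s ^ m) = (\<Sum>m<R. if Suc m = k then real k * s ^ (k - 1) else 0)"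
      by (intro sum.cong refl) (auto simp: jet)
    also have "\<dots> = real k * s ^ (k - 1)" using k by (cases k) auto
    finally have eq: "J f 1 s - real k * s ^ (k - 1) = J f (Suc R) t / fact R * s ^ R" using t(2) by simp
    show "\<bar>J f 1 s - real k * s ^ (k - 1)\<bar> \<le> C * s ^ R" unfolding eq by (rule rem[OF t(1) s])
  qed
qed

lemma J_sum:
  assumes "finite K" "\<And>l. l \<in> K \<Longrightarrow> continuous_on {0..T} (g l)" "- \<eta> < s"
  shows "J (\<lambda>t. \<Sum>l\<in>K. c l * g l t) n s = (\<Sum>l\<in>K. c l * J (g l) n s)"
proof -
  let ?k = "\<lambda>t. \<alpha> n * (2 * G t) ^ n * (1 + 2 * s * G t) powr (1 / 2 - real n)"
  have "J (\<lambda>t. \<Sum>l\<in>K. c l * g l t) n s = integral {0..T} (\<lambda>t. \<Sum>l\<in>K. c l * (g l t * ?k t))"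
    unfolding J_def by (simp add: sum_distrib_right mult.assoc)
  also have "\<dots> = (\<Sum>l\<in>K. integral {0..T} (\<lambda>t. c l * (g l t * ?k t)))"
    using assms(1)
    by (rule integral_sum)
       (intro integrable_continuous_real continuous_on_mult continuous_on_const
         cont_integrand[OF assms(2) assms(3)])
  also have "\<dots> = (\<Sum>l\<in>K. c l * J (g l) n s)"
    unfolding J_def by (intro sum.cong refl integral_mult_right)
  finally show ?thesis .
qed

lemma sqrt_eq_J:
  assumes "0 < h"
  shows "integral {0..T} (\<lambda>t. f t * sqrt (h + 2 * G t)) = sqrt h * J f 0 (1 / h)"
proof -
  have "integral {0..T} (\<lambda>t. f t * sqrt (h + 2 * G t))
      = integral {0..T} (\<lambda>t. sqrt h * (f t * (\<alpha> 0 * (2 * G t) ^ 0 * (1 + 2 * (1 / h) * G t) powr (1 / 2 - real 0))))"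
  proof (intro integral_cong)
    fix t assume t: "t \<in> {0..T}"
    have "h + 2 * G t = h * (1 + 2 * (1 / h) * G t)" using assms by (simp add: field_simps)
    moreover have "0 \<le> 1 + 2 * (1 / h) * G t" using assms G_nonneg[OF t] by simp
    ultimately show "f t * sqrt (h + 2 * G t)
        = sqrt h * (f t * (\<alpha> 0 * (2 * G t) ^ 0 * (1 + 2 * (1 / h) * G t) powr (1 / 2 - real 0)))"
      by (simp add: \<alpha>_def real_sqrt_mult powr_half_sqrt)
  qed
  also have "\<dots> = sqrt h * J f 0 (1 / h)" unfolding J_def by (rule integral_mult_right)
  finally show ?thesis .
qed

text \<open>With y = 1 + 2 G / h one has 1 / sqrt y = sqrt y - (y - 1) / sqrt y, and the last term
  is 2 / h times the kernel of \<open>J f 1\<close>. Hence, at a zero of \<open>J f 0\<close>, this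
  integral is nonzero exactly when \<open>J f 1\<close> is.\<close>

lemma inverse_sqrt_eq_J:
  assumes f: "continuous_on {0..T} f" and h: "0 < h"
  shows "integral {0..T} (\<lambda>t. f t / sqrt (h + 2 * G t)) = (J f 0 (1 / h) - 2 / h * J f 1 (1 / h)) / sqrt h"
proof -
  let ?s = "1 / h"
  have s: "- \<eta> < ?s" using h \<eta>_pos by (meson divide_pos_pos less_trans neg_less_0_iff_less zero_less_one)
  have pos: "0 < 1 + 2 * ?s * G t" if "t \<in> {0..T}" for t by (rule kernel_pos[OF that s])
  let ?a = "\<lambda>t. f t * (\<alpha> 0 * (2 * G t) ^ 0 * (1 + 2 * ?s * G t) powr (1 / 2 - real 0))"
  let ?b = "\<lambda>t. f t * (\<alpha> 1 * (2 * G t) ^ 1 * (1 + 2 * ?s * G t) powr (1 / 2 - real 1))"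
  have c: "continuous_on {0..T} ?a" "continuous_on {0..T} ?b"
    by (intro cont_integrand[OF f s])+
  have eq: "f t / sqrt (h + 2 * G t) = (?a t - 2 / h * ?b t) * (1 / sqrt h)" if t: "t \<in> {0..T}" for t
  proof -
    define y where "y = 1 + 2 * ?s * G t"
    have y: "0 < y" using pos[OF t] by (simp add: y_def)
    have "h + 2 * G t = h * y" using h by (simp add: y_def field_simps)
    then have 1: "f t / sqrt (h + 2 * G t) = f t / sqrt y * (1 / sqrt h)"
      by (simp add: real_sqrt_mult)
    have "y powr (1 / 2 - 1) = y powr (1 / 2) / y powr 1" by (rule powr_diff)
    also have "\<dots> = sqrt y / (sqrt y * sqrt y)" using y by (simp add: powr_half_sqrt)
    also have "\<dots> = 1 / sqrt y" using y by (subst divide_divide_eq_left[symmetric]) simp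
    finally have p: "y powr (1 / 2 - 1) = 1 / sqrt y" .
    have "?a t - 2 / h * ?b t = f t * (sqrt y - (y - 1) * (1 / sqrt y))"
      using y p h unfolding y_def[symmetric]
      by (simp add: \<alpha>_def powr_half_sqrt) (simp add: y_def algebra_simps)
    also have "\<dots> = f t / sqrt y"
      using y by (simp add: field_simps)
    finally show ?thesis unfolding 1 by simp
  qed
  have "integral {0..T} (\<lambda>t. f t / sqrt (h + 2 * G t)) = integral {0..T} (\<lambda>t. (?a t - 2 / h * ?b t) * (1 / sqrt h))"
    by (intro integral_cong eq)
  also have "\<dots> = integral {0..T} (\<lambda>t. ?a t - 2 / h * ?b t) * (1 / sqrt h)" by (rule integral_mult_left)
  also have "integral {0..T} (\<lambda>t. ?a t - 2 / h * ?b t) = integral {0..T} ?a - integral {0..T} (\<lambda>t. 2 / h * ?b t)"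
    by (intro integral_diff integrable_continuous_real continuous_on_mult continuous_on_const c)
  also have "integral {0..T} (\<lambda>t. 2 / h * ?b t) = 2 / h * integral {0..T} ?b" by (rule integral_mult_right)
  finally show ?thesis by (simp add: J_def)
qed

text \<open>\<open>moments_nonzero\<close> makes the matrix of Taylor coefficients at s = 0
  invertible, because these are nonzero multiples of moments. So the jet of order R of the integral
  can be prescribed, and the zeros in s are carried to h = 1 / s.\<close>

theorem simple_zeros_of_sqrt_integral:
  fixes g :: "nat \<Rightarrow> real \<Rightarrow> real"
  assumes nonconst: "\<exists>s\<in>{0<..<T}. \<exists>t\<in>{0<..<T}. G s \<noteq> G t" and R: "1 \<le> R"
    and g: "\<And>l. l \<le> R \<Longrightarrow> continuous_on {0..T} (g l)"
    and CT: "\<And>c. \<exists>l\<le>R. c l \<noteq> 0 \<Longrightarrow> finite {t \<in> {0<..<T}. (\<Sum>l\<le>R. c l * g l t) = 0} \<and>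
        card {t \<in> {0<..<T}. (\<Sum>l\<le>R. c l * g l t) = 0} \<le> R"
  obtains c H where "finite H" "card H = R"
    "\<And>h. h \<in> H \<Longrightarrow> 0 < h \<and> integral {0..T} (\<lambda>t. (\<Sum>l\<le>R. c l * g l t) * sqrt (h + 2 * G t)) = 0 \<and>
       integral {0..T} (\<lambda>t. (\<Sum>l\<le>R. c l * g l t) / sqrt (h + 2 * G t)) \<noteq> 0"
    "integral {0..T} (\<lambda>t. \<Sum>l\<le>R. c l * g l t) \<noteq> 0"
proof -
  let ?f = "\<lambda>c t. \<Sum>l\<le>R. c l * g l t"
  have cf: "continuous_on {0..T} (?f c)" for c
    by (intro continuous_on_sum continuous_on_mult continuous_on_const g) simp
  have Jf: "J (?f c) n s = (\<Sum>l\<le>R. c l * J (g l) n s)" if "- \<eta> < s" for c n s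
    by (rule J_sum) (use g that in auto)
  have \<eta>0: "- \<eta> < 0" using \<eta>_pos by simp
  have inj: "\<forall>l\<le>R. c l = 0" if c: "\<And>i. i \<le> R \<Longrightarrow> (\<Sum>l\<le>R. J (g l) i 0 * c l) = 0" for c
  proof (rule ccontr)
    assume "\<not> (\<forall>l\<le>R. c l = 0)"
    then have "\<exists>l\<le>R. c l \<noteq> 0" by blast
    then have fin: "finite {t \<in> {0<..<T}. ?f c t = 0}" "card {t \<in> {0<..<T}. ?f c t = 0} \<le> R"
      using CT by blast+
    obtain s t where st: "s \<in> {0<..<T}" "t \<in> {0<..<T}" "G s \<noteq> G t" using nonconst by blast
    obtain k where k: "k \<le> R" "integral {0..T} (\<lambda>t. ?f c t * G t ^ k) \<noteq> 0"
      using moments_nonzero[OF T_pos cf cont_G G_anti st fin] by blast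
    have "J (?f c) k 0 = 0"
      using c[OF k(1)] Jf[OF \<eta>0, of c k] by (simp add: mult.commute)
    then show False using k(2) \<alpha>_nonzero unfolding J_at_0 by simp
  qed
  \<comment> \<open>\<open>e k\<close> collects the coefficients of a combination whose integral
    agrees with the monomial s^k up to order R, whence the factorial.\<close>
  have "\<forall>k. \<exists>e. \<forall>i\<le>R. (\<Sum>l\<le>R. J (g l) i 0 * e l) = (if i = k then fact k else 0)"
    by (intro allI injective_square_system_solvable inj)
  then obtain e where "\<forall>k. \<forall>i\<le>R. (\<Sum>l\<le>R. J (g l) i 0 * e k l) = (if i = k then fact k else 0)"
    by (rule choice[THEN exE])
  then have jet: "J (?f (e k)) i 0 = (if i = k then fact k else 0)" if "i \<le> R" for i k
    using that Jf[OF \<eta>0, of "e k" i] by (simp add: mult.commute)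
  have "\<forall>k. \<exists>C. k \<le> R \<longrightarrow> 0 \<le> C \<and> (\<forall>s>0. \<bar>J (?f (e k)) 0 s - s ^ k\<bar> \<le> C * s ^ Suc R \<and>
      \<bar>J (?f (e k)) 1 s - real k * s ^ (k - 1)\<bar> \<le> C * s ^ R)"
  proof
    fix k
    show "\<exists>C. k \<le> R \<longrightarrow> 0 \<le> C \<and> (\<forall>s>0. \<bar>J (?f (e k)) 0 s - s ^ k\<bar> \<le> C * s ^ Suc R \<and>
      \<bar>J (?f (e k)) 1 s - real k * s ^ (k - 1)\<bar> \<le> C * s ^ R)"
    proof (cases "k \<le> R")
      case True
      obtain C where "0 \<le> C" "\<And>s. 0 < s \<Longrightarrow> \<bar>J (?f (e k)) 0 s - s ^ k\<bar> \<le> C * s ^ Suc R"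
        "\<And>s. 0 < s \<Longrightarrow> \<bar>J (?f (e k)) 1 s - real k * s ^ (k - 1)\<bar> \<le> C * s ^ R"
        by (rule J_expansion[OF cf R True jet]) (assumption | rule that)+
      then show ?thesis by (intro exI[of _ C]) simp
    qed simp
  qed
  then obtain C where C: "\<forall>k. k \<le> R \<longrightarrow> 0 \<le> C k \<and> (\<forall>s>0. \<bar>J (?f (e k)) 0 s - s ^ k\<bar> \<le> C k * s ^ Suc R \<and>
      \<bar>J (?f (e k)) 1 s - real k * s ^ (k - 1)\<bar> \<le> C k * s ^ R)"
    by (rule choice[THEN exE])
  define C' where "C' = (\<Sum>k\<le>R. C k)"
  have C'0: "0 \<le> C'" unfolding C'_def using C by (intro sum_nonneg) simp
  have CC': "C k \<le> C'" if "k \<le> R" for k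
    unfolding C'_def using C that by (intro member_le_sum) auto
  obtain d S where S: "finite S" "card S = R" and d0: "d 0 \<noteq> 0"
    and z: "\<And>s. s \<in> S \<Longrightarrow> 0 < s \<and> (\<Sum>k\<le>R. d k * J (?f (e k)) 0 s) = 0 \<and> (\<Sum>k\<le>R. d k * J (?f (e k)) 1 s) \<noteq> 0"
  proof (rule simple_zeros_from_leading_terms[OF R C'0, of "\<lambda>k. J (?f (e k)) 0" "\<lambda>k. J (?f (e k)) 1"])
    fix k :: nat and s :: real assume k: "k \<le> R" and s: "0 < s"
    have "C k * s ^ Suc R \<le> C' * s ^ Suc R" "C k * s ^ R \<le> C' * s ^ R"
      using CC'[OF k] s by (auto intro!: mult_right_mono simp del: power_Suc)
    moreover have "\<bar>J (?f (e k)) 0 s - s ^ k\<bar> \<le> C k * s ^ Suc R"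
      "\<bar>J (?f (e k)) 1 s - real k * s ^ (k - 1)\<bar> \<le> C k * s ^ R"
      using C k s by blast+
    ultimately show "\<bar>J (?f (e k)) 0 s - s ^ k\<bar> \<le> C' * s ^ Suc R"
      "\<bar>J (?f (e k)) 1 s - real k * s ^ (k - 1)\<bar> \<le> C' * s ^ R" by linarith+
    show "(J (?f (e k)) 0 has_real_derivative J (?f (e k)) 1 s) (at s)"
      using J_deriv[OF cf, of s "e k" 0] s \<eta>_pos by simp
  qed (rule that)
  define c where "c l = (\<Sum>k\<le>R. d k * e k l)" for l
  have fc: "?f c = (\<lambda>t. \<Sum>k\<le>R. d k * ?f (e k) t)"
  proof
    fix t
    have "?f c t = (\<Sum>l\<le>R. \<Sum>k\<le>R. d k * (e k l * g l t))"
      by (simp add: c_def sum_distrib_right mult.assoc)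
    also have "\<dots> = (\<Sum>k\<le>R. \<Sum>l\<le>R. d k * (e k l * g l t))" by (rule sum.swap)
    finally show "?f c t = (\<Sum>k\<le>R. d k * ?f (e k) t)" by (simp add: sum_distrib_left)
  qed
  have Jc: "J (?f c) n s = (\<Sum>k\<le>R. d k * J (?f (e k)) n s)" if "0 \<le> s" for n s
    unfolding fc by (rule J_sum) (use cf that \<eta>_pos in auto)
  show thesis
  proof (rule that[of "(\<lambda>s. 1 / s) ` S" c])
    have "inj_on (\<lambda>s. 1 / s) S" by (rule inj_onI) simp
    then show "finite ((\<lambda>s. 1 / s) ` S)" "card ((\<lambda>s. 1 / s) ` S) = R"
      using S card_image by auto
    \<comment> \<open>At s = 0 the kernel is 1 and, up to order R, only the jet for k = 0 has a
      nonzero value, so the plain integral of the combination is \<open>d 0\<close>.\<close>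
    have "integral {0..T} (?f c) = J (?f c) 0 0" unfolding J_at_0 by (simp add: \<alpha>_def)
    also have "\<dots> = (\<Sum>k\<le>R. if k = 0 then d 0 else 0)"
      unfolding Jc[OF order_refl] by (intro sum.cong refl) (simp add: jet)
    also have "\<dots> = d 0" by simp
    finally show "integral {0..T} (?f c) \<noteq> 0" using d0 by simp
    fix h assume "h \<in> (\<lambda>s. 1 / s) ` S"
    then obtain s where s: "s \<in> S" "h = 1 / s" by blast
    have s0: "0 < s" using z[OF s(1)] by simp
    have h: "0 < h" "1 / h = s" using s s0 by auto
    have J01: "J (?f c) 0 s = 0" "J (?f c) 1 s \<noteq> 0" using z[OF s(1)] Jc s0 by auto
    have "integral {0..T} (\<lambda>t. ?f c t * sqrt (h + 2 * G t)) = 0"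
      unfolding sqrt_eq_J[OF h(1)] h(2) J01 by simp
    moreover have "integral {0..T} (\<lambda>t. ?f c t / sqrt (h + 2 * G t)) \<noteq> 0"
      unfolding inverse_sqrt_eq_J[OF cf h(1)] h(2) J01(1) using J01(2) h(1) by simp
    ultimately show "0 < h \<and> integral {0..T} (\<lambda>t. ?f c t * sqrt (h + 2 * G t)) = 0 \<and>
       integral {0..T} (\<lambda>t. ?f c t / sqrt (h + 2 * G t)) \<noteq> 0" using h(1) by blast
  qed
qed

end

section \<open>Integration by parts in the Melnikov function\<close>

context abel_perturbation
begin

lemma sqrt_kernel_G: "sqrt_kernel T G"
proof (rule sqrt_kernel.intro[OF T_pos continuous_on_subset[OF cont_G] G_nonneg G_decreasing])
qed (use T_pos in simp_all)

text \<open>If G were constant on (0,T), continuity would give G 0 = G T, so the nonnegative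
  \<open>a\<close> would have integral 0 over [0,T] and vanish there.\<close>

lemma G_nonconstant:
  assumes "t \<in> {0..T}" "a t \<noteq> 0"
  shows "\<exists>s\<in>{0<..<T}. \<exists>t\<in>{0<..<T}. G s \<noteq> G t"
proof (rule ccontr)
  assume neg: "\<not> ?thesis"
  have cG: "continuous_on {0..T} G" using cont_G by (rule continuous_on_subset) (use T_pos in auto)
  have ca: "continuous_on {0..T} a" using cont_a by (rule continuous_on_subset) (use T_pos in auto)
  have const: "G x = G (T / 2)" if x: "x \<in> {0<..<T}" for x
  proof (rule ccontr)
    assume ne: "G x \<noteq> G (T / 2)"
    have "T / 2 \<in> {0<..<T}" using T_pos by simp
    with ne have "\<exists>t\<in>{0<..<T}. G x \<noteq> G t" by (rule bexI)
    then have "\<exists>s\<in>{0<..<T}. \<exists>t\<in>{0<..<T}. G s \<noteq> G t" using x by (rule bexI)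
    with neg show False by (rule notE)
  qed
  have clo: "closure {0<..<T} = {0..T}" using T_pos by simp
  have "G s = G (T / 2)" if "s \<in> {0..T}" for s
    by (rule continuous_constant_on_closure[OF cG[folded clo] const that[folded clo]])
  from this[of 0] this[of T] have "G 0 = G T" using T_pos by simp
  moreover have "integral {- T..0} a + integral {0..T} a = integral {- T..T} a"
    using T_pos
    by (intro Henstock_Kurzweil_Integration.integral_combine integrable_continuous_real cont_a) auto
  ultimately have "integral {0..T} a = 0" by (simp add: G_def)
  then have "a t = 0" using integral_eq_0_iff[OF ca T_pos a_nonneg] assms(1) by blast
  then show False using assms(2) by simp
qed

lemma integral_derivative_vanishing_ends:
  fixes P p :: "real \<Rightarrow> real"
  assumes "\<And>t. t \<in> {0..T} \<Longrightarrow> (P has_real_derivative p t) (at t within {0..T})" "P 0 = 0" "P T = 0"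
  shows "integral {0..T} p = 0"
proof -
  have "(p has_integral P T - P 0) {0..T}"
    by (rule fundamental_theorem_of_calculus)
       (use T_pos assms(1) in \<open>auto simp flip: has_real_derivative_iff_has_vector_derivative\<close>)
  then show ?thesis using assms(2,3) by (simp add: integral_unique)
qed

text \<open>The primitive F of \<open>X\<close> vanishes at 0 and T, and sqrt (V h) has derivative -
  a / sqrt (V h). So a product \<open>b * \<Phi>\<close> of the form - F a is moved by parts,
  without boundary terms, into the integral of \<open>X\<close> against sqrt (V h). The spaces in
  (c) consist of such multiples of f_1, which here is \<open>a\<close>.\<close>

lemma melnikov_by_parts:
  assumes X: "continuous_on {0..T} X" and X0: "integral {0..T} X = 0"
    and bX: "\<And>t. t \<in> {0..T} \<Longrightarrow> b t * \<Phi> t = - (integral {0..t} X * a t)"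
    and h: "0 < h"
  shows "melnikov h = integral {0..T} (\<lambda>t. (even_part B1 t + X t) * sqrt (h + 2 * G t))"
    and "melnikov' h = integral {0..T} (\<lambda>t. (even_part B1 t + X t) / sqrt (h + 2 * G t)) / 2"
proof -
  have ST: "{0..T} \<subseteq> {- T..T}" using T_pos by auto
  have cV: "continuous_on {0..T} (V h)" by (rule continuous_on_subset[OF cont_V ST])
  have ca: "continuous_on {0..T} a" by (rule continuous_on_subset[OF cont_a ST])
  have cB: "continuous_on {0..T} (even_part B1)" by (rule cont_even_part[OF cont_B1])
  have Vp: "0 < V h t" if "t \<in> {0..T}" for t
    using V_ge[OF subsetD[OF ST that], of h] h by linarith
  define F where "F t = integral {0..t} X" for t
  have cF: "continuous_on {0..T} F"
    unfolding F_def by (intro indefinite_integral_continuous_1 integrable_continuous_real X)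
  have dF: "(F has_real_derivative X t) (at t within {0..T})" if "t \<in> {0..T}" for t
    unfolding F_def by (rule integral_has_real_derivative[OF X that])
  have F_ends: "F 0 = 0" "F T = 0" using X0 by (simp_all add: F_def)
  have bF: "b t * \<Phi> t = - (F t * a t)" if "t \<in> {0..T}" for t using bX[OF that] by (simp add: F_def)
  have dV: "(V h has_real_derivative - 2 * a t) (at t within {0..T})" if t: "t \<in> {0..T}" for t
  proof -
    have "((\<lambda>t. - integral {- T..t} a) has_real_derivative - a t) (at t within {- T..T})"
      by (intro DERIV_minus integral_has_real_derivative[OF cont_a subsetD[OF ST t]])
    then have "(G has_real_derivative - a t) (at t within {- T..T})"
      by (simp add: G_def[abs_def])
    then have "(G has_real_derivative - a t) (at t within {0..T})" by (rule DERIV_subset[OF _ ST])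
    then have "((\<lambda>t. h + 2 * G t) has_real_derivative 0 + 2 * - a t) (at t within {0..T})"
      by (intro DERIV_add DERIV_const DERIV_cmult)
    then show ?thesis by (simp add: V_def[abs_def])
  qed
  have ne: "\<forall>t\<in>{0..T}. sqrt (V h t) \<noteq> 0" "\<forall>t\<in>{0..T}. V h t * sqrt (V h t) \<noteq> 0"
    using less_imp_neq[OF Vp, symmetric] by simp_all
  have c1: "continuous_on {0..T} (\<lambda>t. X t * sqrt (V h t))" "continuous_on {0..T} (\<lambda>t. even_part B1 t * sqrt (V h t))"
    by (intro continuous_intros X cV cB)+
  have c2: "continuous_on {0..T} (\<lambda>t. F t * a t / sqrt (V h t))"
    by (rule continuous_on_divide[OF continuous_on_mult[OF cF ca] continuous_on_real_sqrt[OF cV] ne(1)])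
  have c3: "continuous_on {0..T} (\<lambda>t. X t / sqrt (V h t))" "continuous_on {0..T} (\<lambda>t. even_part B1 t / sqrt (V h t))"
    by (intro continuous_on_divide continuous_on_real_sqrt X cV cB ne(1))+
  have c4: "continuous_on {0..T} (\<lambda>t. F t * a t / (V h t * sqrt (V h t)))"
    by (rule continuous_on_divide[OF continuous_on_mult[OF cF ca]
          continuous_on_mult[OF cV continuous_on_real_sqrt[OF cV]] ne(2)])
  have ds: "((\<lambda>t. sqrt (V h t)) has_real_derivative inverse (sqrt (V h t)) / 2 * (- 2 * a t)) (at t within {0..T})"
    if t: "t \<in> {0..T}" for t
    by (rule DERIV_chain2[where f = sqrt and g = "V h", OF DERIV_real_sqrt[OF Vp[OF t]] dV[OF t]])
  have d1: "((\<lambda>t. F t * sqrt (V h t)) has_real_derivative X t * sqrt (V h t) - F t * a t / sqrt (V h t))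
      (at t within {0..T})" if t: "t \<in> {0..T}" for t
  proof -
    have "X t * y + inverse y / 2 * (- 2 * z) * w = X t * y - w * z / y" for y z w :: real
      by (simp add: inverse_eq_divide)
    with DERIV_mult[OF dF[OF t] ds[OF t]] show ?thesis by (simp only:)
  qed
  have "integral {0..T} (\<lambda>t. X t * sqrt (V h t) - F t * a t / sqrt (V h t)) = 0"
    by (rule integral_derivative_vanishing_ends[OF d1]) (simp_all add: F_ends)
  then have parts1: "integral {0..T} (\<lambda>t. X t * sqrt (V h t)) = integral {0..T} (\<lambda>t. F t * a t / sqrt (V h t))"
    using c1 c2 by (simp add: integral_diff integrable_continuous_real)
  have d2: "((\<lambda>t. F t / sqrt (V h t)) has_real_derivative X t / sqrt (V h t) + F t * a t / (V h t * sqrt (V h t)))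
      (at t within {0..T})" if t: "t \<in> {0..T}" for t
  proof -
    have eq: "(x * y - w * (inverse y / 2 * (- 2 * z))) / (y * y) = x / y + w * z / (v * y)"
      if "y \<noteq> 0" "v = y * y" for x y z w v :: real
      using that(1) unfolding that(2) by (simp add: field_simps)
    have y: "sqrt (V h t) \<noteq> 0" "V h t = sqrt (V h t) * sqrt (V h t)" using Vp[OF t] by simp_all
    show ?thesis
      using DERIV_divide[OF dF[OF t] ds[OF t] y(1)] by (simp only: eq[OF y])
  qed
  have "integral {0..T} (\<lambda>t. X t / sqrt (V h t) + F t * a t / (V h t * sqrt (V h t))) = 0"
    by (rule integral_derivative_vanishing_ends[OF d2]) (simp_all add: F_ends)
  then have parts2: "integral {0..T} (\<lambda>t. F t * a t / (V h t * sqrt (V h t))) = - integral {0..T} (\<lambda>t. X t / sqrt (V h t))"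
    using c3 c4 by (simp add: integral_add integrable_continuous_real)
  have "melnikov h = integral {0..T} (\<lambda>t. even_part B1 t * sqrt (V h t) + F t * a t / sqrt (V h t))"
    unfolding melnikov_def using bF by (intro integral_cong) simp
  also have "\<dots> = integral {0..T} (\<lambda>t. even_part B1 t * sqrt (V h t)) + integral {0..T} (\<lambda>t. X t * sqrt (V h t))"
    unfolding parts1 using c1 c2 by (simp add: integral_add integrable_continuous_real)
  also have "\<dots> = integral {0..T} (\<lambda>t. even_part B1 t * sqrt (V h t) + X t * sqrt (V h t))"
    using c1 by (simp add: integral_add integrable_continuous_real)
  finally show "melnikov h = integral {0..T} (\<lambda>t. (even_part B1 t + X t) * sqrt (h + 2 * G t))"
    by (simp add: V_def distrib_right)
  have "melnikov' h = integral {0..T} (\<lambda>t. (even_part B1 t / sqrt (V h t) - F t * a t / (V h t * sqrt (V h t))) * (1 / 2))"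
    unfolding melnikov'_def
  proof (intro integral_cong)
    fix t assume t: "t \<in> {0..T}"
    have "x / (2 * s) + - y / (2 * v * s) = (x / s - y / (v * s)) * (1 / 2)" for x y v s :: real
      by (simp add: diff_divide_distrib mult_ac)
    then show "even_part B1 t / (2 * sqrt (V h t)) + b t * \<Phi> t / (2 * V h t * sqrt (V h t))
        = (even_part B1 t / sqrt (V h t) - F t * a t / (V h t * sqrt (V h t))) * (1 / 2)"
      unfolding bF[OF t] .
  qed
  also have "\<dots> = integral {0..T} (\<lambda>t. even_part B1 t / sqrt (V h t) - F t * a t / (V h t * sqrt (V h t))) * (1 / 2)"
    by (rule integral_mult_left)
  also have "integral {0..T} (\<lambda>t. even_part B1 t / sqrt (V h t) - F t * a t / (V h t * sqrt (V h t)))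
      = integral {0..T} (\<lambda>t. even_part B1 t / sqrt (V h t)) + integral {0..T} (\<lambda>t. X t / sqrt (V h t))"
    using c3 c4 parts2 by (simp add: integral_diff integrable_continuous_real)
  also have "\<dots> = integral {0..T} (\<lambda>t. even_part B1 t / sqrt (V h t) + X t / sqrt (V h t))"
    using c3 by (simp add: integral_add integrable_continuous_real)
  finally show "melnikov' h = integral {0..T} (\<lambda>t. (even_part B1 t + X t) / sqrt (h + 2 * G t)) / 2"
    by (simp add: V_def add_divide_distrib)
qed

end

section \<open>Realization by the family\<close>

lemma real_analytic_on_isCont:
  assumes "real_analytic_on g U" "x \<in> U"
  shows "isCont g x"
proof -
  from assms have "\<exists>r>0. \<exists>a :: nat \<Rightarrow> real. \<forall>y. \<bar>y - x\<bar> < r \<longrightarrow> (\<lambda>k. a k * (y - x) ^ k) sums g y"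
    by (simp add: real_analytic_on_def)
  then obtain r a where r: "0 < r" and s: "\<forall>y. \<bar>y - x\<bar> < r \<longrightarrow> (\<lambda>k. a k * (y - x) ^ k) sums g y"
    by (elim exE conjE)
  let ?p = "\<lambda>z. \<Sum>k. a k * z ^ k"
  have "(\<lambda>k. a k * (x + r / 2 - x) ^ k) sums g (x + r / 2)"
    using s[rule_format, of "x + r / 2"] r by simp
  then have "summable (\<lambda>k. a k * (r / 2) ^ k)" by (simp add: sums_iff)
  then have "isCont ?p 0" by (rule isCont_powser) (use r in simp)
  then have "isCont (\<lambda>y. ?p (y - x)) x"
    by (intro isCont_o2[where f = "\<lambda>y. y - x" and g = ?p]) simp_all
  moreover have "eventually (\<lambda>y. ?p (y - x) = g y) (nhds x)"
    unfolding eventually_nhds_metric dist_real_def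
  proof (intro exI[of _ r] conjI allI impI r)
    fix y assume "\<bar>y - x\<bar> < r"
    from s[rule_format, OF this] show "?p (y - x) = g y" by (rule sums_unique[symmetric])
  qed
  ultimately show ?thesis by (simp add: isCont_cong)
qed

section \<open>Linear spans on the interval\<close>

lemma span_on_add:
  assumes "g \<in> span_on S f K" "h \<in> span_on S f K"
  shows "(\<lambda>t. g t + h t) \<in> span_on S f K"
proof -
  obtain c where c: "\<forall>t\<in>S. g t = (\<Sum>i\<in>K. c i * f i t)"
    using assms(1) unfolding span_on_def by (elim CollectE exE)
  obtain d where d: "\<forall>t\<in>S. h t = (\<Sum>i\<in>K. d i * f i t)"
    using assms(2) unfolding span_on_def by (elim CollectE exE)
  show ?thesis unfolding span_on_def
    by (intro CollectI exI[of _ "\<lambda>i. c i + d i"] ballI) (simp add: c d sum.distrib distrib_right)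
qed

lemma span_on_scale:
  assumes "g \<in> span_on S f K"
  shows "(\<lambda>t. r * g t) \<in> span_on S f K"
proof -
  obtain c where c: "\<forall>t\<in>S. g t = (\<Sum>i\<in>K. c i * f i t)"
    using assms unfolding span_on_def by (elim CollectE exE)
  show ?thesis unfolding span_on_def
    by (intro CollectI exI[of _ "\<lambda>i. r * c i"] ballI) (simp add: c sum_distrib_left mult.assoc)
qed

lemma span_on_base:
  assumes "finite K" "k \<in> K"
  shows "f k \<in> span_on S f K"
  unfolding span_on_def
proof (intro CollectI exI[of _ "\<lambda>i. if i = k then 1 else 0"] ballI)
  fix t
  have "(\<Sum>i\<in>K. (if i = k then 1 else 0) * f i t) = (\<Sum>i\<in>K. if k = i then f i t else 0)"
    by (intro sum.cong) auto
  then show "f k t = (\<Sum>i\<in>K. (if i = k then 1 else 0) * f i t)" using assms by simp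
qed

lemma span_on_sum:
  assumes "finite K" "finite L" "\<And>l. l \<in> L \<Longrightarrow> i l \<in> K"
  shows "(\<lambda>t. \<Sum>l\<in>L. c l * f (i l) t) \<in> span_on S f K"
  using assms(2,3)
proof (induction L rule: finite_induct)
  case empty
  show ?case unfolding span_on_def by (intro CollectI exI[of _ "\<lambda>_. 0"]) simp
next
  case (insert l L)
  have "(\<lambda>t. c l * f (i l) t + (\<Sum>l\<in>L. c l * f (i l) t)) \<in> span_on S f K"
    using insert by (intro span_on_add span_on_scale span_on_base assms(1)) auto
  then show ?case using insert.hyps by simp
qed

lemma span_on_continuous:
  assumes "h \<in> span_on S f K" "\<And>i. continuous_on S (f i)"
  shows "continuous_on S h"
proof -
  obtain c where c: "\<forall>t\<in>S. h t = (\<Sum>i\<in>K. c i * f i t)"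
    using assms(1) unfolding span_on_def by (elim CollectE exE)
  have "continuous_on S (\<lambda>t. \<Sum>i\<in>K. c i * f i t)"
    by (intro continuous_on_sum continuous_on_mult continuous_on_const assms(2))
  then show ?thesis by (rule continuous_on_eq) (simp add: c)
qed

lemma even_part_sum: "even_part (\<lambda>t. \<Sum>l\<in>L. c l * g l t) t = (\<Sum>l\<in>L. c l * even_part (g l) t)"
  by (simp add: even_part_def sum.distrib[symmetric] sum_divide_distrib distrib_left[symmetric])

lemma admissible_family_continuous:
  assumes "admissible_family T f"
  shows "continuous_on {- T..T} (f i)"
proof -
  obtain U where "{- T..T} \<subseteq> U" "real_analytic_on (f i) U"
    using assms unfolding admissible_family_def by meson
  then show ?thesis
    by (intro continuous_at_imp_continuous_on ballI real_analytic_on_isCont) auto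
qed

text \<open>The common frame of both parts: what remains is to realise a given combination of even
  parts as \<open>even_part B1 + X\<close>. It is required for every c, because the vector c that
  produces the zeros comes from an existence statement.\<close>

theorem H32_ge:
  fixes i :: "nat \<Rightarrow> nat"
  assumes T: "0 < T" and adm: "admissible_family T f" and a: "cond_a T f" and n: "1 \<le> n" and R: "1 \<le> R"
    and CT: "\<And>c. \<exists>l\<le>R. c l \<noteq> 0 \<Longrightarrow> finite {t \<in> {0<..<T}. (\<Sum>l\<le>R. c l * even_part (f (i l)) t) = 0} \<and>
        card {t \<in> {0<..<T}. (\<Sum>l\<le>R. c l * even_part (f (i l)) t) = 0} \<le> R"
    and realize: "\<And>c. \<exists>A1 b B1 X. A1 \<in> span_on {- T..T} f {0..n} \<and> b \<in> span_on {- T..T} f {0..m} \<and>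
        B1 \<in> span_on {- T..T} f {0..m} \<and> continuous_on {0..T} X \<and>
        (\<forall>t\<in>{- T..T}. b (- t) = - b t) \<and> integral {- T..T} A1 = 0 \<and> integral {0..T} X = 0 \<and>
        (\<forall>t\<in>{0..T}. b t * integral {0..t} (even_part A1) = - (integral {0..t} X * f 1 t)) \<and>
        (\<forall>t\<in>{0..T}. even_part B1 t + X t = (\<Sum>l\<le>R. c l * even_part (f (i l)) t))"
  shows "enat (2 * R + 1) \<le> H32 T f n m"
proof -
  have cf: "continuous_on {- T..T} (f k)" for k by (rule admissible_family_continuous[OF adm])
  have odd1: "f 1 (- t) = - f 1 t" if "t \<in> {- T..T}" for t using a that by (simp add: cond_a_def)
  have pos1: "0 \<le> f 1 t" if "t \<in> {0..T}" for t using a that by (simp add: cond_a_def)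
  \<comment> \<open>The zeros must be found before the perturbation is known; since \<open>G\<close>
    depends on T and \<open>f 1\<close> alone, the trivial perturbation supplies the same
    \<open>G\<close>.\<close>
  interpret p0: abel_perturbation T "f 1" "\<lambda>_. 0" "\<lambda>_. 0" "\<lambda>_. 0"
    by (rule abel_perturbation.intro[OF T cf continuous_on_const continuous_on_const continuous_on_const
          odd1 _ pos1]) simp_all
  interpret k: sqrt_kernel T p0.G by (rule p0.sqrt_kernel_G)
  obtain t0 where "t0 \<in> {0..T}" "f 1 t0 \<noteq> 0" using a unfolding cond_a_def by blast
  note nonconst = p0.G_nonconstant[OF this]
  let ?g = "\<lambda>l. even_part (f (i l))"
  obtain c H where H: "finite H" "card H = R"
    and zeros: "\<And>h. h \<in> H \<Longrightarrow> 0 < h \<and> integral {0..T} (\<lambda>t. (\<Sum>l\<le>R. c l * ?g l t) * sqrt (h + 2 * p0.G t)) = 0 \<and>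
       integral {0..T} (\<lambda>t. (\<Sum>l\<le>R. c l * ?g l t) / sqrt (h + 2 * p0.G t)) \<noteq> 0"
    and int0: "integral {0..T} (\<lambda>t. \<Sum>l\<le>R. c l * ?g l t) \<noteq> 0"
    by (rule k.simple_zeros_of_sqrt_integral[OF nonconst R p0.cont_even_part[OF cf] CT]) (assumption | rule that)+
  obtain A1 b B1 X where A1: "A1 \<in> span_on {- T..T} f {0..n}" and b: "b \<in> span_on {- T..T} f {0..m}"
    and B1: "B1 \<in> span_on {- T..T} f {0..m}" and X: "continuous_on {0..T} X"
    and b_odd: "\<forall>t\<in>{- T..T}. b (- t) = - b t" and A10: "integral {- T..T} A1 = 0" and X0: "integral {0..T} X = 0"
    and bX: "\<forall>t\<in>{0..T}. b t * integral {0..t} (even_part A1) = - (integral {0..t} X * f 1 t)"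
    and comb: "\<forall>t\<in>{0..T}. even_part B1 t + X t = (\<Sum>l\<le>R. c l * ?g l t)"
    using realize[of c] by (elim exE conjE)
  have cont: "continuous_on {- T..T} A1" "continuous_on {- T..T} b" "continuous_on {- T..T} B1"
    by (rule span_on_continuous[OF A1 cf] span_on_continuous[OF b cf] span_on_continuous[OF B1 cf])+
  interpret p: abel_perturbation T "f 1" A1 b B1
    by (rule abel_perturbation.intro[OF T cf cont odd1 _ pos1 A10]) (use b_odd in blast)+
  have bX': "b t * p.\<Phi> t = - (integral {0..t} X * f 1 t)" if "t \<in> {0..T}" for t
    unfolding p.\<Phi>_def by (rule bspec[OF bX that])
  have mel: "0 < h \<and> p.melnikov h = 0 \<and> p.melnikov' h \<noteq> 0" if h: "h \<in> H" for h
  proof -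
    have h0: "0 < h" using zeros[OF h] by (rule conjunct1)
    have "integral {0..T} (\<lambda>t. (even_part B1 t + X t) * sqrt (h + 2 * p.G t))
        = integral {0..T} (\<lambda>t. (\<Sum>l\<le>R. c l * ?g l t) * sqrt (h + 2 * p0.G t))"
      by (intro integral_cong) (simp add: bspec[OF comb])
    moreover have "integral {0..T} (\<lambda>t. (even_part B1 t + X t) / sqrt (h + 2 * p.G t))
        = integral {0..T} (\<lambda>t. (\<Sum>l\<le>R. c l * ?g l t) / sqrt (h + 2 * p0.G t))"
      by (intro integral_cong) (simp add: bspec[OF comb])
    ultimately show ?thesis
      using zeros[OF h] p.melnikov_by_parts[OF X X0 bX' h0] by simp
  qed
  \<comment> \<open>\<open>X\<close> has integral 0, so the mean of \<open>B1\<close> is twice the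
    integral of the combination, which is nonzero.\<close>
  have "integral {- T..T} B1 \<noteq> 0"
  proof -
    have "integral {- T..T} B1 = integral {0..T} (\<lambda>t. B1 t + B1 (- t))"
      by (rule integral_symmetric_interval) (use T cont in auto)
    also have "\<dots> = integral {0..T} (\<lambda>t. 2 * ((\<Sum>l\<le>R. c l * ?g l t) - X t))"
    proof (intro integral_cong)
      fix t assume "t \<in> {0..T}"
      have aux: "u = 2 * (s - x)" if "u / 2 + x = s" for u x s :: real using that by simp
      show "B1 t + B1 (- t) = 2 * ((\<Sum>l\<le>R. c l * ?g l t) - X t)"
        by (rule aux[OF bspec[OF comb \<open>t \<in> {0..T}\<close>, unfolded even_part_def[of B1]]])
    qed
    also have "\<dots> = 2 * integral {0..T} (\<lambda>t. (\<Sum>l\<le>R. c l * ?g l t) - X t)" by (rule integral_mult_right)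
    also have "integral {0..T} (\<lambda>t. (\<Sum>l\<le>R. c l * ?g l t) - X t) = integral {0..T} (\<lambda>t. \<Sum>l\<le>R. c l * ?g l t) - integral {0..T} X"
      by (intro integral_diff integrable_continuous_real continuous_on_sum continuous_on_mult continuous_on_const
          p0.cont_even_part[OF cf] X)
    finally show ?thesis using X0 int0 by simp
  qed
  from p.limit_cycles_from_simple_zeros[OF H(1) mel this]
  obtain \<epsilon> where \<epsilon>: "0 < \<epsilon>" "enat (2 * card H + 1) \<le> num_limit_cycles T (p.abel \<epsilon>)" .
  have "p.coefA \<epsilon> \<in> span_on {- T..T} f {0..n}"
    unfolding p.coefA_def[abs_def] using n
    by (intro span_on_add span_on_scale A1 span_on_base) auto
  moreover have "p.coefB \<epsilon> \<in> span_on {- T..T} f {0..m}"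
    unfolding p.coefB_def[abs_def] by (intro span_on_add span_on_scale b B1)
  ultimately have "num_limit_cycles T (\<lambda>t x. p.coefA \<epsilon> t * x ^ 3 + p.coefB \<epsilon> t * x ^ 2) \<le> H32 T f n m"
    unfolding H32_def by (intro SUP_upper2[of "(p.coefA \<epsilon>, p.coefB \<epsilon>)"]) auto
  then show ?thesis using \<epsilon>(2) H(2) unfolding p.abel_def[abs_def] by (simp add: order_trans)
qed

text \<open>Solved from the top: among the given rows only the last has a nonzero entry at the
  highest index. Entries at indices up to K are unconstrained.\<close>

lemma triangular_system:
  fixes e :: "nat \<Rightarrow> nat \<Rightarrow> real"
  assumes "\<And>q. q \<in> {1..Q} \<Longrightarrow> e q (K + q) \<noteq> 0" "\<And>q l. q \<in> {1..Q} \<Longrightarrow> K + q < l \<Longrightarrow> e q l = 0"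
  shows "\<exists>x. \<forall>l\<in>{K<..K + Q}. (\<Sum>q=1..Q. x q * e q l) = c l"
  using assms
proof (induction Q arbitrary: c)
  case 0
  show ?case by simp
next
  case (Suc Q)
  define y where "y = c (K + Suc Q) / e (Suc Q) (K + Suc Q)"
  have ne: "e (Suc Q) (K + Suc Q) \<noteq> 0" by (rule Suc.prems(1)) simp
  have "\<exists>x. \<forall>l\<in>{K<..K + Q}. (\<Sum>q=1..Q. x q * e q l) = c l - y * e (Suc Q) l"
    by (rule Suc.IH) (use Suc.prems in simp_all)
  then obtain x where x: "\<forall>l\<in>{K<..K + Q}. (\<Sum>q=1..Q. x q * e q l) = c l - y * e (Suc Q) l" by (rule exE)
  have eq: "(\<Sum>q=1..Suc Q. (x(Suc Q := y)) q * e q l) = (\<Sum>q=1..Q. x q * e q l) + y * e (Suc Q) l" for l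
    by simp
  show ?case
  proof (intro exI[of _ "x(Suc Q := y)"] ballI)
    fix l assume l: "l \<in> {K<..K + Suc Q}"
    show "(\<Sum>q=1..Suc Q. (x(Suc Q := y)) q * e q l) = c l"
    proof (cases "l = K + Suc Q")
      case True
      have "(\<Sum>q=1..Q. x q * e q l) = 0"
        using Suc.prems(2)[of _ l] True by (intro sum.neutral) auto
      then show ?thesis unfolding eq using ne by (simp add: True y_def)
    next
      case False
      then have "l \<in> {K<..K + Q}" using l by auto
      from bspec[OF x this] show ?thesis unfolding eq by simp
    qed
  qed
qed

text \<open>Only the coefficients above K are prescribed. Those of lower index are whatever the
  products bring along, which is why \<open>y\<close> is returned together with
  \<open>x\<close>.\<close>

lemma leading_term_reduction:
  fixes P W :: "nat \<Rightarrow> real \<Rightarrow> real"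
  assumes "\<And>q. q \<in> {1..Q} \<Longrightarrow> \<exists>e. e (K + q) \<noteq> 0 \<and> (\<forall>t\<in>S. P q t = (\<Sum>l=1..K + q. e l * W l t))"
  shows "\<exists>x y. (\<forall>l\<in>{K<..K + Q}. y l = c l) \<and>
    (\<forall>t\<in>S. (\<Sum>q=1..Q. x q * P q t) = (\<Sum>l=1..K + Q. y l * W l t))"
proof -
  have "\<forall>q\<in>{1..Q}. \<exists>e. e (K + q) \<noteq> 0 \<and> (\<forall>t\<in>S. P q t = (\<Sum>l=1..K + q. e l * W l t))"
    by (intro ballI assms)
  then obtain e where "\<forall>q\<in>{1..Q}. e q (K + q) \<noteq> 0 \<and> (\<forall>t\<in>S. P q t = (\<Sum>l=1..K + q. e q l * W l t))"
    by (rule bchoice[THEN exE])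
  then have e: "e q (K + q) \<noteq> 0" "t \<in> S \<Longrightarrow> P q t = (\<Sum>l=1..K + q. e q l * W l t)" if "q \<in> {1..Q}" for q t
    using that by simp_all
  define e' where "e' q l = (if l \<le> K + q then e q l else 0)" for q l
  have "\<exists>x. \<forall>l\<in>{K<..K + Q}. (\<Sum>q=1..Q. x q * e' q l) = c l"
    by (rule triangular_system) (use e(1) in \<open>simp_all add: e'_def\<close>)
  then obtain x where x: "\<forall>l\<in>{K<..K + Q}. (\<Sum>q=1..Q. x q * e' q l) = c l" by (rule exE)
  have P: "P q t = (\<Sum>l=1..K + Q. e' q l * W l t)" if "q \<in> {1..Q}" "t \<in> S" for q t
  proof -
    have "(\<Sum>l=1..K + Q. e' q l * W l t) = (\<Sum>l=1..K + q. e' q l * W l t)"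
      using that(1) by (intro sum.mono_neutral_right) (auto simp: e'_def)
    also have "\<dots> = (\<Sum>l=1..K + q. e q l * W l t)" by (intro sum.cong) (auto simp: e'_def)
    finally show ?thesis using e(2)[OF that] by simp
  qed
  have "(\<Sum>q=1..Q. x q * P q t) = (\<Sum>l=1..K + Q. (\<Sum>q=1..Q. x q * e' q l) * W l t)" if t: "t \<in> S" for t
  proof -
    have "(\<Sum>q=1..Q. x q * P q t) = (\<Sum>q=1..Q. \<Sum>l=1..K + Q. x q * e' q l * W l t)"
      by (intro sum.cong refl) (simp add: P[OF _ t] sum_distrib_left mult.assoc)
    also have "\<dots> = (\<Sum>l=1..K + Q. \<Sum>q=1..Q. x q * e' q l * W l t)" by (rule sum.swap)
    finally show ?thesis by (simp add: sum_distrib_right)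
  qed
  then show ?thesis using x
    by (intro exI[of _ x] exI[of _ "\<lambda>l. \<Sum>q=1..Q. x q * e' q l"] conjI ballI) simp_all
qed

section \<open>Enumeration of the odd and non-odd indices\<close>

lemma enumerate_le:
  fixes N :: "nat set"
  assumes "infinite N" "l < card (N \<inter> {0..k})"
  shows "enumerate N l \<le> k"
proof (rule ccontr)
  assume neg: "\<not> enumerate N l \<le> k"
  have "N \<inter> {0..k} \<subseteq> enumerate N ` {..<l}"
  proof
    fix x assume x: "x \<in> N \<inter> {0..k}"
    then obtain j where j: "enumerate N j = x" using enumerate_Ex[OF assms(1), of x] by blast
    have "j < l"
    proof (rule ccontr)
      assume "\<not> j < l"
      then have "enumerate N l \<le> enumerate N j" using enumerate_mono_le_iff[OF assms(1)] by simp
      then show False using neg j x by simp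
    qed
    then show "x \<in> enumerate N ` {..<l}" using j by blast
  qed
  then have "card (N \<inter> {0..k}) \<le> card (enumerate N ` {..<l})" by (intro card_mono) simp_all
  also have "\<dots> \<le> l" using card_image_le[of "{..<l}" "enumerate N"] by simp
  finally show False using assms(2) by simp
qed

lemma sorted_list_of_set_enumerate:
  fixes N :: "nat set"
  assumes N: "infinite N"
  shows "sorted_list_of_set (N \<inter> {0..enumerate N r}) = map (enumerate N) [0..<Suc r]"
proof -
  have "sorted_list_of_set (set (map (enumerate N) [0..<Suc r])) = map (enumerate N) [0..<Suc r]"
  proof (rule sorted_list_of_set.idem_if_sorted_distinct)
    show "sorted (map (enumerate N) [0..<Suc r])"
      unfolding sorted_map by (rule sorted_wrt_mono_rel[of _ "(\<le>)"]) (simp_all add: enumerate_mono_le_iff[OF N] del: upt_Suc)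
    show "distinct (map (enumerate N) [0..<Suc r])"
      using inj_on_subset[OF inj_enumerate[OF N] subset_UNIV] by (simp add: distinct_map del: upt_Suc)
  qed
  moreover have "set (map (enumerate N) [0..<Suc r]) = N \<inter> {0..enumerate N r}"
  proof (intro equalityI subsetI)
    fix x assume "x \<in> set (map (enumerate N) [0..<Suc r])"
    then obtain l where "l < Suc r" "x = enumerate N l" by (auto simp del: upt_Suc)
    then show "x \<in> N \<inter> {0..enumerate N r}"
      using enumerate_in_set[OF N] enumerate_mono_le_iff[OF N] by simp
  next
    fix x assume x: "x \<in> N \<inter> {0..enumerate N r}"
    then obtain l where l: "enumerate N l = x" using enumerate_Ex[OF N, of x] by blast
    have "enumerate N l \<le> enumerate N r" using x l by simp
    then have "l \<le> r" by (simp only: enumerate_mono_le_iff[OF N])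
    then show "x \<in> set (map (enumerate N) [0..<Suc r])" using l by (auto simp del: upt_Suc)
  qed
  ultimately show ?thesis by (simp only:)
qed

lemma CT_system_nth:
  assumes CT: "CT_system 0 T (map (\<lambda>i. even_part (f i)) L)" and len: "length L = Suc R"
    and c: "\<exists>l\<le>R. c l \<noteq> 0"
  shows "finite {t \<in> {0<..<T}. (\<Sum>l\<le>R. c l * even_part (f (L ! l)) t) = 0} \<and>
    card {t \<in> {0<..<T}. (\<Sum>l\<le>R. c l * even_part (f (L ! l)) t) = 0} \<le> R"
proof -
  let ?gs = "map (\<lambda>i. even_part (f i)) L"
  have eq: "(\<Sum>l\<le>R. c l * (?gs ! l) t) = (\<Sum>l\<le>R. c l * even_part (f (L ! l)) t)" for t
    using len by (intro sum.cong) auto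
  have "\<forall>k<length ?gs. \<forall>\<alpha> :: nat \<Rightarrow> real. (\<exists>i\<le>k. \<alpha> i \<noteq> 0) \<longrightarrow>
        finite {t \<in> {0<..<T}. (\<Sum>i\<le>k. \<alpha> i * (?gs ! i) t) = 0} \<and>
        card {t \<in> {0<..<T}. (\<Sum>i\<le>k. \<alpha> i * (?gs ! i) t) = 0} \<le> k"
    using CT unfolding CT_system_def by (rule conjunct2)
  from this[rule_format, of R c] show ?thesis using len c unfolding eq by simp
qed

lemma zero_non_odd:
  assumes "0 < T" "admissible_family T f"
  shows "0 \<in> non_odd T f"
proof -
  have "0 < f 0 0" using assms by (simp add: admissible_family_def)
  then have "even_part (f 0) 0 \<noteq> 0" by (simp add: even_part_def)
  then show ?thesis unfolding non_odd_def using assms(1) by (intro CollectI bexI[of _ 0]) auto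
qed

lemma card_non_odd_upto:
  assumes "0 < T" "admissible_family T f"
  shows "card (non_odd T f \<inter> {0..k}) = Suc (non_odd_count T f k)"
proof -
  have "0 \<in> non_odd T f \<inter> {0..k}" using zero_non_odd[OF assms] by simp
  then have "0 < card (non_odd T f \<inter> {0..k})" by (intro card_gt_0_iff[THEN iffD2]) auto
  then show ?thesis by (simp add: non_odd_count_def non_odd_upto_def)
qed

lemma H32_ge_first:
  assumes T: "0 < T" and adm: "admissible_family T f" and n: "1 \<le> n" and m: "1 \<le> m"
    and m1: "1 \<le> non_odd_count T f m" and a: "cond_a T f" and b: "cond_b T f"
  shows "enat (2 * non_odd_count T f m + 1) \<le> H32 T f n m"
proof -
  define L where "L = sorted_list_of_set (non_odd_upto T f m)"
  have len: "length L = Suc (non_odd_count T f m)"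
    unfolding L_def using card_non_odd_upto[OF T adm, of m] by (simp add: non_odd_upto_def)
  have set: "set L = non_odd T f \<inter> {0..m}" by (simp add: L_def non_odd_upto_def)
  have Lm: "L ! l \<in> {0..m}" if "l \<in> {..non_odd_count T f m}" for l
    using nth_mem[of l L] that len set by auto
  have "CT_system 0 T (map (\<lambda>i. even_part (f i)) L)"
    using b m by (simp add: cond_b_def L_def)
  note CT = CT_system_nth[OF this len]
  show ?thesis
  proof (rule H32_ge[where i = "\<lambda>l. L ! l", OF T adm a n m1 CT])
    fix c :: "nat \<Rightarrow> real"
    have zero: "(\<lambda>_. 0) \<in> span_on {- T..T} f K" for K
      unfolding span_on_def by (intro CollectI exI[of _ "\<lambda>_. 0"]) simp
    have "(\<lambda>t. \<Sum>l\<le>non_odd_count T f m. c l * f (L ! l) t) \<in> span_on {- T..T} f {0..m}"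
      by (rule span_on_sum) (use Lm in auto)
    with zero show "\<exists>A1 b B1 X. A1 \<in> span_on {- T..T} f {0..n} \<and> b \<in> span_on {- T..T} f {0..m} \<and>
        B1 \<in> span_on {- T..T} f {0..m} \<and> continuous_on {0..T} X \<and>
        (\<forall>t\<in>{- T..T}. b (- t) = - b t) \<and> integral {- T..T} A1 = 0 \<and> integral {0..T} X = 0 \<and>
        (\<forall>t\<in>{0..T}. b t * integral {0..t} (even_part A1) = - (integral {0..t} X * f 1 t)) \<and>
        (\<forall>t\<in>{0..T}. even_part B1 t + X t = (\<Sum>l\<le>non_odd_count T f m. c l * even_part (f (L ! l)) t))"
      by - (rule exI[of _ "\<lambda>_. 0"], rule exI[of _ "\<lambda>_. 0"],
          rule exI[of _ "\<lambda>t. \<Sum>l\<le>non_odd_count T f m. c l * f (L ! l) t"], rule exI[of _ "\<lambda>_. 0"],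
          simp add: even_part_sum)
  qed
qed

lemma integral_even_part:
  assumes "continuous_on {- T..T} g" "0 \<le> t" "t \<le> T"
  shows "integral {- t..t} g = 2 * integral {0..t} (even_part g)"
proof -
  have "integral {- t..t} g = integral {0..t} (\<lambda>s. g s + g (- s))"
    using assms by (intro integral_symmetric_interval continuous_on_subset[OF assms(1)]) auto
  also have "\<dots> = integral {0..t} (\<lambda>s. 2 * even_part g s)"
    by (intro integral_cong) (simp add: even_part_def)
  also have "\<dots> = 2 * integral {0..t} (even_part g)" by (rule integral_mult_right)
  finally show ?thesis .
qed

lemma continuous_even_part:
  assumes "continuous_on {- T..T} g"
  shows "continuous_on {- T..T} (even_part g)"
proof -
  have "continuous_on {- T..T} (\<lambda>t. g (- t))"
    by (rule continuous_on_compose2[OF assms]) (auto intro!: continuous_intros)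
  then show ?thesis unfolding even_part_def[abs_def]
    by (intro continuous_on_divide continuous_on_add continuous_on_const assms) simp_all
qed

text \<open>\<open>Fe\<close> integrates from -T, whereas \<open>\<Phi>\<close> integrates from 0.
  For a function of mean zero the two agree, because its even part has integral 0 over
  [-T, 0].\<close>

lemma Fe_eq:
  assumes g: "continuous_on {- T..T} (f k)" and zero: "integral {- T..T} (f k) = 0" and t: "t \<in> {0..T}"
  shows "Fe T f k t = integral {0..t} (even_part (f k))"
proof -
  have T: "0 \<le> T" using t by auto
  have c: "continuous_on {- T..T} (even_part (f k))" by (rule continuous_even_part[OF g])
  have ct: "continuous_on {- T..t} (even_part (f k))" by (rule continuous_on_subset[OF c]) (use t in auto)
  have "integral {0..T} (even_part (f k)) = 0" using integral_even_part[OF g T order_refl] zero by simp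
  moreover have "(\<lambda>x. even_part (f k) (- x)) = even_part (f k)"
    by (auto simp: even_part_def add.commute)
  ultimately have "integral {- T..0} (even_part (f k)) = 0"
    using Henstock_Kurzweil_Integration.integral_reflect_real[of T 0 "even_part (f k)"] by simp
  moreover have "integral {- T..0} (even_part (f k)) + integral {0..t} (even_part (f k)) = integral {- T..t} (even_part (f k))"
    by (rule Henstock_Kurzweil_Integration.integral_combine[OF _ _ integrable_continuous_real[OF ct]]) (use t in auto)
  ultimately show ?thesis by (simp add: Fe_def)
qed

lemma integral_even_part_sum:
  assumes "finite L" "\<And>l. l \<in> L \<Longrightarrow> continuous_on {- T..T} (g l)" "t \<in> {0..T}"
  shows "integral {0..t} (even_part (\<lambda>t. \<Sum>l\<in>L. c l * g l t)) = (\<Sum>l\<in>L. c l * integral {0..t} (even_part (g l)))"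
proof -
  have "integral {0..t} (even_part (\<lambda>t. \<Sum>l\<in>L. c l * g l t)) = integral {0..t} (\<lambda>t. \<Sum>l\<in>L. c l * even_part (g l) t)"
    by (intro integral_cong even_part_sum)
  also have "\<dots> = (\<Sum>l\<in>L. integral {0..t} (\<lambda>t. c l * even_part (g l) t))"
    using assms(1)
  proof (rule integral_sum)
    fix l assume "l \<in> L"
    then have "continuous_on {0..t} (even_part (g l))"
      by (intro continuous_on_subset[OF continuous_even_part[OF assms(2)]]) (use assms(3) in auto)
    then show "(\<lambda>t. c l * even_part (g l) t) integrable_on {0..t}"
      by (intro integrable_continuous_real continuous_on_mult continuous_on_const)
  qed
  also have "\<dots> = (\<Sum>l\<in>L. c l * integral {0..t} (even_part (g l)))"
    by (intro sum.cong refl integral_mult_right)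
  finally show ?thesis .
qed

text \<open>By (c) the product of the l-th primitive and the k-th odd function has leading index k +
  l - 1. The task is to cover the indices 0, ..., R by \<open>B1\<close> from below and by such
  products from above.\<close>

lemma H32_ge_second:
  assumes T: "0 < T" and adm: "admissible_family T f" and n: "1 \<le> n" and m: "1 \<le> m"
    and m1: "m1 = non_odd_count T f m" and n1: "n1 = non_odd_count T f n" and n1_pos: "1 \<le> n1"
    and a: "cond_a T f" and b: "cond_b T f" and c: "cond_c T f n m"
  shows "enat (2 * (m - m1 + n1) - 1) \<le> H32 T f n m"
proof -
  define N where "N = non_odd T f"
  have N: "infinite N" "infinite (- N)" using c by (simp_all add: cond_c_def N_def)
  \<comment> \<open>Non-odd functions are counted from 0 and odd ones from 1, while
    \<open>enumerate\<close> starts at 0; hence the shift in \<open>j\<close> only.\<close>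
  define i j where "i = enumerate N" and "j q = enumerate (- N) (q - 1)" for q
  \<comment> \<open>The number of odd functions among f_0, ..., f_m: m + 1 indices minus the m1 + 1
    non-odd ones.\<close>
  define k0 where "k0 = m - m1"
  have one: "1 \<in> - N"
  proof -
    have "even_part (f 1) t = 0" if "t \<in> {- T..T}" for t
      using a that by (simp add: cond_a_def even_part_def)
    then show ?thesis by (simp add: N_def non_odd_def)
  qed
  have zero: "0 \<in> N" using zero_non_odd[OF T adm] by (simp add: N_def)
  have cardN: "card (N \<inter> {0..k}) = Suc (non_odd_count T f k)" for k
    unfolding N_def by (rule card_non_odd_upto[OF T adm])
  have cardm: "card (- N \<inter> {0..m}) = k0"
  proof -
    have "card (N \<inter> {0..m}) + card (- N \<inter> {0..m}) = card ((N \<inter> {0..m}) \<union> (- N \<inter> {0..m}))"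
      by (rule card_Un_disjoint[symmetric]) auto
    also have "(N \<inter> {0..m}) \<union> (- N \<inter> {0..m}) = {0..m}" by auto
    finally show ?thesis unfolding cardN by (simp add: k0_def m1)
  qed
  have "0 < card (- N \<inter> {0..m})" using one m by (intro card_gt_0_iff[THEN iffD2]) auto
  then have k0: "1 \<le> k0" using cardm by simp
  have i0: "i 0 = 0" using zero by (simp add: i_def enumerate_0 Least_eq_0)
  have i_pos: "1 \<le> i l" if "1 \<le> l" for l
  proof -
    have "i 0 < i l" unfolding i_def by (rule enumerate_mono[OF _ N(1)]) (use that in simp)
    then show ?thesis using i0 by simp
  qed
  have i_m: "i l \<le> m" if "l \<le> m1" for l
    unfolding i_def by (rule enumerate_le[OF N(1)]) (use that in \<open>simp add: cardN m1\<close>)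
  have i_n: "i l \<le> n" if "l \<le> n1" for l
    unfolding i_def by (rule enumerate_le[OF N(1)]) (use that in \<open>simp add: cardN n1\<close>)
  have j_m: "j q \<le> m" if "1 \<le> q" "q \<le> k0" for q
    unfolding j_def by (rule enumerate_le[OF N(2)]) (use that in \<open>simp add: cardm\<close>)
  have j_odd: "f (j q) (- t) = - f (j q) t" if "t \<in> {- T..T}" for q t
  proof -
    have "j q \<in> - N" unfolding j_def by (rule enumerate_in_set[OF N(2)])
    then have "even_part (f (j q)) t = 0" using that by (simp add: N_def non_odd_def)
    then show ?thesis by (simp add: even_part_def)
  qed
  have fo: "fo_tilde T f q t = f (j q) t" if "t \<in> {- T..T}" for q t
    using j_odd[OF that, of q] by (simp add: fo_tilde_def j_def N_def odd_part_def)
  have j1: "j 1 = 1"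
  proof -
    have "(LEAST k. k \<in> - N) = 1"
      by (rule Least_equality) (use one zero in \<open>auto simp: Suc_le_eq intro!: gr0I\<close>)
    then show ?thesis by (simp add: j_def enumerate_0)
  qed
  have cf: "continuous_on {- T..T} (f k)" for k by (rule admissible_family_continuous[OF adm])
  have int0: "integral {- T..T} (f (i l)) = 0" if "1 \<le> l" for l
    using adm i_pos[OF that] by (simp add: admissible_family_def)
  define F where "F l t = integral {0..t} (even_part (f (i l)))" for l t
  have Fe: "Fe_tilde T f l t = F l t" if "1 \<le> l" "t \<in> {0..T}" for l t
    using Fe_eq[of T f "i l" t, OF cf int0[OF that(1)] that(2)] by (simp add: Fe_tilde_def F_def i_def N_def)
  have F_T: "F l T = 0" if "1 \<le> l" for l
    using integral_even_part[of T "f (i l)" T, OF cf] int0[OF that] T by (simp add: F_def)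
  have prod: "\<exists>e. e (k + l - 1) \<noteq> 0 \<and>
      (\<forall>t\<in>{0..T}. F l t * f (j k) t = (\<Sum>p=1..k + l - 1. e p * (F p t * f 1 t)))"
    if k: "1 \<le> k" and l: "1 \<le> l" for k l
  proof -
    let ?W = "\<lambda>p t. Fe_tilde T f p t * fo_tilde T f 1 t"
    have mem: "(\<lambda>t. Fe_tilde T f l t * fo_tilde T f k t) \<in> B_space T f (k + l - 1)"
      and nmem: "(\<lambda>t. Fe_tilde T f l t * fo_tilde T f k t) \<notin> B_space T f (k + l - 2)"
      using c k l by (auto simp: cond_c_def)
    obtain e where e: "\<forall>t\<in>{- T..T}. Fe_tilde T f l t * fo_tilde T f k t = (\<Sum>p\<in>{1..k + l - 1}. e p * ?W p t)"
      using mem unfolding B_space_def span_on_def by (elim CollectE exE)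
    have "e (k + l - 1) \<noteq> 0"
    proof
      assume 0: "e (k + l - 1) = 0"
      have "k + l - 1 = Suc (k + l - 2)" using k l by simp
      then have "(\<Sum>p\<in>{1..k + l - 1}. e p * ?W p t) = (\<Sum>p\<in>{1..k + l - 2}. e p * ?W p t)" for t
        using 0 by simp
      then have "(\<lambda>t. Fe_tilde T f l t * fo_tilde T f k t) \<in> B_space T f (k + l - 2)"
        using e unfolding B_space_def span_on_def by (intro CollectI exI[of _ e]) simp
      with nmem show False by (rule notE)
    qed
    moreover have "F l t * f (j k) t = (\<Sum>p=1..k + l - 1. e p * (F p t * f 1 t))" if t: "t \<in> {0..T}" for t
    proof -
      have tS: "t \<in> {- T..T}" using t by auto
      have "(\<Sum>p\<in>{1..k + l - 1}. e p * ?W p t) = (\<Sum>p=1..k + l - 1. e p * (F p t * f 1 t))"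
        by (intro sum.cong refl) (simp add: Fe[OF _ t] fo[OF tS] j1[unfolded One_nat_def])
      then show ?thesis using bspec[OF e tS] by (simp add: Fe[OF l t] fo[OF tS])
    qed
    ultimately show ?thesis by (intro exI[of _ e]) simp
  qed
  \<comment> \<open>The largest leading index of a product built from A in the span up to n and B in
    the span up to m.\<close>
  define R where "R = k0 + n1 - 1"
  have R: "1 \<le> R" using k0 n1_pos by (simp add: R_def)
  have CT: "finite {t \<in> {0<..<T}. (\<Sum>l\<le>R. d l * even_part (f (i l)) t) = 0} \<and>
        card {t \<in> {0<..<T}. (\<Sum>l\<le>R. d l * even_part (f (i l)) t) = 0} \<le> R"
    if d: "\<exists>l\<le>R. d l \<noteq> 0" for d
  proof -
    let ?L = "map i [0..<Suc R]"
    have "sorted_list_of_set (non_odd_upto T f (i R)) = ?L"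
      using sorted_list_of_set_enumerate[OF N(1), of R] by (simp add: non_odd_upto_def N_def i_def)
    moreover have "CT_system 0 T (map (\<lambda>i. even_part (f i)) (sorted_list_of_set (non_odd_upto T f (i R))))"
      using b i_pos[OF R] unfolding cond_b_def by blast
    ultimately have CT: "CT_system 0 T (map (\<lambda>i. even_part (f i)) ?L)" by simp
    have nth: "?L ! l = i l" if "l \<le> R" for l using that by (simp del: upt_Suc)
    have "(\<Sum>l\<le>R. d l * even_part (f (?L ! l)) t) = (\<Sum>l\<le>R. d l * even_part (f (i l)) t)" for t
      by (intro sum.cong refl) (simp add: nth del: upt_Suc)
    with CT_system_nth[OF CT _ d] show ?thesis by (simp del: upt_Suc)
  qed
  \<comment> \<open>\<open>P 1\<close>, ..., \<open>P Q\<close> are products with one factor frozen,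
    with leading indices K + 1, ..., K + Q. The indices 0, ..., K are left to \<open>B1\<close>,
    whence K \<le> m1. Freezing the available factor of highest index is what makes the range end at
    R.\<close>
  have "\<exists>K Q P. K \<le> m1 \<and> K + Q = R \<and>
      (\<forall>q\<in>{1..Q}. \<exists>e. e (K + q) \<noteq> 0 \<and> (\<forall>t\<in>{0..T}. P q t = (\<Sum>l=1..K + q. e l * (F l t * f 1 t)))) \<and>
      (\<forall>x. \<exists>A1 b. A1 \<in> span_on {- T..T} f {0..n} \<and> b \<in> span_on {- T..T} f {0..m} \<and>
         (\<forall>t\<in>{- T..T}. b (- t) = - b t) \<and> integral {- T..T} A1 = 0 \<and>
         (\<forall>t\<in>{0..T}. b t * integral {0..t} (even_part A1) = - (\<Sum>q=1..Q. x q * P q t)))"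
  \<comment> \<open>The inequality in (c) says that k0 - 1 \<le> m1 or n1 - 1 \<le> m1. In the first
    case the odd factor \<open>f (j k0)\<close> is frozen and \<open>A1\<close> varies; in the
    second the primitive \<open>F n1\<close> is frozen and \<open>b\<close> varies.\<close>
  proof (cases "k0 - 1 \<le> m1")
    case True
    let ?K = "k0 - 1" and ?P = "\<lambda>q t. F q t * f (j k0) t"
    have p1: "\<exists>e. e (?K + q) \<noteq> 0 \<and> (\<forall>t\<in>{0..T}. ?P q t = (\<Sum>l=1..?K + q. e l * (F l t * f 1 t)))"
      if "q \<in> {1..n1}" for q
      using prod[OF k0, of q] that k0 by simp
    have p2: "\<exists>A1 b. A1 \<in> span_on {- T..T} f {0..n} \<and> b \<in> span_on {- T..T} f {0..m} \<and>
         (\<forall>t\<in>{- T..T}. b (- t) = - b t) \<and> integral {- T..T} A1 = 0 \<and>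
         (\<forall>t\<in>{0..T}. b t * integral {0..t} (even_part A1) = - (\<Sum>q=1..n1. x q * ?P q t))" for x
    proof (rule exI[of _ "\<lambda>t. \<Sum>q=1..n1. x q * f (i q) t"], rule exI[of _ "\<lambda>t. (- 1) * f (j k0) t"],
        intro conjI ballI)
      show "(\<lambda>t. \<Sum>q=1..n1. x q * f (i q) t) \<in> span_on {- T..T} f {0..n}"
        by (rule span_on_sum) (use i_n in auto)
      show "(\<lambda>t. (- 1) * f (j k0) t) \<in> span_on {- T..T} f {0..m}"
        by (intro span_on_scale span_on_base) (use j_m k0 in auto)
      show "(- 1) * f (j k0) (- t) = - ((- 1) * f (j k0) t)" if "t \<in> {- T..T}" for t
        using j_odd[OF that] by simp
      have "integral {- T..T} (\<lambda>t. \<Sum>q=1..n1. x q * f (i q) t) = (\<Sum>q=1..n1. integral {- T..T} (\<lambda>t. x q * f (i q) t))"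
        by (intro integral_sum integrable_continuous_real continuous_on_mult continuous_on_const cf) simp
      also have "\<dots> = (\<Sum>q=1..n1. x q * integral {- T..T} (f (i q)))"
        by (intro sum.cong refl integral_mult_right)
      also have "\<dots> = 0" using int0 by (intro sum.neutral) simp
      finally show "integral {- T..T} (\<lambda>t. \<Sum>q=1..n1. x q * f (i q) t) = 0" .
      fix t assume t: "t \<in> {0..T}"
      show "(- 1) * f (j k0) t * integral {0..t} (even_part (\<lambda>t. \<Sum>q=1..n1. x q * f (i q) t)) = - (\<Sum>q=1..n1. x q * ?P q t)"
        unfolding integral_even_part_sum[of "{1..n1}" T "\<lambda>q. f (i q)" t x, OF finite_atLeastAtMost cf t] F_def
        by (simp add: sum_distrib_left sum_negf mult_ac)
    qed
    have sum: "?K + n1 = R" using k0 by (simp add: R_def)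
    show ?thesis
      by (rule exI[of _ ?K], rule exI[of _ n1], rule exI[of _ ?P], intro conjI allI ballI)
         (rule True sum p1 p2 | assumption)+
  next
    case False
    have "min (int m - int m1 - 1) (int n1 - 1) \<le> int m1"
      using c unfolding cond_c_def m1 n1 by (elim conjE)
    then have le: "n1 - 1 \<le> m1" using False unfolding k0_def by linarith
    let ?K = "n1 - 1" and ?P = "\<lambda>q t. F n1 t * f (j q) t"
    have p1: "\<exists>e. e (?K + q) \<noteq> 0 \<and> (\<forall>t\<in>{0..T}. ?P q t = (\<Sum>l=1..?K + q. e l * (F l t * f 1 t)))"
      if "q \<in> {1..k0}" for q
    proof -
      have "q + n1 - 1 = ?K + q" using n1_pos by simp
      then show ?thesis using prod[of q n1] that n1_pos by simp
    qed
    have p2: "\<exists>A1 b. A1 \<in> span_on {- T..T} f {0..n} \<and> b \<in> span_on {- T..T} f {0..m} \<and>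
         (\<forall>t\<in>{- T..T}. b (- t) = - b t) \<and> integral {- T..T} A1 = 0 \<and>
         (\<forall>t\<in>{0..T}. b t * integral {0..t} (even_part A1) = - (\<Sum>q=1..k0. x q * ?P q t))" for x
    proof (rule exI[of _ "f (i n1)"], rule exI[of _ "\<lambda>t. \<Sum>q=1..k0. - x q * f (j q) t"],
        intro conjI ballI)
      show "f (i n1) \<in> span_on {- T..T} f {0..n}"
        by (rule span_on_base) (use i_n in auto)
      show "(\<lambda>t. \<Sum>q=1..k0. - x q * f (j q) t) \<in> span_on {- T..T} f {0..m}"
        by (rule span_on_sum) (use j_m in auto)
      show "(\<Sum>q=1..k0. - x q * f (j q) (- t)) = - (\<Sum>q=1..k0. - x q * f (j q) t)" if "t \<in> {- T..T}" for t
        using j_odd[OF that] by (simp add: sum_negf)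
      show "integral {- T..T} (f (i n1)) = 0" by (rule int0[OF n1_pos])
      fix t assume t: "t \<in> {0..T}"
      show "(\<Sum>q=1..k0. - x q * f (j q) t) * integral {0..t} (even_part (f (i n1))) = - (\<Sum>q=1..k0. x q * ?P q t)"
        unfolding F_def by (simp add: sum_distrib_left sum_negf mult_ac)
    qed
    have sum: "?K + k0 = R" using n1_pos by (simp add: R_def)
    show ?thesis
      by (rule exI[of _ ?K], rule exI[of _ k0], rule exI[of _ ?P], intro conjI allI ballI)
         (rule le sum p1 p2 | assumption)+
  qed
  then obtain K Q P where K: "K \<le> m1" and KQ: "K + Q = R"
    and P: "\<forall>q\<in>{1..Q}. \<exists>e. e (K + q) \<noteq> 0 \<and> (\<forall>t\<in>{0..T}. P q t = (\<Sum>l=1..K + q. e l * (F l t * f 1 t)))"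
    and real: "\<forall>x. \<exists>A1 b. A1 \<in> span_on {- T..T} f {0..n} \<and> b \<in> span_on {- T..T} f {0..m} \<and>
         (\<forall>t\<in>{- T..T}. b (- t) = - b t) \<and> integral {- T..T} A1 = 0 \<and>
         (\<forall>t\<in>{0..T}. b t * integral {0..t} (even_part A1) = - (\<Sum>q=1..Q. x q * P q t))"
    by (elim exE conjE)
  have "enat (2 * R + 1) \<le> H32 T f n m"
  proof (rule H32_ge[where i = i, OF T adm a n R CT])
    fix d :: "nat \<Rightarrow> real"
    have "\<exists>x y. (\<forall>l\<in>{K<..K + Q}. y l = d l) \<and>
        (\<forall>t\<in>{0..T}. (\<Sum>q=1..Q. x q * P q t) = (\<Sum>l=1..K + Q. y l * (F l t * f 1 t)))"
      by (rule leading_term_reduction[OF bspec[OF P]])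
    then obtain x y where y: "\<forall>l\<in>{K<..K + Q}. y l = d l"
      and xy: "\<forall>t\<in>{0..T}. (\<Sum>q=1..Q. x q * P q t) = (\<Sum>l=1..K + Q. y l * (F l t * f 1 t))"
      by (elim exE conjE)
    obtain A1 b where A1: "A1 \<in> span_on {- T..T} f {0..n}" and b: "b \<in> span_on {- T..T} f {0..m}"
      and bo: "\<forall>t\<in>{- T..T}. b (- t) = - b t" and A10: "integral {- T..T} A1 = 0"
      and bA: "\<forall>t\<in>{0..T}. b t * integral {0..t} (even_part A1) = - (\<Sum>q=1..Q. x q * P q t)"
      using spec[OF real, of x] by (elim exE conjE)
    \<comment> \<open>The coefficients that the products contribute: they agree with
      \<open>d\<close> above K, while below \<open>B1\<close> corrects the difference. Products
      involve no index 0, as the primitives start at 1, so \<open>B1\<close> carries all of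
      \<open>d 0\<close>.\<close>
    define z where "z l = (if l = 0 then 0 else y l)" for l
    define B1 where "B1 t = (\<Sum>l\<le>K. (d l - z l) * f (i l) t)" for t
    define X0 where "X0 t = (\<Sum>l=1..R. y l * f (i l) t)" for t
    have intX: "integral {0..t} (even_part X0) = (\<Sum>l=1..R. y l * F l t)" if t: "t \<in> {0..T}" for t
      unfolding X0_def[abs_def] F_def by (rule integral_even_part_sum[OF _ cf t]) simp
    have "B1 \<in> span_on {- T..T} f {0..m}"
      unfolding B1_def[abs_def] by (rule span_on_sum) (use i_m K in auto)
    moreover have "continuous_on {0..T} (even_part X0)"
    proof -
      have "continuous_on {- T..T} X0" unfolding X0_def[abs_def]
        by (intro continuous_on_sum continuous_on_mult continuous_on_const cf)
      then show ?thesis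
        by (intro continuous_on_subset[OF continuous_even_part]) (use T in auto)
    qed
    moreover have "integral {0..T} (even_part X0) = 0"
      using T by (subst intX) (auto intro!: sum.neutral simp: F_T)
    moreover have "b t * integral {0..t} (even_part A1) = - (integral {0..t} (even_part X0) * f 1 t)" if t: "t \<in> {0..T}" for t
      unfolding intX[OF t] bspec[OF bA t] bspec[OF xy t] KQ by (simp add: sum_distrib_right mult.assoc)
    moreover have "even_part B1 t + even_part X0 t = (\<Sum>l\<le>R. d l * even_part (f (i l)) t)" for t
    proof -
      let ?g = "\<lambda>l. even_part (f (i l)) t"
      have "even_part B1 t = (\<Sum>l\<le>K. (d l - z l) * ?g l)"
        unfolding B1_def[abs_def] by (rule even_part_sum)
      also have "\<dots> = (\<Sum>l\<le>R. (d l - z l) * ?g l)"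
        using KQ y by (intro sum.mono_neutral_left) (auto simp: z_def)
      finally have 1: "even_part B1 t = (\<Sum>l\<le>R. (d l - z l) * ?g l)" .
      have "even_part X0 t = (\<Sum>l=1..R. y l * ?g l)"
        unfolding X0_def[abs_def] by (rule even_part_sum)
      also have "\<dots> = (\<Sum>l=1..R. z l * ?g l)" by (intro sum.cong) (auto simp: z_def)
      also have "\<dots> = (\<Sum>l\<le>R. z l * ?g l)"
        by (intro sum.mono_neutral_left) (auto simp: z_def)
      finally have 2: "even_part X0 t = (\<Sum>l\<le>R. z l * ?g l)" .
      show ?thesis unfolding 1 2 by (simp add: sum.distrib[symmetric] left_diff_distrib)
    qed
    ultimately show "\<exists>A1 b B1 X. A1 \<in> span_on {- T..T} f {0..n} \<and> b \<in> span_on {- T..T} f {0..m} \<and>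
        B1 \<in> span_on {- T..T} f {0..m} \<and> continuous_on {0..T} X \<and>
        (\<forall>t\<in>{- T..T}. b (- t) = - b t) \<and> integral {- T..T} A1 = 0 \<and> integral {0..T} X = 0 \<and>
        (\<forall>t\<in>{0..T}. b t * integral {0..t} (even_part A1) = - (integral {0..t} X * f 1 t)) \<and>
        (\<forall>t\<in>{0..T}. even_part B1 t + X t = (\<Sum>l\<le>R. d l * even_part (f (i l)) t))"
      using A1 b bo A10
      by - (rule exI[of _ A1], rule exI[of _ b], rule exI[of _ B1], rule exI[of _ "even_part X0"],
          intro conjI ballI; simp)
  qed
  moreover have "2 * R + 1 = 2 * (m - m1 + n1) - 1" using k0 n1_pos by (simp add: R_def k0_def)
  ultimately show ?thesis by (simp only:)
qed

theorem theorem2p3: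
  fixes T :: real and f :: "nat \<Rightarrow> real \<Rightarrow> real" and n m m1 n1 :: nat
  assumes "T > 0"
    and "admissible_family T f"
    and "n \<ge> 1" and "m \<ge> 1"
    and "m1 = non_odd_count T f m" and "n1 = non_odd_count T f n"
    and "m1 \<ge> 1" and "n1 \<ge> 1"
  shows "(cond_a T f \<and> cond_b T f \<longrightarrow> H32 T f n m \<ge> enat (2 * m1 + 1)) \<and>
    (cond_a T f \<and> cond_b T f \<and> cond_c T f n m \<longrightarrow>
       H32 T f n m \<ge> enat (2 * max (m - m1 + n1) (m1 + 1) - 1))"
proof (intro conjI impI; elim conjE)
  assume ab: "cond_a T f" "cond_b T f"
  have first: "enat (2 * m1 + 1) \<le> H32 T f n m"
    using H32_ge_first[OF assms(1-4) _ ab] assms(5,7) by simp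
  then show "enat (2 * m1 + 1) \<le> H32 T f n m" .
  assume c: "cond_c T f n m"
  have "enat (2 * (m - m1 + n1) - 1) \<le> H32 T f n m"
    by (rule H32_ge_second[OF assms(1-6,8) ab c])
  \<comment> \<open>The other entry of the maximum is the first part, since 2 (m1 + 1) - 1 = 2 m1 +
    1.\<close>
  with first show "enat (2 * max (m - m1 + n1) (m1 + 1) - 1) \<le> H32 T f n m"
    by (cases "m - m1 + n1 \<le> m1 + 1") (simp_all add: max_def)
qed

end
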